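(* Let $p \in [1, \infty) \setminus \{ 2 \}$, and let $A$ be a spatial $L^p$ AF algebra. Then $A$ has unique $L^p$ operator matrix norms.
   Context: All algebras are over $\mathbb{C}$; homomorphisms of algebras need not be unital. $L(E)$ is the Banach algebra of bounded operators on a Banach space $E$. An $L^p$ operator algebra is a Banach algebra isometrically isomorphic to a norm closed subalgebra of $L(L^p(X,\mu))$ for some measure space $(X,\mathcal{B},\mu)$. An isometric representation of $A$ on $L^p(X,\mu)$ is an isometric homomorphism $A\to L(L^p(X,\mu))$. Matrix norms of a concrete algebra: for a closed subalgebra $D\subset L(L^p(X,\mu))$, $M_n(D)$ is normed as a subalgebra of $L\big(L^p(\{1,\dots,n\}\times X,\ \nu\times\mu)\big)$, with $\nu$ counting measure. Unique $L^p$ operator matrix norms: a separable $L^p$ operator algebra $A$ has unique $L^p$ operator matrix norms if whenever $(X,\mathcal{B},\mu)$ and $(Y,\mathcal{C},\nu)$ are $\sigma$-finite measure spaces with $L^p(X,\mu)$ and $L^p(Y,\nu)$ separable, and $\pi\colon A\to L(L^p(X,\mu))$ and $\sigma\colon A\to L(L^p(Y,\nu))$ are isometric representations, then $\sigma\circ\pi^{-1}\colon\pi(A)\to\sigma(A)$ is completely isometric, i.e. for every $n \in \mathbb{Z}_{>0}$ the entrywise map $M_n(\pi(A))\to M_n(\sigma(A))$ is isometric when $M_n(\pi(A))$ is normed as a subalgebra of $L\big(L^p(\{1,\dots,n\}\times X,\ \kappa_n\times\mu)\big)$ and $M_n(\sigma(A))$ is normed as a subalgebra of $L\big(L^p(\{1,\dots,n\}\times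 Y,\ \kappa_n\times\nu)\big)$, with $\kappa_n$ counting measure on $\{1,\dots,n\}$. Matrix algebras: $l^p_d = l^p(\{1,\dots,d\})$ and $M_d^p = L(l^p_d)$ with the operator norm, algebraically identified with $M_d(\mathbb{C})$. A finite direct sum of Banach algebras is given the norm $\|(a_1,\dots,a_N)\| = \max_k \|a_k\|$. Hermitian idempotent: in a unital Banach algebra $B$ with $\|1\|=1$, an idempotent $e$ is hermitian if $\|\exp(i\lambda e)\| = 1$ for all $\lambda \in \mathbb{R}$. A spatial semisimple finite dimensional $L^p$ operator algebra is a Banach algebra isometrically isomorphic to $\bigoplus_{k=1}^N M_{d_k}^p$ for some $N, d_1,\dots,d_N \in \mathbb{Z}_{>0}$. A homomorphism $\varphi\colon \bigoplus_{k=1}^N M_{d_k}^p \to B$ between two such algebras is spatial if for every $k$ the restriction of $\varphi$ to the summand $M_{d_k}^p$ is contractive and sends the identity of $M_{d_k}^p$ to a hermitian idempotent of $B$ (the zero homomorphism is allowed). A spatial $L^p$ AF direct system consists of spatial semisimple finite dimensional $L^p$ operator algebras $A_m$ ($m \in \mathbb{Z}_{\ge 0}$) and contractive spatial homomorphisms $\varphi_{n,m}\colon A_m \to A_n$ ($m \le n$) with $\varphi_{m,m} = \mathrm{id}$ and $\varphi_{n,m}\circ\varphi_{m,k} = \varphi_{n,k}$. Its Banach algebra direct limit is the completion of the algebraic direct limit modulo elements of seminorm zero, for the seminorm that sends the class of $a\in A_m$ to $\lim_n \|\varphi_{n,m}(a)\|$. A spatial $L^p$ AF algebra is a Banach algebra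 isometrically isomorphic to the direct limit of a spatial $L^p$ AF direct system. (Such an algebra is a separable $L^p$ operator algebra.) *)

theory Defs
  imports "HOL-Analysis.Analysis"
begin

record 'a nspace =
  carrier_of :: "'a set"
  zero_of :: 'a
  add_of :: "'a \<Rightarrow> 'a \<Rightarrow> 'a"
  scale_of :: "complex \<Rightarrow> 'a \<Rightarrow> 'a"
  norm_of :: "'a \<Rightarrow> real"

record 'a nalg = "'a nspace" +
  mult_of :: "'a \<Rightarrow> 'a \<Rightarrow> 'a"

definition diff_of :: "('a, 'm) nspace_scheme \<Rightarrow> 'a \<Rightarrow> 'a \<Rightarrow> 'a" where
  "diff_of E x y = add_of E x (scale_of E (- 1) y)"

locale complex_normed_space =
  fixes E :: "('a, 'm) nspace_scheme"
  assumes zero_closed: "zero_of E \<in> carrier_of E"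
    and add_closed: "\<lbrakk>x \<in> carrier_of E; y \<in> carrier_of E\<rbrakk> \<Longrightarrow> add_of E x y \<in> carrier_of E"
    and scale_closed: "x \<in> carrier_of E \<Longrightarrow> scale_of E c x \<in> carrier_of E"
    and add_assoc: "\<lbrakk>x \<in> carrier_of E; y \<in> carrier_of E; z \<in> carrier_of E\<rbrakk>
      \<Longrightarrow> add_of E (add_of E x y) z = add_of E x (add_of E y z)"
    and add_comm: "\<lbrakk>x \<in> carrier_of E; y \<in> carrier_of E\<rbrakk> \<Longrightarrow> add_of E x y = add_of E y x"
    and add_zero: "x \<in> carrier_of E \<Longrightarrow> add_of E x (zero_of E) = x"
    and diff_self: "x \<in> carrier_of E \<Longrightarrow> diff_of E x x = zero_of E"
    and scale_add: "\<lbrakk>x \<in> carrier_of E; y \<in> carrier_of E\<rbrakk>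
      \<Longrightarrow> scale_of E c (add_of E x y) = add_of E (scale_of E c x) (scale_of E c y)"
    and add_scale: "x \<in> carrier_of E
      \<Longrightarrow> scale_of E (c + d) x = add_of E (scale_of E c x) (scale_of E d x)"
    and scale_scale: "x \<in> carrier_of E \<Longrightarrow> scale_of E c (scale_of E d x) = scale_of E (c * d) x"
    and scale_one: "x \<in> carrier_of E \<Longrightarrow> scale_of E 1 x = x"
    and norm_nonneg: "x \<in> carrier_of E \<Longrightarrow> 0 \<le> norm_of E x"
    and norm_eq_zero: "x \<in> carrier_of E \<Longrightarrow> norm_of E x = 0 \<longleftrightarrow> x = zero_of E"
    and norm_scale: "x \<in> carrier_of E \<Longrightarrow> norm_of E (scale_of E c x) = cmod c * norm_of E x"
    and norm_triangle: "\<lbrakk>x \<in> carrier_of E; y \<in> carrier_of E\<rbrakk>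
      \<Longrightarrow> norm_of E (add_of E x y) \<le> norm_of E x + norm_of E y"

locale complex_normed_algebra = complex_normed_space A for A :: "('a, 'm) nalg_scheme" +
  assumes mult_closed: "\<lbrakk>x \<in> carrier_of A; y \<in> carrier_of A\<rbrakk> \<Longrightarrow> mult_of A x y \<in> carrier_of A"
    and mult_assoc: "\<lbrakk>x \<in> carrier_of A; y \<in> carrier_of A; z \<in> carrier_of A\<rbrakk>
      \<Longrightarrow> mult_of A (mult_of A x y) z = mult_of A x (mult_of A y z)"
    and mult_add_left: "\<lbrakk>x \<in> carrier_of A; y \<in> carrier_of A; z \<in> carrier_of A\<rbrakk>
      \<Longrightarrow> mult_of A (add_of A x y) z = add_of A (mult_of A x z) (mult_of A y z)"
    and mult_add_right: "\<lbrakk>x \<in> carrier_of A; y \<in> carrier_of A; z \<in> carrier_of A\<rbrakk>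
      \<Longrightarrow> mult_of A x (add_of A y z) = add_of A (mult_of A x y) (mult_of A x z)"
    and mult_scale_left: "\<lbrakk>x \<in> carrier_of A; y \<in> carrier_of A\<rbrakk>
      \<Longrightarrow> mult_of A (scale_of A c x) y = scale_of A c (mult_of A x y)"
    and mult_scale_right: "\<lbrakk>x \<in> carrier_of A; y \<in> carrier_of A\<rbrakk>
      \<Longrightarrow> mult_of A x (scale_of A c y) = scale_of A c (mult_of A x y)"
    and norm_mult: "\<lbrakk>x \<in> carrier_of A; y \<in> carrier_of A\<rbrakk>
      \<Longrightarrow> norm_of A (mult_of A x y) \<le> norm_of A x * norm_of A y"

definition converges_to :: "('a, 'm) nspace_scheme \<Rightarrow> (nat \<Rightarrow> 'a) \<Rightarrow> 'a \<Rightarrow> bool" where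
  "converges_to E s l \<longleftrightarrow> (\<lambda>n. norm_of E (diff_of E (s n) l)) \<longlonglongrightarrow> 0"

definition cauchy_in :: "('a, 'm) nspace_scheme \<Rightarrow> (nat \<Rightarrow> 'a) \<Rightarrow> bool" where
  "cauchy_in E s \<longleftrightarrow>
     (\<forall>\<epsilon>>0. \<exists>K. \<forall>m\<ge>K. \<forall>n\<ge>K. norm_of E (diff_of E (s m) (s n)) < \<epsilon>)"

locale banach_algebra = complex_normed_algebra A for A :: "('a, 'm) nalg_scheme" +
  assumes complete: "\<lbrakk>\<And>n. s n \<in> carrier_of A; cauchy_in A s\<rbrakk>
    \<Longrightarrow> \<exists>l\<in>carrier_of A. converges_to A s l"

definition dense_in :: "('a, 'm) nspace_scheme \<Rightarrow> 'a set \<Rightarrow> bool" where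
  "dense_in E D \<longleftrightarrow> D \<subseteq> carrier_of E \<and>
     (\<forall>x\<in>carrier_of E. \<forall>\<epsilon>>0. \<exists>d\<in>D. norm_of E (diff_of E x d) < \<epsilon>)"

definition separable_space :: "('a, 'm) nspace_scheme \<Rightarrow> bool" where
  "separable_space E \<longleftrightarrow> (\<exists>D. countable D \<and> dense_in E D)"

text \<open>Homomorphisms are not required to preserve units.\<close>

definition algebra_hom ::
    "('a, 'm) nalg_scheme \<Rightarrow> ('b, 'n) nalg_scheme \<Rightarrow> ('a \<Rightarrow> 'b) \<Rightarrow> bool" where
  "algebra_hom A B f \<longleftrightarrow>
     f \<in> carrier_of A \<rightarrow> carrier_of B \<and>
     (\<forall>x\<in>carrier_of A. \<forall>y\<in>carrier_of A. f (add_of A x y) = add_of B (f x) (f y)) \<and>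
     (\<forall>x\<in>carrier_of A. \<forall>c. f (scale_of A c x) = scale_of B c (f x)) \<and>
     (\<forall>x\<in>carrier_of A. \<forall>y\<in>carrier_of A. f (mult_of A x y) = mult_of B (f x) (f y))"

definition contractive ::
    "('a, 'm) nspace_scheme \<Rightarrow> ('b, 'n) nspace_scheme \<Rightarrow> ('a \<Rightarrow> 'b) \<Rightarrow> bool" where
  "contractive E F f \<longleftrightarrow> (\<forall>x\<in>carrier_of E. norm_of F (f x) \<le> norm_of E x)"

definition isometric_hom ::
    "('a, 'm) nalg_scheme \<Rightarrow> ('b, 'n) nalg_scheme \<Rightarrow> ('a \<Rightarrow> 'b) \<Rightarrow> bool" where
  "isometric_hom A B f \<longleftrightarrow>
     algebra_hom A B f \<and> (\<forall>x\<in>carrier_of A. norm_of B (f x) = norm_of A x)"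

definition isometric_iso ::
    "('a, 'm) nalg_scheme \<Rightarrow> ('b, 'n) nalg_scheme \<Rightarrow> ('a \<Rightarrow> 'b) \<Rightarrow> bool" where
  "isometric_iso A B f \<longleftrightarrow> isometric_hom A B f \<and> bij_betw f (carrier_of A) (carrier_of B)"

definition is_unit_of :: "('a, 'm) nalg_scheme \<Rightarrow> 'a \<Rightarrow> bool" where
  "is_unit_of B u \<longleftrightarrow> u \<in> carrier_of B \<and>
     (\<forall>x\<in>carrier_of B. mult_of B u x = x \<and> mult_of B x u = x)"

definition unit_of :: "('a, 'm) nalg_scheme \<Rightarrow> 'a" where
  "unit_of B = (THE u. is_unit_of B u)"

primrec power_of :: "('a, 'm) nalg_scheme \<Rightarrow> 'a \<Rightarrow> nat \<Rightarrow> 'a" where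
  "power_of B a 0 = unit_of B"
| "power_of B a (Suc n) = mult_of B (power_of B a n) a"

text \<open>The partial sum of the terms of index less than \<open>n\<close> of the exponential series.\<close>

primrec exp_partial :: "('a, 'm) nalg_scheme \<Rightarrow> 'a \<Rightarrow> nat \<Rightarrow> 'a" where
  "exp_partial B a 0 = zero_of B"
| "exp_partial B a (Suc n) =
     add_of B (exp_partial B a n) (scale_of B (1 / fact n) (power_of B a n))"

definition exp_of :: "('a, 'm) nalg_scheme \<Rightarrow> 'a \<Rightarrow> 'a" where
  "exp_of B a = (THE s. s \<in> carrier_of B \<and> converges_to B (exp_partial B a) s)"

definition hermitian_idempotent :: "('a, 'm) nalg_scheme \<Rightarrow> 'a \<Rightarrow> bool" where
  "hermitian_idempotent B e \<longleftrightarrow>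
     banach_algebra B \<and> (\<exists>u. is_unit_of B u) \<and> norm_of B (unit_of B) = 1 \<and>
     e \<in> carrier_of B \<and> mult_of B e e = e \<and>
     (\<forall>t::real. norm_of B (exp_of B (scale_of B (\<i> * of_real t) e)) = 1)"

text \<open>
  Operators are extensional functions on the carrier, so that equality of operators is equality
  of functions.
\<close>

definition bounded_operators :: "('a, 'm) nspace_scheme \<Rightarrow> ('a \<Rightarrow> 'a) nalg" where
  "bounded_operators E = \<lparr>
     carrier_of = {T \<in> carrier_of E \<rightarrow>\<^sub>E carrier_of E.
       (\<forall>x\<in>carrier_of E. \<forall>y\<in>carrier_of E. T (add_of E x y) = add_of E (T x) (T y)) \<and>
       (\<forall>x\<in>carrier_of E. \<forall>c. T (scale_of E c x) = scale_of E c (T x)) \<and>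
       (\<exists>C. \<forall>x\<in>carrier_of E. norm_of E (T x) \<le> C * norm_of E x)},
     zero_of = (\<lambda>x\<in>carrier_of E. zero_of E),
     add_of = (\<lambda>S T. \<lambda>x\<in>carrier_of E. add_of E (S x) (T x)),
     scale_of = (\<lambda>c T. \<lambda>x\<in>carrier_of E. scale_of E c (T x)),
     norm_of = (\<lambda>T. SUP x\<in>{x \<in> carrier_of E. norm_of E x \<le> 1}. norm_of E (T x)),
     mult_of = (\<lambda>S T. \<lambda>x\<in>carrier_of E. S (T x))\<rparr>"

definition Lp_functions :: "real \<Rightarrow> 'x measure \<Rightarrow> ('x \<Rightarrow> complex) set" where
  "Lp_functions p M =
     {f \<in> borel_measurable M. integrable M (\<lambda>x. cmod (f x) powr p)}"

definition Lp_class :: "real \<Rightarrow> 'x measure \<Rightarrow> ('x \<Rightarrow> complex) \<Rightarrow> ('x \<Rightarrow> complex) set" where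
  "Lp_class p M f = {g \<in> Lp_functions p M. AE x in M. g x = f x}"

text \<open>
  Elements of \<open>L\<^sup>p\<close> are almost everywhere classes of functions; the unions below are
  unions of one and the same class over all choices of representatives.
\<close>

definition Lp :: "real \<Rightarrow> 'x measure \<Rightarrow> ('x \<Rightarrow> complex) set nspace" where
  "Lp p M = \<lparr>
     carrier_of = Lp_class p M ` Lp_functions p M,
     zero_of = Lp_class p M (\<lambda>_. 0),
     add_of = (\<lambda>F G. \<Union>f\<in>F. \<Union>g\<in>G. Lp_class p M (\<lambda>x. f x + g x)),
     scale_of = (\<lambda>c F. \<Union>f\<in>F. Lp_class p M (\<lambda>x. c * f x)),
     norm_of = (\<lambda>F. (LINT x|M. cmod ((SOME f. f \<in> F) x) powr p) powr (1 / p))\<rparr>"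

definition isometric_representation ::
    "real \<Rightarrow> ('a, 'm) nalg_scheme \<Rightarrow> 'x measure
      \<Rightarrow> ('a \<Rightarrow> ('x \<Rightarrow> complex) set \<Rightarrow> ('x \<Rightarrow> complex) set) \<Rightarrow> bool" where
  "isometric_representation p A M \<pi> \<longleftrightarrow> isometric_hom A (bounded_operators (Lp p M)) \<pi>"

abbreviation amplified_measure :: "nat \<Rightarrow> 'x measure \<Rightarrow> (nat \<times> 'x) measure" where
  "amplified_measure n M \<equiv> count_space {1..n} \<Otimes>\<^sub>M M"

definition Lp_slice ::
    "real \<Rightarrow> 'x measure \<Rightarrow> nat \<Rightarrow> (nat \<times> 'x \<Rightarrow> complex) set \<Rightarrow> ('x \<Rightarrow> complex) set" where
  "Lp_slice p M j F = (\<Union>f\<in>F. Lp_class p M (\<lambda>x. f (j, x)))"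

text \<open>
  The operator of a matrix \<open>b\<close> of operators: the slice over \<open>i\<close> of the image of \<open>F\<close> is the sum
  over \<open>j\<close> of the images under \<open>b i j\<close> of the slices of \<open>F\<close>. Here \<open>g i j\<close> runs through
  the representatives of the summands.
\<close>

definition matrix_operator ::
    "real \<Rightarrow> 'x measure \<Rightarrow> nat
      \<Rightarrow> (nat \<Rightarrow> nat \<Rightarrow> ('x \<Rightarrow> complex) set \<Rightarrow> ('x \<Rightarrow> complex) set)
      \<Rightarrow> (nat \<times> 'x \<Rightarrow> complex) set \<Rightarrow> (nat \<times> 'x \<Rightarrow> complex) set" where
  "matrix_operator p M n b = (\<lambda>F\<in>carrier_of (Lp p (amplified_measure n M)).
     {h \<in> Lp_functions p (amplified_measure n M).
       \<exists>g. (\<forall>i\<in>{1..n}. \<forall>j\<in>{1..n}. g i j \<in> b i j (Lp_slice p M j F)) \<and>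
           (\<forall>i\<in>{1..n}. AE x in M. h (i, x) = (\<Sum>j\<in>{1..n}. g i j x))})"

definition matrix_norm ::
    "real \<Rightarrow> 'x measure \<Rightarrow> nat
      \<Rightarrow> (nat \<Rightarrow> nat \<Rightarrow> ('x \<Rightarrow> complex) set \<Rightarrow> ('x \<Rightarrow> complex) set) \<Rightarrow> real" where
  "matrix_norm p M n b =
     norm_of (bounded_operators (Lp p (amplified_measure n M))) (matrix_operator p M n b)"

definition completely_isometric_on ::
    "real \<Rightarrow> 'x measure \<Rightarrow> 'y measure
      \<Rightarrow> (('x \<Rightarrow> complex) set \<Rightarrow> ('x \<Rightarrow> complex) set) set
      \<Rightarrow> ((('x \<Rightarrow> complex) set \<Rightarrow> ('x \<Rightarrow> complex) set)
          \<Rightarrow> ('y \<Rightarrow> complex) set \<Rightarrow> ('y \<Rightarrow> complex) set) \<Rightarrow> bool" where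
  "completely_isometric_on p M N D \<psi> \<longleftrightarrow>
     (\<forall>n>0. \<forall>b. (\<forall>i\<in>{1..n}. \<forall>j\<in>{1..n}. b i j \<in> D) \<longrightarrow>
        matrix_norm p N n (\<lambda>i j. \<psi> (b i j)) = matrix_norm p M n b)"

text \<open>
  The type arguments are those of the points of the two measure spaces. They only occur because
  a definition cannot quantify over types.
\<close>

definition unique_Lp_operator_matrix_norms ::
    "'x itself \<Rightarrow> 'y itself \<Rightarrow> real \<Rightarrow> ('a, 'm) nalg_scheme \<Rightarrow> bool" where
  "unique_Lp_operator_matrix_norms TX TY p A \<longleftrightarrow>
     (\<forall>(M :: 'x measure) (N :: 'y measure) \<pi> \<sigma>.
        sigma_finite_measure M \<and> separable_space (Lp p M) \<and>
        sigma_finite_measure N \<and> separable_space (Lp p N) \<and>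
        isometric_representation p A M \<pi> \<and> isometric_representation p A N \<sigma> \<longrightarrow>
        completely_isometric_on p M N (\<pi> ` carrier_of A)
          (\<sigma> \<circ> inv_into (carrier_of A) \<pi>))"

definition matrix_algebra ::
    "real \<Rightarrow> nat \<Rightarrow> ((nat \<Rightarrow> complex) set \<Rightarrow> (nat \<Rightarrow> complex) set) nalg" where
  "matrix_algebra p d = bounded_operators (Lp p (count_space {1..d}))"

definition direct_sum :: "nat \<Rightarrow> (nat \<Rightarrow> 'a nalg) \<Rightarrow> (nat \<Rightarrow> 'a) nalg" where
  "direct_sum N B = \<lparr>
     carrier_of = (\<Pi>\<^sub>E k\<in>{1..N}. carrier_of (B k)),
     zero_of = (\<lambda>k\<in>{1..N}. zero_of (B k)),
     add_of = (\<lambda>x y. \<lambda>k\<in>{1..N}. add_of (B k) (x k) (y k)),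
     scale_of = (\<lambda>c x. \<lambda>k\<in>{1..N}. scale_of (B k) c (x k)),
     norm_of = (\<lambda>x. Max ((\<lambda>k. norm_of (B k) (x k)) ` {1..N})),
     mult_of = (\<lambda>x y. \<lambda>k\<in>{1..N}. mult_of (B k) (x k) (y k))\<rparr>"

definition summand_embedding :: "nat \<Rightarrow> (nat \<Rightarrow> 'a nalg) \<Rightarrow> nat \<Rightarrow> 'a \<Rightarrow> nat \<Rightarrow> 'a" where
  "summand_embedding N B k x = (\<lambda>l\<in>{1..N}. if l = k then x else zero_of (B l))"

definition block_algebra ::
    "real \<Rightarrow> nat \<Rightarrow> (nat \<Rightarrow> nat)
      \<Rightarrow> (nat \<Rightarrow> (nat \<Rightarrow> complex) set \<Rightarrow> (nat \<Rightarrow> complex) set) nalg" where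
  "block_algebra p N d = direct_sum N (\<lambda>k. matrix_algebra p (d k))"

definition block_presentation ::
    "real \<Rightarrow> nat \<Rightarrow> (nat \<Rightarrow> nat) \<Rightarrow> ('a, 'm) nalg_scheme
      \<Rightarrow> ((nat \<Rightarrow> (nat \<Rightarrow> complex) set \<Rightarrow> (nat \<Rightarrow> complex) set) \<Rightarrow> 'a) \<Rightarrow> bool" where
  "block_presentation p N d A \<theta> \<longleftrightarrow>
     N > 0 \<and> (\<forall>k\<in>{1..N}. d k > 0) \<and> isometric_iso (block_algebra p N d) A \<theta>"

definition spatial_fd_algebra :: "real \<Rightarrow> ('a, 'm) nalg_scheme \<Rightarrow> bool" where
  "spatial_fd_algebra p A \<longleftrightarrow>
     banach_algebra A \<and> (\<exists>N d \<theta>. block_presentation p N d A \<theta>)"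

text \<open>
  The choice of the presentation of \<open>A\<close> as a direct sum of matrix algebras is immaterial:
  isomorphisms of such sums permute the summands.
\<close>

definition spatial_hom ::
    "real \<Rightarrow> ('a, 'm) nalg_scheme \<Rightarrow> ('b, 'n) nalg_scheme \<Rightarrow> ('a \<Rightarrow> 'b) \<Rightarrow> bool" where
  "spatial_hom p A B \<phi> \<longleftrightarrow>
     spatial_fd_algebra p A \<and> spatial_fd_algebra p B \<and> algebra_hom A B \<phi> \<and>
     (\<exists>N d \<theta>. block_presentation p N d A \<theta> \<and>
       (\<forall>k\<in>{1..N}.
          let \<phi>\<^sub>k = \<phi> \<circ> \<theta> \<circ> summand_embedding N (\<lambda>k. matrix_algebra p (d k)) k in
          contractive (matrix_algebra p (d k)) B \<phi>\<^sub>k \<and>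
          hermitian_idempotent B (\<phi>\<^sub>k (unit_of (matrix_algebra p (d k))))))"

text \<open>The map \<open>\<phi> n m\<close> goes from \<open>A m\<close> to \<open>A n\<close>; only its values for \<open>m \<le> n\<close> matter.\<close>

definition spatial_AF_system ::
    "real \<Rightarrow> (nat \<Rightarrow> 'b nalg) \<Rightarrow> (nat \<Rightarrow> nat \<Rightarrow> 'b \<Rightarrow> 'b) \<Rightarrow> bool" where
  "spatial_AF_system p A \<phi> \<longleftrightarrow>
     (\<forall>m. spatial_fd_algebra p (A m)) \<and>
     (\<forall>m n. m \<le> n \<longrightarrow>
        spatial_hom p (A m) (A n) (\<phi> n m) \<and> contractive (A m) (A n) (\<phi> n m)) \<and>
     (\<forall>m. \<forall>a\<in>carrier_of (A m). \<phi> m m a = a) \<and>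
     (\<forall>k m n. k \<le> m \<and> m \<le> n \<longrightarrow>
        (\<forall>a\<in>carrier_of (A k). \<phi> n m (\<phi> m k a) = \<phi> n k a))"

definition limit_rel ::
    "(nat \<Rightarrow> 'b nalg) \<Rightarrow> (nat \<Rightarrow> nat \<Rightarrow> 'b \<Rightarrow> 'b) \<Rightarrow> ((nat \<times> 'b) \<times> (nat \<times> 'b)) set" where
  "limit_rel A \<phi> = {((m, a), (n, b)).
     a \<in> carrier_of (A m) \<and> b \<in> carrier_of (A n) \<and> (\<exists>k. m \<le> k \<and> n \<le> k \<and> \<phi> k m a = \<phi> k n b)}"

definition limit_class ::
    "(nat \<Rightarrow> 'b nalg) \<Rightarrow> (nat \<Rightarrow> nat \<Rightarrow> 'b \<Rightarrow> 'b) \<Rightarrow> nat \<Rightarrow> 'b \<Rightarrow> (nat \<times> 'b) set" where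
  "limit_class A \<phi> m a = limit_rel A \<phi> `` {(m, a)}"

text \<open>The norm component of the algebraic direct limit is only a seminorm.\<close>

definition algebraic_limit ::
    "(nat \<Rightarrow> 'b nalg) \<Rightarrow> (nat \<Rightarrow> nat \<Rightarrow> 'b \<Rightarrow> 'b) \<Rightarrow> (nat \<times> 'b) set nalg" where
  "algebraic_limit A \<phi> = \<lparr>
     carrier_of = (SIGMA m:UNIV. carrier_of (A m)) // limit_rel A \<phi>,
     zero_of = limit_class A \<phi> 0 (zero_of (A 0)),
     add_of = (\<lambda>X Y. \<Union>(m, a)\<in>X. \<Union>(n, b)\<in>Y.
       limit_class A \<phi> (max m n)
         (add_of (A (max m n)) (\<phi> (max m n) m a) (\<phi> (max m n) n b))),
     scale_of = (\<lambda>c X. \<Union>(m, a)\<in>X. limit_class A \<phi> m (scale_of (A m) c a)),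
     norm_of = (\<lambda>X. case (SOME x. x \<in> X) of (m, a) \<Rightarrow> lim (\<lambda>n. norm_of (A n) (\<phi> n m a))),
     mult_of = (\<lambda>X Y. \<Union>(m, a)\<in>X. \<Union>(n, b)\<in>Y.
       limit_class A \<phi> (max m n)
         (mult_of (A (max m n)) (\<phi> (max m n) m a) (\<phi> (max m n) n b)))\<rparr>"

definition null_rel :: "'c nalg \<Rightarrow> ('c \<times> 'c) set" where
  "null_rel D = {(x, y). x \<in> carrier_of D \<and> y \<in> carrier_of D \<and> norm_of D (diff_of D x y) = 0}"

definition null_quotient :: "'c nalg \<Rightarrow> 'c set nalg" where
  "null_quotient D = \<lparr>
     carrier_of = carrier_of D // null_rel D,
     zero_of = null_rel D `` {zero_of D},
     add_of = (\<lambda>X Y. \<Union>x\<in>X. \<Union>y\<in>Y. null_rel D `` {add_of D x y}),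
     scale_of = (\<lambda>c X. \<Union>x\<in>X. null_rel D `` {scale_of D c x}),
     norm_of = (\<lambda>X. norm_of D (SOME x. x \<in> X)),
     mult_of = (\<lambda>X Y. \<Union>x\<in>X. \<Union>y\<in>Y. null_rel D `` {mult_of D x y})\<rparr>"

definition is_completion :: "'c nalg \<Rightarrow> ('a, 'm) nalg_scheme \<Rightarrow> bool" where
  "is_completion D A \<longleftrightarrow> banach_algebra A \<and>
     (\<exists>\<iota>. isometric_hom D A \<iota> \<and> dense_in A (\<iota> ` carrier_of D))"

text \<open>
  Completions are determined up to isometric isomorphism, so \<open>is_completion\<close> already expresses
  that \<open>A\<close> is isometrically isomorphic to the direct limit. The type argument is the type that
  holds the algebras of the system; every system has an isometric copy in the type of
  \<open>block_algebra\<close>.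
\<close>

definition spatial_Lp_AF_algebra ::
    "'b itself \<Rightarrow> real \<Rightarrow> ('a, 'm) nalg_scheme \<Rightarrow> bool" where
  "spatial_Lp_AF_algebra TB p A \<longleftrightarrow>
     (\<exists>(S :: nat \<Rightarrow> 'b nalg) \<phi>. spatial_AF_system p S \<phi> \<and>
        is_completion (null_quotient (algebraic_limit S \<phi>)) A)"

end

theory Submission
  imports Defs
begin

text \<open>
  It is enough to compute the norm of a matrix over the image of an isometric representation from
  data that do not mention the representation.

  \<^emph>\<open>Direct sums of matrix algebras.\<close> Let \<open>\<rho>\<close> be a contractive representation of a direct sum of matrix
  algebras on \<open>L\<^sup>p\<close>, and let \<open>E k i j\<close> be the images of the matrix units. Since \<open>\<rho> 1\<close> is only a
  contractive idempotent, its range need not consist of all functions supported on some set, and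
  the classical description of the isometries of \<open>L\<^sup>p\<close> spaces does not apply to it as it stands. One
  can argue with the functions themselves. For \<open>\<bar>\<lambda>\<bar> = 1\<close> and two different diagonal idempotents \<open>e\<close> and
  \<open>d\<close> the operator \<open>e + \<lambda>d\<close> is a contraction of all of \<open>L\<^sup>p\<close>, and for \<open>p \<noteq> 2\<close> this forces functions \<open>f\<close>
  and \<open>g\<close> in the ranges of \<open>e\<close> and \<open>d\<close> to have disjoint supports (\<open>ranges_disjoint\<close>). For \<open>p > 1\<close>
  the derivative of \<open>\<integral>\<bar>F\<bar>\<^sup>p\<close> is given by the functional of \<open>F\<close> in the dual space, and applying the contractions
  shows that the functional of \<open>f + \<lambda>g\<close> has the form \<open>u + \<lambda>\<^sup>-\<^sup>1v\<close>, with \<open>u\<close> and \<open>v\<close> independent of \<open>\<lambda>\<close>.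
  At a point where \<open>f\<close> and \<open>g\<close> are both nonzero this contradicts the strict convexity or concavity of
  the power with exponent \<open>p - 1\<close>. For \<open>p = 1\<close> the additivity of the norm takes the place of its
  smoothness.

  Disjointness gives \<open>\<parallel>\<rho> 1 f\<parallel>\<^sup>p = \<Sum>\<^sub>k \<Sum>\<^sub>i \<parallel>E k 1 i f\<parallel>\<^sup>p\<close>. In these coordinates a matrix over the algebra acts
  through the scalar matrices that are formed by its \<open>k\<close>-th blocks, tensored with the identity. Its norm is therefore the largest
  of the \<open>\<ell>\<^sup>p\<close> operator norms of those scalar matrices whose index satisfies \<open>E k 1 1 \<noteq> 0\<close>. Two contractive
  representations with the same kernel thus give the same norms (\<open>matrix_bound_transfer\<close>).

  \<^emph>\<open>The limit.\<close> An algebra of the direct system maps contractively, though perhaps not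
  injectively, to the limit. Its composites with two isometric representations of the limit have the
  same kernel, so both give the same norms to matrices over its image. These images increase to a
  dense subalgebra (\<open>block_approximable_AF\<close>), and the norm of a matrix depends continuously on its
  entries (\<open>matrix_bound_perturb\<close>).
\<close>

section \<open>The spaces of p-integrable functions\<close>

lemma powr_convex_combination:
  fixes p x y t :: real
  assumes "1 \<le> p" "0 \<le> x" "0 \<le> y" "0 \<le> t" "t \<le> 1"
  shows "((1 - t) * x + t * y) powr p \<le> (1 - t) * x powr p + t * y powr p"
proof -
  have small: "s powr p \<le> s" if "0 \<le> s" "s \<le> 1" for s :: real
    using powr_mono'[of 1 p s] that assms(1) by (cases "s = 0") auto
  show ?thesis
  proof (cases "x = 0 \<or> y = 0")
    case True
    then consider "x = 0" | "y = 0" by blast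
    then show ?thesis
    proof cases
      case 1
      have "(t * y) powr p = t powr p * y powr p" using assms by (simp add: powr_mult)
      also have "\<dots> \<le> t * y powr p" using small[of t] assms by (intro mult_right_mono) auto
      finally show ?thesis using 1 by simp
    next
      case 2
      have "((1 - t) * x) powr p = (1 - t) powr p * x powr p" using assms by (simp add: powr_mult)
      also have "\<dots> \<le> (1 - t) * x powr p" using small[of "1 - t"] assms by (intro mult_right_mono) auto
      finally show ?thesis using 2 by simp
    qed
  next
    case False
    then show ?thesis
      using convex_onD[OF powr_convex[OF assms(1)], of t x y] assms by auto
  qed
qed

lemma cmod_powr_convex_combination:
  fixes a b :: complex
  assumes "1 \<le> p" "0 \<le> t" "t \<le> 1"
  shows "cmod (complex_of_real (1 - t) * a + complex_of_real t * b) powr p \<le> (1 - t) * cmod a powr p + t * cmod b powr p"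
proof -
  have "cmod (complex_of_real (1 - t) * a + complex_of_real t * b) \<le> (1 - t) * cmod a + t * cmod b"
    using norm_triangle_ineq[of "complex_of_real (1 - t) * a" "complex_of_real t * b"] assms
    by (simp add: norm_mult del: of_real_diff)
  then have "cmod (complex_of_real (1 - t) * a + complex_of_real t * b) powr p \<le> ((1 - t) * cmod a + t * cmod b) powr p"
    using assms by (intro powr_mono2) auto
  also have "\<dots> \<le> (1 - t) * cmod a powr p + t * cmod b powr p"
    using assms by (intro powr_convex_combination) auto
  finally show ?thesis .
qed

text \<open>
  The p-th power of the norm. It is the quantity that is additive over functions with disjoint
  supports and over the rows of a column.
\<close>

definition Lp_integral :: "real \<Rightarrow> 'x measure \<Rightarrow> ('x \<Rightarrow> complex) \<Rightarrow> real" where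
  "Lp_integral p M f = (LINT x|M. cmod (f x) powr p)"

definition Lp_norm :: "real \<Rightarrow> 'x measure \<Rightarrow> ('x \<Rightarrow> complex) \<Rightarrow> real" where
  "Lp_norm p M f = Lp_integral p M f powr (1 / p)"

lemma Lp_integral_nonneg [simp]: "0 \<le> Lp_integral p M f"
  by (simp add: Lp_integral_def)

lemma Lp_norm_nonneg [simp]: "0 \<le> Lp_norm p M f"
  by (simp add: Lp_norm_def)

lemma Lp_measurable: "f \<in> Lp_functions p M \<Longrightarrow> f \<in> borel_measurable M"
  by (simp add: Lp_functions_def)

lemma Lp_integrable: "f \<in> Lp_functions p M \<Longrightarrow> integrable M (\<lambda>x. cmod (f x) powr p)"
  by (simp add: Lp_functions_def)

lemma Lp_dominated:
  assumes "f \<in> borel_measurable M" "integrable M g"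
    and "\<And>x. x \<in> space M \<Longrightarrow> cmod (f x) powr p \<le> g x"
  shows "f \<in> Lp_functions p M"
  unfolding Lp_functions_def
proof (safe intro!: assms(1))
  show "integrable M (\<lambda>x. cmod (f x) powr p)"
    using assms(1) by (intro Bochner_Integration.integrable_bound[OF assms(2)])
      (auto intro!: AE_I2 order_trans[OF assms(3)])
qed

lemma Lp_zero [simp]: "(\<lambda>x. 0) \<in> Lp_functions p M"
  by (simp add: Lp_functions_def)

lemma Lp_integral_zero [simp]: "Lp_integral p M (\<lambda>x. 0) = 0"
  by (simp add: Lp_integral_def)

lemma Lp_norm_zero [simp]: "Lp_norm p M (\<lambda>x. 0) = 0"
  by (simp add: Lp_norm_def)

lemma Lp_scale [intro]: "f \<in> Lp_functions p M \<Longrightarrow> (\<lambda>x. c * f x) \<in> Lp_functions p M"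
  by (auto simp: Lp_functions_def norm_mult powr_mult)

lemma Lp_integral_scale: "Lp_integral p M (\<lambda>x. c * f x) = cmod c powr p * Lp_integral p M f"
  by (simp add: Lp_integral_def norm_mult powr_mult)

lemma Lp_integral_cong_AE:
  assumes "f \<in> borel_measurable M" "g \<in> borel_measurable M" "AE x in M. f x = g x"
  shows "Lp_integral p M f = Lp_integral p M g"
  unfolding Lp_integral_def using assms by (intro integral_cong_AE) auto

lemma Lp_integral_eq_zero:
  assumes "f \<in> Lp_functions p M"
  shows "Lp_integral p M f = 0 \<longleftrightarrow> (AE x in M. f x = 0)"
  unfolding Lp_integral_def
  using integral_nonneg_eq_0_iff_AE[OF Lp_integrable[OF assms]] by simp

locale lp_exponent =
  fixes p :: real
  assumes p_ge1: "1 \<le> p"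
begin

lemma Lp_add [intro]:
  assumes "f \<in> Lp_functions p M" "g \<in> Lp_functions p M"
  shows "(\<lambda>x. f x + g x) \<in> Lp_functions p M"
proof (rule Lp_dominated[where g = "\<lambda>x. 2 powr p * (cmod (f x) powr p + cmod (g x) powr p)"])
  show "(\<lambda>x. f x + g x) \<in> borel_measurable M"
    using assms by (intro borel_measurable_add Lp_measurable)
  show "integrable M (\<lambda>x. 2 powr p * (cmod (f x) powr p + cmod (g x) powr p))"
    using assms by (simp add: Lp_functions_def)
  fix x
  have "cmod (f x + g x) powr p \<le> (2 * max (cmod (f x)) (cmod (g x))) powr p"
    using norm_triangle_ineq[of "f x" "g x"] p_ge1 by (intro powr_mono2) auto
  also have "\<dots> = 2 powr p * max (cmod (f x)) (cmod (g x)) powr p"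
    by (simp add: powr_mult)
  also have "\<dots> \<le> 2 powr p * (cmod (f x) powr p + cmod (g x) powr p)"
    by (intro mult_left_mono) (auto simp: max_def)
  finally show "cmod (f x + g x) powr p \<le> 2 powr p * (cmod (f x) powr p + cmod (g x) powr p)" .
qed

lemma Lp_diff [intro]:
  assumes "f \<in> Lp_functions p M" "g \<in> Lp_functions p M"
  shows "(\<lambda>x. f x - g x) \<in> Lp_functions p M"
  using Lp_add[OF assms(1) Lp_scale[OF assms(2), of "-1"]] by simp

lemma Lp_sum [intro]:
  assumes "\<And>j. j \<in> S \<Longrightarrow> f j \<in> Lp_functions p M"
  shows "(\<lambda>x. \<Sum>j\<in>S. f j x) \<in> Lp_functions p M"
proof (cases "finite S")
  case True
  then show ?thesis using assms
    by (induction S rule: finite_induct) (simp_all add: Lp_add)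
qed simp

lemma Lp_restrict:
  assumes "f \<in> Lp_functions p M" "Measurable.pred M P"
  shows "(\<lambda>x. if P x then f x else 0) \<in> Lp_functions p M"
proof (rule Lp_dominated[OF _ Lp_integrable[OF assms(1)]])
  show "(\<lambda>x. if P x then f x else 0) \<in> borel_measurable M"
    using assms by (auto simp: Lp_functions_def)
qed auto

lemma Lp_norm_powr: "Lp_norm p M f powr p = Lp_integral p M f"
  using p_ge1 by (simp add: Lp_norm_def powr_powr)

lemma Lp_norm_le_iff: "0 \<le> C \<Longrightarrow> Lp_norm p M f \<le> C \<longleftrightarrow> Lp_integral p M f \<le> C powr p"
  using p_ge1 by (metis Lp_norm_nonneg Lp_norm_powr powr_less_mono2 powr_mono2 linorder_not_le less_eq_real_def zero_less_one less_le_trans)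

lemma Lp_norm_le_Lp_norm_iff: "Lp_norm p M f \<le> Lp_norm p N g \<longleftrightarrow> Lp_integral p M f \<le> Lp_integral p N g"
  by (simp add: Lp_norm_le_iff Lp_norm_powr)

lemma Lp_norm_scale: "Lp_norm p M (\<lambda>x. c * f x) = cmod c * Lp_norm p M f"
  using p_ge1 by (simp add: Lp_norm_def Lp_integral_scale powr_mult powr_powr)

lemma Lp_norm_eq_zero:
  assumes "f \<in> Lp_functions p M"
  shows "Lp_norm p M f = 0 \<longleftrightarrow> (AE x in M. f x = 0)"
  using Lp_integral_eq_zero[OF assms] by (simp add: Lp_norm_def)

lemma Lp_integral_convex:
  assumes "f \<in> Lp_functions p M" "g \<in> Lp_functions p M" "0 \<le> t" "t \<le> 1"
  shows "Lp_integral p M (\<lambda>x. complex_of_real (1 - t) * f x + complex_of_real t * g x) \<le> (1 - t) * Lp_integral p M f + t * Lp_integral p M g"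
proof -
  have c: "(\<lambda>x. complex_of_real (1 - t) * f x + complex_of_real t * g x) \<in> Lp_functions p M"
    using assms by (intro Lp_add Lp_scale)
  have "Lp_integral p M (\<lambda>x. complex_of_real (1 - t) * f x + complex_of_real t * g x)
      \<le> (LINT x|M. (1 - t) * cmod (f x) powr p + t * cmod (g x) powr p)"
    unfolding Lp_integral_def
    using Lp_integrable[OF c] Lp_integrable[OF assms(1)] Lp_integrable[OF assms(2)] assms p_ge1
    by (intro integral_mono) (auto intro: cmod_powr_convex_combination simp del: of_real_diff)
  also have "\<dots> = (1 - t) * Lp_integral p M f + t * Lp_integral p M g"
    using Lp_integrable[OF assms(1)] Lp_integrable[OF assms(2)] by (simp add: Lp_integral_def)
  finally show ?thesis .
qed

text \<open>
  The sum is a multiple of a convex combination of the normalised functions, to which the convexity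
  of the p-th power applies.
\<close>

lemma Lp_norm_triangle:
  assumes f: "f \<in> Lp_functions p M" and g: "g \<in> Lp_functions p M"
  shows "Lp_norm p M (\<lambda>x. f x + g x) \<le> Lp_norm p M f + Lp_norm p M g"
proof -
  let ?a = "Lp_norm p M f" and ?b = "Lp_norm p M g"
  have m: "f \<in> borel_measurable M" "g \<in> borel_measurable M" using assms by (auto simp: Lp_functions_def)
  consider "?a = 0" | "?b = 0" | "?a > 0" "?b > 0"
    using Lp_norm_nonneg[of p M f] Lp_norm_nonneg[of p M g] by linarith
  then show ?thesis
  proof cases
    case 1
    then have "AE x in M. f x = 0" using f by (simp add: Lp_norm_eq_zero)
    then have "Lp_integral p M (\<lambda>x. f x + g x) = Lp_integral p M g"
      using m by (intro Lp_integral_cong_AE) auto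
    then show ?thesis by (simp add: Lp_norm_def)
  next
    case 2
    then have "AE x in M. g x = 0" using g by (simp add: Lp_norm_eq_zero)
    then have "Lp_integral p M (\<lambda>x. f x + g x) = Lp_integral p M f"
      using m by (intro Lp_integral_cong_AE) auto
    then show ?thesis by (simp add: Lp_norm_def)
  next
    case 3
    let ?t = "?b / (?a + ?b)"
    have t: "0 \<le> ?t" "?t \<le> 1" "1 - ?t = ?a / (?a + ?b)" using 3 by (auto simp: field_simps)
    let ?f = "\<lambda>x. complex_of_real (1 / ?a) * f x" and ?g = "\<lambda>x. complex_of_real (1 / ?b) * g x"
    have one: "Lp_norm p M ?f = 1" "Lp_norm p M ?g = 1"
      using 3 by (simp_all only: Lp_norm_scale norm_of_real) simp_all
    have "Lp_integral p M ?f = 1" "Lp_integral p M ?g = 1"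
      using one Lp_norm_powr[of M ?f] Lp_norm_powr[of M ?g] by simp_all
    then have "Lp_integral p M (\<lambda>x. complex_of_real (1 - ?t) * ?f x + complex_of_real ?t * ?g x) \<le> 1"
      using Lp_integral_convex[OF Lp_scale[OF f] Lp_scale[OF g] t(1,2), of "1 / ?a" "1 / ?b"]
      by (simp only: mult_1_right diff_add_cancel)
    then have le1: "Lp_norm p M (\<lambda>x. complex_of_real (1 - ?t) * ?f x + complex_of_real ?t * ?g x) \<le> 1"
      by (simp add: Lp_norm_le_iff)
    have "(\<lambda>x. f x + g x) = (\<lambda>x. complex_of_real (?a + ?b) * (complex_of_real (1 - ?t) * ?f x + complex_of_real ?t * ?g x))"
    proof
      fix x
      have "complex_of_real ?a \<noteq> 0" "complex_of_real ?b \<noteq> 0" "complex_of_real (?a + ?b) \<noteq> 0"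
        using 3 by (simp_all del: of_real_add)
      moreover have "complex_of_real (1 - ?t) = complex_of_real ?a / complex_of_real (?a + ?b)"
        by (simp only: t(3) of_real_divide)
      ultimately show "f x + g x = complex_of_real (?a + ?b) * (complex_of_real (1 - ?t) * ?f x + complex_of_real ?t * ?g x)"
        by (simp add: distrib_left del: of_real_add of_real_diff)
    qed
    then have "Lp_norm p M (\<lambda>x. f x + g x) = (?a + ?b) * Lp_norm p M (\<lambda>x. complex_of_real (1 - ?t) * ?f x + complex_of_real ?t * ?g x)"
      using 3 by (simp only: Lp_norm_scale norm_of_real)
    also have "\<dots> \<le> (?a + ?b) * 1" using le1 3 by (intro mult_left_mono) auto
    finally show ?thesis by simp
  qed
qed

lemma Lp_norm_sum:
  assumes "finite S" "\<And>j. j \<in> S \<Longrightarrow> f j \<in> Lp_functions p M"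
  shows "Lp_norm p M (\<lambda>x. \<Sum>j\<in>S. f j x) \<le> (\<Sum>j\<in>S. Lp_norm p M (f j))"
  using assms
proof (induction S rule: finite_induct)
  case (insert i S)
  have "Lp_norm p M (\<lambda>x. f i x + (\<Sum>j\<in>S. f j x)) \<le> Lp_norm p M (f i) + Lp_norm p M (\<lambda>x. \<Sum>j\<in>S. f j x)"
    using insert by (intro Lp_norm_triangle Lp_sum) auto
  then show ?case using insert by fastforce
qed simp

lemma Lp_integral_disjoint_add:
  assumes f: "f \<in> Lp_functions p M" and g: "g \<in> Lp_functions p M" and "AE x in M. f x = 0 \<or> g x = 0"
  shows "Lp_integral p M (\<lambda>x. f x + g x) = Lp_integral p M f + Lp_integral p M g"
proof -
  have "Lp_integral p M (\<lambda>x. f x + g x) = (LINT x|M. cmod (f x) powr p + cmod (g x) powr p)"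
    unfolding Lp_integral_def using assms Lp_measurable[OF f] Lp_measurable[OF g]
    by (intro integral_cong_AE) auto
  then show ?thesis using Lp_integrable[OF f] Lp_integrable[OF g] by (simp add: Lp_integral_def)
qed

lemma Lp_integral_disjoint_sum:
  assumes "finite S" "\<And>i. i \<in> S \<Longrightarrow> f i \<in> Lp_functions p M"
    and "\<And>i j. i \<in> S \<Longrightarrow> j \<in> S \<Longrightarrow> i \<noteq> j \<Longrightarrow> AE x in M. f i x = 0 \<or> f j x = 0"
  shows "Lp_integral p M (\<lambda>x. \<Sum>i\<in>S. f i x) = (\<Sum>i\<in>S. Lp_integral p M (f i))"
  using assms
proof (induction S rule: finite_induct)
  case (insert i S)
  have "AE x in M. \<forall>j\<in>S. f i x = 0 \<or> f j x = 0"
    using insert by (intro AE_finite_allI) auto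
  then have "AE x in M. f i x = 0 \<or> (\<Sum>j\<in>S. f j x) = 0"
    by eventually_elim (metis (no_types, lifting) sum.neutral)
  then have "Lp_integral p M (\<lambda>x. f i x + (\<Sum>j\<in>S. f j x)) = Lp_integral p M (f i) + Lp_integral p M (\<lambda>x. \<Sum>j\<in>S. f j x)"
    using insert by (intro Lp_integral_disjoint_add Lp_sum) auto
  then show ?case using insert by simp
qed simp

end

section \<open>Orthogonal hermitian idempotents have disjoint ranges\<close>

text \<open>
  The gradient of \<open>\<bar>z\<bar>\<^sup>p / p\<close>. For \<open>p > 1\<close> the functional \<open>h \<mapsto> \<integral> duality_map p (F x) * h x\<close> is the one in the
  dual of \<open>L\<^sup>p\<close> that is norming for \<open>F\<close>, up to a positive factor.
\<close>

definition duality_map :: "real \<Rightarrow> complex \<Rightarrow> complex" where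
  "duality_map p z = of_real (cmod z powr (p - 2)) * cnj z"

lemma cmod_duality_map: "cmod (duality_map p z) = cmod z powr (p - 1)"
proof (cases "z = 0")
  case False
  then show ?thesis
    using powr_add[of "cmod z" "p - 2" 1] by (simp add: duality_map_def norm_mult)
qed (simp add: duality_map_def)

lemma measurable_duality_map [measurable]: "duality_map p \<in> borel_measurable borel"
proof -
  have [measurable]: "cnj \<in> borel_measurable borel"
    by (intro borel_measurable_continuous_onI continuous_intros)
  show ?thesis unfolding duality_map_def[abs_def] by measurable
qed

lemma cmod_add_scaled_powr_deriv:
  fixes a b :: complex and p :: real
  assumes "a \<noteq> 0"
  shows "((\<lambda>t. cmod (a + complex_of_real t * b) powr p) has_real_derivative p * Re (duality_map p a * b)) (at 0)"
proof -
  define Q where "Q t = (cmod a)\<^sup>2 + 2 * t * Re (cnj a * b) + t\<^sup>2 * (cmod b)\<^sup>2" for t :: real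
  have Q: "(cmod (a + complex_of_real t * b))\<^sup>2 = Q t" for t
    unfolding Q_def cmod_power2 by (simp add: power2_eq_square algebra_simps)
  have eq: "cmod (a + complex_of_real t * b) powr p = Q t powr (p / 2)" for t
    using powr_powr[of "cmod (a + complex_of_real t * b)" 2 "p / 2"] by (simp add: Q[symmetric])
  have Q0: "Q 0 = (cmod a)\<^sup>2" by (simp add: Q_def)
  have "(Q has_real_derivative 2 * Re (cnj a * b)) (at 0)"
    unfolding Q_def by (auto intro!: derivative_eq_intros)
  then have "((\<lambda>t. Q t powr (p / 2)) has_real_derivative
      (p / 2) * Q 0 powr (p / 2 - 1) * (2 * Re (cnj a * b))) (at 0)"
    using assms by (auto simp: Q0 intro!: DERIV_fun_powr[THEN DERIV_cong])
  moreover have "Q 0 powr (p / 2 - 1) = cmod a powr (p - 2)"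
    using powr_powr[of "cmod a" 2 "p / 2 - 1"] by (simp add: Q0)
  ultimately show ?thesis unfolding eq by (simp add: duality_map_def algebra_simps)
qed

lemma cmod_add_scaled_powr_limit:
  fixes a b :: complex and p :: real
  assumes "1 < p"
  shows "(\<lambda>n. real (Suc n) * (cmod (a + complex_of_real (inverse (real (Suc n))) * b) powr p - cmod a powr p))
    \<longlonglongrightarrow> p * Re (duality_map p a * b)"
proof (cases "a = 0")
  case True
  have eq: "real (Suc n) * (cmod (complex_of_real (inverse (real (Suc n))) * b) powr p)
      = cmod b powr p * real (Suc n) powr (- (p - 1))" for n
  proof -
    have "(inverse (real (Suc n)) * cmod b) powr p = inverse (real (Suc n)) powr p * cmod b powr p"
      by (simp add: powr_mult)
    moreover have "real (Suc n) * inverse (real (Suc n)) powr p = real (Suc n) powr (- (p - 1))"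
      using powr_add[of "real (Suc n)" 1 "- p"] by (simp add: powr_minus inverse_powr)
    ultimately show ?thesis
      by (simp add: norm_mult norm_inverse del: of_nat_Suc)
  qed
  have "(\<lambda>n. real (Suc n) powr (- (p - 1))) \<longlonglongrightarrow> 0"
    using assms by (intro tendsto_neg_powr filterlim_compose[OF filterlim_real_sequentially filterlim_Suc]) auto
  then have "(\<lambda>n. cmod b powr p * real (Suc n) powr (- (p - 1))) \<longlonglongrightarrow> 0"
    by (auto intro: tendsto_eq_intros)
  then have "(\<lambda>n. real (Suc n) * (cmod (complex_of_real (inverse (real (Suc n))) * b) powr p)) \<longlonglongrightarrow> 0"
    unfolding eq .
  then show ?thesis
    using True by (simp add: duality_map_def del: of_nat_Suc)
next
  case False
  have "(\<lambda>h. (cmod (a + complex_of_real (0 + h) * b) powr p - cmod (a + complex_of_real 0 * b) powr p) / h)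
      \<midarrow>0\<rightarrow> p * Re (duality_map p a * b)"
    using cmod_add_scaled_powr_deriv[OF False, of b p] unfolding DERIV_def by simp
  then have "(\<lambda>n. (\<lambda>h. (cmod (a + complex_of_real (0 + h) * b) powr p - cmod (a + complex_of_real 0 * b) powr p) / h)
      (inverse (real (Suc n)))) \<longlonglongrightarrow> p * Re (duality_map p a * b)"
    by (rule filterlim_compose) (auto simp: filterlim_at LIMSEQ_inverse_real_of_nat simp del: of_nat_Suc)
  then show ?thesis by (simp add: field_simps)
qed

context lp_exponent
begin

lemma integrable_duality_pairing:
  assumes F: "F \<in> Lp_functions p M" and H: "H \<in> Lp_functions p M"
  shows "integrable M (\<lambda>x. duality_map p (F x) * H x)"
proof (rule Bochner_Integration.integrable_bound)
  show "integrable M (\<lambda>x. cmod (F x) powr p + cmod (H x) powr p)"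
    using assms by (auto intro: Lp_integrable)
  show "(\<lambda>x. duality_map p (F x) * H x) \<in> borel_measurable M"
    using Lp_measurable[OF F] Lp_measurable[OF H] by measurable
  have "cmod (duality_map p a * b) \<le> cmod a powr p + cmod b powr p" for a b
  proof -
    let ?m = "max (cmod a) (cmod b)"
    have "cmod a powr (p - 1) * cmod b \<le> ?m powr (p - 1) * ?m"
      using p_ge1 by (intro mult_mono powr_mono2) auto
    also have "\<dots> = ?m powr p"
      using powr_add[of ?m "p - 1" 1] p_ge1 by (cases "?m = 0") (auto simp: max_def split: if_splits)
    also have "\<dots> \<le> cmod a powr p + cmod b powr p" by (auto simp: max_def)
    finally show ?thesis by (simp add: norm_mult cmod_duality_map)
  qed
  then show "AE x in M. cmod (duality_map p (F x) * H x) \<le> norm (cmod (F x) powr p + cmod (H x) powr p)"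
    by (simp add: abs_of_nonneg)
qed

text \<open>
  The function \<open>t \<mapsto> \<bar>a + tb\<bar>\<^sup>p\<close> is convex, so its difference quotients at \<open>0\<close> with increments in \<open>(0, 1]\<close>
  lie between the slopes of the secants over \<open>[-1, 0]\<close> and \<open>[0, 1]\<close>. This dominates the limit.
\<close>

lemma Lp_integral_derivative:
  assumes F: "F \<in> Lp_functions p M" and H: "H \<in> Lp_functions p M" and p: "1 < p"
  shows "(\<lambda>n. real (Suc n) * (Lp_integral p M (\<lambda>x. F x + complex_of_real (inverse (real (Suc n))) * H x) - Lp_integral p M F))
    \<longlonglongrightarrow> p * Re (LINT x|M. duality_map p (F x) * H x)"
proof -
  define q where "q n a b = real (Suc n) * (cmod (a + complex_of_real (inverse (real (Suc n))) * b) powr p - cmod a powr p)"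
    for n a b
  define w where "w x = cmod (F x + H x) powr p + cmod (F x - H x) powr p + cmod (F x) powr p" for x
  have mF: "F \<in> borel_measurable M" and mH: "H \<in> borel_measurable M"
    using F H by (auto intro: Lp_measurable)
  have lim: "(\<lambda>n. LINT x|M. q n (F x) (H x)) \<longlonglongrightarrow> (LINT x|M. p * Re (duality_map p (F x) * H x))"
  proof (rule integral_dominated_convergence[where w = w])
    show "(\<lambda>x. p * Re (duality_map p (F x) * H x)) \<in> borel_measurable M"
      using mF mH by measurable
    show "(\<lambda>x. q n (F x) (H x)) \<in> borel_measurable M" for n
      unfolding q_def using mF mH by measurable
    show "integrable M w"
      unfolding w_def using Lp_integrable[OF Lp_add[OF F H]] Lp_integrable[OF Lp_diff[OF F H]] Lp_integrable[OF F]
      by auto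
    show "AE x in M. (\<lambda>n. q n (F x) (H x)) \<longlonglongrightarrow> p * Re (duality_map p (F x) * H x)"
      unfolding q_def using cmod_add_scaled_powr_limit[OF p] by simp
    have "\<bar>q n a b\<bar> \<le> cmod (a + b) powr p + cmod (a - b) powr p + cmod a powr p" for n a b
    proof -
      define t where "t = inverse (real (Suc n))"
      have t: "0 < t" "t \<le> 1" and n: "real (Suc n) = 1 / t"
        by (auto simp: t_def field_simps)
      have comb: "complex_of_real (1 - t) * a + complex_of_real t * (a + b) = a + complex_of_real t * b"
        by (simp add: algebra_simps)
      have up: "cmod (a + complex_of_real t * b) powr p \<le> (1 - t) * cmod a powr p + t * cmod (a + b) powr p"
        using cmod_powr_convex_combination[of p t a "a + b"] t p_ge1 unfolding comb by simp
      (* The point a lies between a - b and a + t b, which gives the lower bound. *)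
      define s where "s = t / (1 + t)"
      have s: "0 < s" "s \<le> 1" "1 - s = 1 / (1 + t)" using t by (auto simp: s_def field_simps)
      have t1: "complex_of_real (1 + t) \<noteq> 0" using t by (metis of_real_eq_0_iff add_pos_pos less_numeral_extra(1) less_irrefl)
      have comb2: "complex_of_real (1 - s) * (a + complex_of_real t * b) + complex_of_real s * (a - b) = a"
      proof -
        have "complex_of_real (1 - s) * (a + complex_of_real t * b) + complex_of_real s * (a - b)
            = ((a + complex_of_real t * b) + complex_of_real t * (a - b)) / complex_of_real (1 + t)"
          unfolding s(3) unfolding s_def by (simp add: add_divide_distrib)
        also have "(a + complex_of_real t * b) + complex_of_real t * (a - b) = complex_of_real (1 + t) * a"
          by (simp add: algebra_simps)
        finally show ?thesis using t1 by simp
      qed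
      have "cmod a powr p \<le> (1 - s) * cmod (a + complex_of_real t * b) powr p + s * cmod (a - b) powr p"
        using cmod_powr_convex_combination[of p s "a + complex_of_real t * b" "a - b"] s p_ge1
        unfolding comb2 by simp
      then have "(1 + t) * cmod a powr p \<le> (1 + t) * ((1 - s) * cmod (a + complex_of_real t * b) powr p + s * cmod (a - b) powr p)"
        using t by (intro mult_left_mono) auto
      also have "\<dots> = cmod (a + complex_of_real t * b) powr p + t * cmod (a - b) powr p"
        unfolding s(3) unfolding s_def using t by (simp add: distrib_left)
      finally have low: "t * cmod a powr p - t * cmod (a - b) powr p \<le> cmod (a + complex_of_real t * b) powr p - cmod a powr p"
        by (simp add: algebra_simps)
      have q: "q n a b = (cmod (a + complex_of_real t * b) powr p - cmod a powr p) / t"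
        unfolding q_def n t_def[symmetric] by simp
      have "q n a b \<le> cmod (a + b) powr p - cmod a powr p"
        using up t unfolding q by (simp add: field_simps)
      moreover have "cmod a powr p - cmod (a - b) powr p \<le> q n a b"
        using low t unfolding q by (simp add: field_simps)
      moreover have "0 \<le> cmod (a + b) powr p" "0 \<le> cmod (a - b) powr p" "0 \<le> cmod a powr p" by auto
      ultimately show ?thesis by linarith
    qed
    then show "AE x in M. norm (q n (F x) (H x)) \<le> w x" for n
      by (simp add: w_def)
  qed
  have "(LINT x|M. q n (F x) (H x))
      = real (Suc n) * (Lp_integral p M (\<lambda>x. F x + complex_of_real (inverse (real (Suc n))) * H x) - Lp_integral p M F)" for n
    unfolding q_def Lp_integral_def
    using Lp_integrable[OF F] Lp_integrable[OF Lp_add[OF F Lp_scale[OF H, of "complex_of_real (inverse (real (Suc n)))"]]]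
    by (simp add: Bochner_Integration.integral_diff)
  moreover have "(LINT x|M. p * Re (duality_map p (F x) * H x)) = p * Re (LINT x|M. duality_map p (F x) * H x)"
    by (simp only: integral_mult_right_zero integral_Re[OF integrable_duality_pairing[OF F H]])
  ultimately show ?thesis using lim by (simp only:)
qed

text \<open>
  As a function of \<open>z\<close>, the difference of the two sides of \<open>le\<close> has its minimum at \<open>0\<close>, so its
  derivative vanishes there in every complex direction.
\<close>

lemma duality_pairing_of_contraction:
  assumes F: "F \<in> Lp_functions p M" and H: "H \<in> Lp_functions p M"
    and F': "F' \<in> Lp_functions p N" and H': "H' \<in> Lp_functions p N" and p: "1 < p"
    and le: "\<And>z. Lp_integral p N (\<lambda>x. F' x + z * H' x) \<le> Lp_integral p M (\<lambda>x. F x + z * H x)"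
    and eq: "Lp_integral p N F' = Lp_integral p M F"
  shows "(LINT x|N. duality_map p (F' x) * H' x) = (LINT x|M. duality_map p (F x) * H x)"
proof -
  have main: "Re (c * (LINT x|N. duality_map p (F' x) * H' x)) \<le> Re (c * (LINT x|M. duality_map p (F x) * H x))" for c
  proof -
    have "p * Re (LINT x|N. duality_map p (F' x) * (c * H' x)) \<le> p * Re (LINT x|M. duality_map p (F x) * (c * H x))"
    proof (rule LIMSEQ_le[OF Lp_integral_derivative[OF F' Lp_scale[OF H'] p] Lp_integral_derivative[OF F Lp_scale[OF H] p]],
        intro exI allI impI mult_left_mono)
      fix n
      show "Lp_integral p N (\<lambda>x. F' x + complex_of_real (inverse (real (Suc n))) * (c * H' x)) - Lp_integral p N F'
        \<le> Lp_integral p M (\<lambda>x. F x + complex_of_real (inverse (real (Suc n))) * (c * H x)) - Lp_integral p M F"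
        using le[of "complex_of_real (inverse (real (Suc n))) * c"] eq by (simp only: mult.assoc)
    qed simp
    moreover have "(LINT x|N. duality_map p (F' x) * (c * H' x)) = c * (LINT x|N. duality_map p (F' x) * H' x)"
      "(LINT x|M. duality_map p (F x) * (c * H x)) = c * (LINT x|M. duality_map p (F x) * H x)"
      by (simp_all add: mult.left_commute[of _ c])
    ultimately show ?thesis using p by simp
  qed
  show ?thesis
    using main[of 1] main[of "-1"] main[of \<i>] main[of "-\<i>"] by (intro complex_eqI) auto
qed

end

text \<open>
  The mean value theorem writes the differences over \<open>[s + v, s + w]\<close> and \<open>[s - w, s - v]\<close> as the same
  length times slopes of the power at two different points, and the slope is injective for \<open>r \<noteq> 1\<close>.
\<close>

lemma symmetric_powr_sum_neq:
  fixes r s w v :: real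
  assumes r: "0 < r" "r \<noteq> 1" and "0 \<le> v" "v < w" "w \<le> s"
  shows "(s + w) powr r + (s - w) powr r \<noteq> (s + v) powr r + (s - v) powr r"
proof
  assume eq: "(s + w) powr r + (s - w) powr r = (s + v) powr r + (s - v) powr r"
  have mvt: "\<exists>z. x < z \<and> z < y \<and> y powr r - x powr r = (y - x) * (r * z powr (r - 1))"
    if "0 \<le> x" "x < y" for x y :: real
  proof -
    have "\<exists>l z. x < z \<and> z < y \<and> ((\<lambda>u. u powr r) has_real_derivative l) (at z)
        \<and> y powr r - x powr r = (y - x) * l"
    proof (rule MVT)
      show "continuous_on {x..y} (\<lambda>u. u powr r)"
        using r that by (intro continuous_on_powr' continuous_intros) auto
      show "(\<lambda>u. u powr r) differentiable (at z)" if "x < z" "z < y" for z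
        using has_real_derivative_powr[of z r] that \<open>0 \<le> x\<close> real_differentiable_def by fastforce
    qed (use that in auto)
    then obtain l z where z: "x < z" "z < y" "((\<lambda>u. u powr r) has_real_derivative l) (at z)"
      "y powr r - x powr r = (y - x) * l" by blast
    have "l = r * z powr (r - 1)"
      using DERIV_unique[OF z(3) has_real_derivative_powr] z(1) that by simp
    then show ?thesis using z by blast
  qed
  obtain z where z: "s + v < z" "z < s + w" "(s + w) powr r - (s + v) powr r = (w - v) * (r * z powr (r - 1))"
    using mvt[of "s + v" "s + w"] assms by auto
  obtain y where y: "s - w < y" "y < s - v" "(s - v) powr r - (s - w) powr r = (w - v) * (r * y powr (r - 1))"
    using mvt[of "s - w" "s - v"] assms by auto
  have "(w - v) * (r * z powr (r - 1)) = (w - v) * (r * y powr (r - 1))"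
    using z(3) y(3) eq by linarith
  then have "z powr (r - 1) = y powr (r - 1)" using assms by simp
  then have "ln z * (r - 1) = ln y * (r - 1)"
    using z y assms by (simp add: powr_def)
  then have "z = y" using z y assms by simp
  then show False using z y assms by simp
qed

lemma cmod_add_power2: "(cmod (a + b))\<^sup>2 = ((cmod a)\<^sup>2 + (cmod b)\<^sup>2) + 2 * Re (a * cnj b)"
  unfolding cmod_power2 by (simp add: power2_eq_square algebra_simps)

text \<open>
  Suppose that \<open>duality_map p (a + \<lambda> b) = u + cnj \<lambda> v\<close> for the four fourth roots of unity \<open>\<lambda>\<close>.
  The parallelogram law for \<open>u\<close> and \<open>v\<close> then compares
  \<open>\<bar>a + b\<bar>\<^sup>2\<^sup>r + \<bar>a - b\<bar>\<^sup>2\<^sup>r\<close> with \<open>\<bar>a + \<i> b\<bar>\<^sup>2\<^sup>r + \<bar>a - \<i> b\<bar>\<^sup>2\<^sup>r\<close> where \<open>r = p - 1\<close>. For \<open>r \<noteq> 1\<close>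
  such a sum, for given \<open>\<bar>a\<bar>\<close> and \<open>\<bar>b\<bar>\<close>, determines the real part of \<open>a cnj b\<close> up to sign.
\<close>

lemma abs_Re_eq_abs_Im_of_duality_map:
  fixes a b :: complex
  assumes p: "1 < p" "p \<noteq> 2"
    and sum: "duality_map p (a + b) + duality_map p (a - b) = duality_map p (a + \<i> * b) + duality_map p (a - \<i> * b)"
    and diff: "duality_map p (a + b) - duality_map p (a - b) = \<i> * (duality_map p (a + \<i> * b) - duality_map p (a - \<i> * b))"
  shows "\<bar>Re (a * cnj b)\<bar> = \<bar>Im (a * cnj b)\<bar>"
proof -
  define s where "s = (cmod a)\<^sup>2 + (cmod b)\<^sup>2"
  define w where "w = 2 * Re (a * cnj b)"
  define v where "v = 2 * Im (a * cnj b)"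
  have par: "2 * ((cmod x)\<^sup>2 + (cmod y)\<^sup>2) = (cmod (x + y))\<^sup>2 + (cmod (x - y))\<^sup>2" for x y
    unfolding cmod_power2 by (simp add: power2_eq_square algebra_simps)
  have sq: "(cmod (duality_map p z))\<^sup>2 = (cmod z)\<^sup>2 powr (p - 1)" for z
    using powr_powr[of "cmod z" 2 "p - 1"]
    by (cases "z = 0") (simp_all add: cmod_duality_map powr_power algebra_simps)
  have sm: "(cmod (a + b))\<^sup>2 = s + w" "(cmod (a - b))\<^sup>2 = s - w"
    "(cmod (a + \<i> * b))\<^sup>2 = s + v" "(cmod (a - \<i> * b))\<^sup>2 = s - v"
    using cmod_add_power2[of a b] cmod_add_power2[of a "-b"] cmod_add_power2[of a "\<i> * b"] cmod_add_power2[of a "- (\<i> * b)"]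
    by (simp_all add: s_def w_def v_def norm_mult algebra_simps)
  have nn: "0 \<le> s + w" "0 \<le> s - w" "0 \<le> s + v" "0 \<le> s - v"
    unfolding sm[symmetric] by simp_all
  have "2 * ((cmod (duality_map p (a + b)))\<^sup>2 + (cmod (duality_map p (a - b)))\<^sup>2)
      = 2 * ((cmod (duality_map p (a + \<i> * b)))\<^sup>2 + (cmod (duality_map p (a - \<i> * b)))\<^sup>2)"
    unfolding par sum diff by (simp add: norm_mult)
  then have eq: "(s + w) powr (p - 1) + (s - w) powr (p - 1) = (s + v) powr (p - 1) + (s - v) powr (p - 1)"
    unfolding sq sm by simp
  have absolute: "(s + x) powr (p - 1) + (s - x) powr (p - 1) = (s + \<bar>x\<bar>) powr (p - 1) + (s - \<bar>x\<bar>) powr (p - 1)" for x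
    by (cases "0 \<le> x") auto
  have "\<not> \<bar>v\<bar> < \<bar>w\<bar>"
    using symmetric_powr_sum_neq[of "p - 1" "\<bar>v\<bar>" "\<bar>w\<bar>" s] eq absolute[of w] absolute[of v] p nn by linarith
  moreover have "\<not> \<bar>w\<bar> < \<bar>v\<bar>"
    using symmetric_powr_sum_neq[of "p - 1" "\<bar>w\<bar>" "\<bar>v\<bar>" s] eq absolute[of w] absolute[of v] p nn by linarith
  ultimately show ?thesis by (simp add: w_def v_def)
qed

text \<open>
  The first condition puts \<open>z\<close> on one of the two diagonals of the plane. These are not mapped to
  diagonals by the rotation, whose angle is no multiple of \<open>\<pi>/2\<close>; the entries are chosen rational.
\<close>

lemma eq_zero_if_rotations_balanced:
  fixes z :: complex
  assumes "\<bar>Re z\<bar> = \<bar>Im z\<bar>" "\<bar>Re (z * cnj (Complex (3/5) (4/5)))\<bar> = \<bar>Im (z * cnj (Complex (3/5) (4/5)))\<bar>"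
  shows "z = 0"
proof -
  have "Re z = Im z \<or> Re z = - Im z" using assms(1) by linarith
  then have "Re z = 0 \<and> Im z = 0" using assms(2) by (auto simp: field_simps)
  then show ?thesis by (simp add: complex_eq_iff)
qed

lemma cnj_mult_self_unimodular: "cmod l = 1 \<Longrightarrow> cnj l * l = 1"
  by (simp add: mult.commute complex_norm_square[symmetric])

text \<open>
  A model of two different diagonal matrix units, acting on representatives of classes of functions.
  That they are orthogonal idempotents is expressed by \<open>in_ranges\<close> for the functions in question.
\<close>

locale hermitian_pair = lp_exponent +
  fixes M :: "'x measure" and e d :: "('x \<Rightarrow> complex) \<Rightarrow> 'x \<Rightarrow> complex"
  assumes e_closed: "f \<in> Lp_functions p M \<Longrightarrow> e f \<in> Lp_functions p M"
    and d_closed: "f \<in> Lp_functions p M \<Longrightarrow> d f \<in> Lp_functions p M"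
    and e_linear: "f \<in> Lp_functions p M \<Longrightarrow> g \<in> Lp_functions p M
      \<Longrightarrow> AE x in M. e (\<lambda>x. f x + c * g x) x = e f x + c * e g x"
    and d_linear: "f \<in> Lp_functions p M \<Longrightarrow> g \<in> Lp_functions p M
      \<Longrightarrow> AE x in M. d (\<lambda>x. f x + c * g x) x = d f x + c * d g x"
    and rotation_contractive: "cmod l = 1 \<Longrightarrow> f \<in> Lp_functions p M
      \<Longrightarrow> Lp_integral p M (\<lambda>x. e f x + l * d f x) \<le> Lp_integral p M f"
begin

definition in_ranges :: "('x \<Rightarrow> complex) \<Rightarrow> ('x \<Rightarrow> complex) \<Rightarrow> bool" where
  "in_ranges f g \<longleftrightarrow> f \<in> Lp_functions p M \<and> g \<in> Lp_functions p M \<and>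
     (AE x in M. e f x = f x \<and> d f x = 0 \<and> e g x = 0 \<and> d g x = g x)"

lemma in_ranges_scale:
  assumes "in_ranges f g"
  shows "in_ranges f (\<lambda>x. z * g x)"
proof -
  have f: "f \<in> Lp_functions p M" and g: "g \<in> Lp_functions p M" using assms by (auto simp: in_ranges_def)
  have "AE x in M. e f x = f x \<and> d f x = 0 \<and> e g x = 0 \<and> d g x = g x"
    using assms by (simp add: in_ranges_def)
  with e_linear[OF g g, of "z - 1"] d_linear[OF g g, of "z - 1"]
  have "AE x in M. e f x = f x \<and> d f x = 0 \<and> e (\<lambda>x. z * g x) x = 0 \<and> d (\<lambda>x. z * g x) x = z * g x"
    by eventually_elim (simp add: algebra_simps)
  then show ?thesis using f g by (auto simp: in_ranges_def)
qed

lemma rotation_of_ranges: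
  assumes "in_ranges f g"
  shows "AE x in M. e (\<lambda>x. f x + z * g x) x + w * d (\<lambda>x. f x + z * g x) x = f x + w * z * g x"
proof -
  have f: "f \<in> Lp_functions p M" and g: "g \<in> Lp_functions p M" using assms by (auto simp: in_ranges_def)
  have "AE x in M. e f x = f x \<and> d f x = 0 \<and> e g x = 0 \<and> d g x = g x"
    using assms by (simp add: in_ranges_def)
  with e_linear[OF f g, of z] d_linear[OF f g, of z] show ?thesis
    by eventually_elim simp
qed

text \<open>
  Both the rotation \<open>e + \<lambda>d\<close> and its inverse on the ranges are contractions.
\<close>

lemma Lp_integral_rotation:
  assumes "in_ranges f g" "cmod l = 1"
  shows "Lp_integral p M (\<lambda>x. f x + l * g x) = Lp_integral p M (\<lambda>x. f x + g x)"
proof -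
  have le: "Lp_integral p M (\<lambda>x. f x + w * z * g x) \<le> Lp_integral p M (\<lambda>x. f x + z * g x)" if "cmod w = 1" for w z
  proof -
    have f: "f \<in> Lp_functions p M" and g: "g \<in> Lp_functions p M" using assms by (auto simp: in_ranges_def)
    let ?F = "\<lambda>x. f x + z * g x"
    have F: "?F \<in> Lp_functions p M" using f g by auto
    have "Lp_integral p M (\<lambda>x. f x + w * z * g x) = Lp_integral p M (\<lambda>x. e ?F x + w * d ?F x)"
      using rotation_of_ranges[OF assms(1), of z w] f g e_closed[OF F] d_closed[OF F]
      by (intro Lp_integral_cong_AE Lp_measurable[where p = p] Lp_add Lp_scale) auto
    also have "\<dots> \<le> Lp_integral p M ?F" using rotation_contractive[OF that F] .
    finally show ?thesis .
  qed
  have "cnj l * l = 1" using assms(2) by (rule cnj_mult_self_unimodular)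
  then show ?thesis using le[of l 1] le[of "cnj l" l] assms(2) by simp
qed

text \<open>
  The contraction \<open>e + cnj \<lambda> d\<close> maps \<open>f + \<lambda>g\<close> to \<open>f + g\<close>, which has the same norm. Hence the functional
  of \<open>f + \<lambda>g\<close> is that of \<open>f + g\<close> composed with the contraction, and depends on \<open>\<lambda>\<close> only through the factor
  \<open>cnj \<lambda>\<close>.
\<close>

lemma duality_map_split:
  assumes fg: "in_ranges f g" and l: "cmod l = 1" and h: "h \<in> Lp_functions p M" and p: "1 < p"
  shows "(LINT x|M. duality_map p (f x + l * g x) * h x)
    = (LINT x|M. duality_map p (f x + g x) * e h x) + cnj l * (LINT x|M. duality_map p (f x + g x) * d h x)"
proof -
  have f: "f \<in> Lp_functions p M" and g: "g \<in> Lp_functions p M" using fg by (auto simp: in_ranges_def)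
  have ll: "cnj l * l = 1" using l by (rule cnj_mult_self_unimodular)
  let ?T = "\<lambda>h x. e h x + cnj l * d h x" and ?F = "\<lambda>x. f x + l * g x"
  have T: "?T u \<in> Lp_functions p M" if "u \<in> Lp_functions p M" for u
    using that by (intro Lp_add Lp_scale e_closed d_closed)
  have F: "?F \<in> Lp_functions p M" using f g by auto
  have "(LINT x|M. duality_map p (f x + g x) * ?T h x) = (LINT x|M. duality_map p (?F x) * h x)"
  proof (rule duality_pairing_of_contraction[OF F h _ T[OF h] p])
    show "(\<lambda>x. f x + g x) \<in> Lp_functions p M" using f g by auto
    show "Lp_integral p M (\<lambda>x. f x + g x) = Lp_integral p M ?F"
      using Lp_integral_rotation[OF fg l] by simp
    fix z
    let ?G = "\<lambda>x. ?F x + z * h x"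
    have G: "?G \<in> Lp_functions p M" using F h by auto
    have "AE x in M. ?T ?F x = f x + g x"
      using rotation_of_ranges[OF fg, of l "cnj l"] ll by simp
    with e_linear[OF F h, of z] d_linear[OF F h, of z]
    have "AE x in M. (f x + g x) + z * ?T h x = ?T ?G x"
      by eventually_elim (simp add: algebra_simps)
    then have "Lp_integral p M (\<lambda>x. (f x + g x) + z * ?T h x) = Lp_integral p M (?T ?G)"
      using Lp_measurable[OF Lp_add[OF Lp_add[OF f g] Lp_scale[OF T[OF h]]]] Lp_measurable[OF T[OF G]]
      by (intro Lp_integral_cong_AE) auto
    also have "\<dots> \<le> Lp_integral p M ?G" using l G by (intro rotation_contractive) auto
    finally show "Lp_integral p M (\<lambda>x. (f x + g x) + z * ?T h x) \<le> Lp_integral p M ?G" .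
  qed
  moreover have "(LINT x|M. duality_map p (f x + g x) * ?T h x)
      = (LINT x|M. duality_map p (f x + g x) * e h x + cnj l * (duality_map p (f x + g x) * d h x))"
    by (simp add: algebra_simps)
  ultimately show ?thesis
    using integrable_duality_pairing[OF Lp_add[OF f g] e_closed[OF h]]
      integrable_duality_pairing[OF Lp_add[OF f g] d_closed[OF h]]
    by simp
qed

lemma balanced_if_exponent_gt_1:
  assumes fg: "in_ranges f g" and p: "1 < p" "p \<noteq> 2"
  shows "AE x in M. \<bar>Re (f x * cnj (g x))\<bar> = \<bar>Im (f x * cnj (g x))\<bar>"
proof -
  have f: "f \<in> Lp_functions p M" and g: "g \<in> Lp_functions p M" using fg by (auto simp: in_ranges_def)
  note [measurable] = Lp_measurable[OF f] Lp_measurable[OF g]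
  define G where "G l x = duality_map p (f x + l * g x)" for l x
  define k where "k x = cmod (f x) + cmod (g x)" for x
  have k: "(\<lambda>x. complex_of_real (k x)) \<in> Lp_functions p M"
  proof -
    have cl: "(\<lambda>x. complex_of_real (cmod (u x))) \<in> Lp_functions p M" if "u \<in> Lp_functions p M" for u :: "'x \<Rightarrow> complex"
      using that by (auto simp: Lp_functions_def)
    then show ?thesis using Lp_add[OF cl[OF f] cl[OF g]] by (simp add: k_def)
  qed
  have G [measurable]: "G l \<in> borel_measurable M" for l unfolding G_def[abs_def] by measurable
  \<comment> \<open>By \<open>duality_map_split\<close> the pairing of \<open>G l\<close> with \<open>h\<close> is \<open>X + cnj l * Y\<close>, and the conditions on the
    coefficients say that both parts cancel. The function \<open>h\<close> is the conjugate phase of \<open>W\<close> times \<open>k\<close>,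
    which is p-integrable and turns the pairing into \<open>\<integral>\<bar>W\<bar>k\<close>.\<close>
  have vanish: "AE x in M. W x * k x = 0"
    if W: "\<And>x. W x = G 1 x + c1 * G (-1) x + c2 * G \<i> x + c3 * G (-\<i>) x"
      and c: "1 + c1 + c2 + c3 = 0" "1 - c1 - \<i> * c2 + \<i> * c3 = 0" for W c1 c2 c3
  proof -
    have Wm [measurable]: "W \<in> borel_measurable M" unfolding W[abs_def] by measurable
    have cnjm [measurable]: "cnj \<in> borel_measurable borel"
      by (intro borel_measurable_continuous_onI continuous_intros)
    have sgnm [measurable]: "(\<lambda>x. sgn (W x)) \<in> borel_measurable M"
      unfolding sgn_div_norm by measurable
    define h where "h x = cnj (sgn (W x)) * complex_of_real (k x)" for x
    have hm: "h \<in> borel_measurable M"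
      unfolding h_def[abs_def] k_def by measurable
    have h: "h \<in> Lp_functions p M"
    proof (rule Lp_dominated[OF hm Lp_integrable[OF k]])
      show "cmod (h x) powr p \<le> cmod (complex_of_real (k x)) powr p" for x
        using p_ge1 by (intro powr_mono2) (auto simp: h_def norm_mult norm_sgn)
    qed
    have int: "integrable M (\<lambda>x. G l x * h x)" for l
      unfolding G_def using f g h by (intro integrable_duality_pairing) auto
    define X where "X = (LINT x|M. duality_map p (f x + g x) * e h x)"
    define Y where "Y = (LINT x|M. duality_map p (f x + g x) * d h x)"
    have val: "(LINT x|M. G l x * h x) = X + cnj l * Y" if "cmod l = 1" for l
      unfolding G_def X_def Y_def using duality_map_split[OF fg that h p(1)] .
    have Wh: "W x * h x = G 1 x * h x + c1 * (G (-1) x * h x) + c2 * (G \<i> x * h x) + c3 * (G (-\<i>) x * h x)" for x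
      unfolding W by (simp add: algebra_simps)
    have "(LINT x|M. W x * h x) = (X + Y) + c1 * (X - Y) + c2 * (X - \<i> * Y) + c3 * (X + \<i> * Y)"
      unfolding Wh using int val[of 1] val[of "-1"] val[of \<i>] val[of "-\<i>"] by simp
    also have "\<dots> = (1 + c1 + c2 + c3) * X + (1 - c1 - \<i> * c2 + \<i> * c3) * Y"
      by (simp add: algebra_simps)
    finally have zero: "(LINT x|M. W x * h x) = 0" using c by simp
    have eq: "W x * h x = complex_of_real (cmod (W x) * k x)" for x
    proof -
      have "W x * cnj (sgn (W x)) = complex_of_real (cmod (W x))"
        by (cases "W x = 0") (simp_all add: sgn_eq complex_norm_square[symmetric] power2_eq_square)
      then show ?thesis by (simp add: h_def flip: mult.assoc)
    qed
    have i: "integrable M (\<lambda>x. cmod (W x) * k x)"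
    proof -
      have "integrable M (\<lambda>x. W x * h x)" unfolding Wh using int by auto
      then have "integrable M (\<lambda>x. complex_of_real (cmod (W x) * k x))" unfolding eq .
      from integrable_Re[OF this] show ?thesis by simp
    qed
    have "complex_of_real (LINT x|M. cmod (W x) * k x) = 0"
      using zero unfolding eq by (simp del: of_real_mult)
    then have "(LINT x|M. cmod (W x) * k x) = 0" by simp
    then have "AE x in M. cmod (W x) * k x = 0"
      using integral_nonneg_eq_0_iff_AE[OF i] by (simp add: k_def)
    then show ?thesis by eventually_elim auto
  qed
  have "AE x in M. (G 1 x + 1 * G (-1) x + (-1) * G \<i> x + (-1) * G (-\<i>) x) * k x = 0"
    by (rule vanish[where ?c1.0 = 1 and ?c2.0 = "-1" and ?c3.0 = "-1"]) simp_all
  moreover have "AE x in M. (G 1 x + (-1) * G (-1) x + (-\<i>) * G \<i> x + \<i> * G (-\<i>) x) * k x = 0"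
    by (rule vanish[where ?c1.0 = "-1" and ?c2.0 = "-\<i>" and ?c3.0 = "\<i>"]) simp_all
  ultimately show ?thesis
  proof eventually_elim
    case (elim x)
    show ?case
    proof (cases "k x = 0")
      case True
      then show ?thesis by (simp add: k_def add_nonneg_eq_0_iff)
    next
      case False
      then have "G 1 x + G (-1) x = G \<i> x + G (-\<i>) x" "G 1 x - G (-1) x = \<i> * (G \<i> x - G (-\<i>) x)"
        using elim by (simp_all add: mult_eq_0_iff add_eq_0_iff right_diff_distrib eq_neg_iff_add_eq_0)
          (simp_all add: algebra_simps)
      then show ?thesis
        by (intro abs_Re_eq_abs_Im_of_duality_map[OF p]) (simp_all add: G_def)
    qed
  qed
qed

lemma disjoint_if_exponent_gt_1:
  assumes fg: "in_ranges f g" and p: "1 < p" "p \<noteq> 2"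
  shows "AE x in M. f x = 0 \<or> g x = 0"
proof -
  let ?z = "Complex (3/5) (4/5)"
  show ?thesis
    using balanced_if_exponent_gt_1[OF fg p] balanced_if_exponent_gt_1[OF in_ranges_scale[OF fg, of ?z] p]
  proof eventually_elim
    case (elim x)
    then have "f x * cnj (g x) = 0"
      by (intro eq_zero_if_rotations_balanced) (simp_all only: complex_cnj_mult mult_ac)
    then show ?case by simp
  qed
qed

text \<open>
  For \<open>p = 1\<close> the norm is not smooth, but it is additive: cutting \<open>f + \<lambda>g\<close> along a set \<open>S\<close> leaves
  no slack in the triangle inequality for the images under a rotation, so these images point in
  the direction of \<open>f + g\<close>.
\<close>

lemma cut_images_aligned:
  fixes cut :: "('x \<Rightarrow> complex) \<Rightarrow> 'x \<Rightarrow> complex"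
  assumes fg: "in_ranges f g" and l: "cmod l = 1" and p: "p = 1" and S: "Measurable.pred M S"
  defines "cut \<equiv> (\<lambda>u x. if S x then u x else 0)"
  shows "AE x in M. \<exists>k::real. e (cut f) x + l * e (cut g) x + cnj l * d (cut f) x + d (cut g) x = k * (f x + g x)"
proof -
  have f: "f \<in> Lp_functions p M" and g: "g \<in> Lp_functions p M" using fg by (auto simp: in_ranges_def)
  have ll: "cnj l * l = 1" using l by (rule cnj_mult_self_unimodular)
  let ?T = "\<lambda>h x. e h x + cnj l * d h x" and ?F = "\<lambda>x. f x + l * g x"
  define cut' where "cut' u x = (if \<not> S x then u x else 0)" for u :: "'x \<Rightarrow> complex" and x
  have T: "?T u \<in> Lp_functions p M" if "u \<in> Lp_functions p M" for u
    using that by (intro Lp_add Lp_scale e_closed d_closed)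
  have F: "?F \<in> Lp_functions p M" using f g by auto
  have c: "cut u \<in> Lp_functions p M" "cut' u \<in> Lp_functions p M" if "u \<in> Lp_functions p M" for u
    using Lp_restrict[OF that, of S] Lp_restrict[OF that, of "\<lambda>x. \<not> S x"] S by (simp_all add: cut_def cut'_def[abs_def])
  have "AE x in M. ?T ?F x = f x + g x"
    using rotation_of_ranges[OF fg, of l "cnj l"] ll by simp
  moreover have "?F = (\<lambda>x. cut ?F x + 1 * cut' ?F x)" by (auto simp: cut_def cut'_def)
  then have "AE x in M. e ?F x = e (cut ?F) x + 1 * e (cut' ?F) x" "AE x in M. d ?F x = d (cut ?F) x + 1 * d (cut' ?F) x"
    using e_linear[OF c[OF F], of 1] d_linear[OF c[OF F], of 1] by simp_all
  ultimately have split: "AE x in M. ?T (cut ?F) x + ?T (cut' ?F) x = f x + g x"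
    by eventually_elim (simp add: algebra_simps)
  let ?D = "\<lambda>x. cmod (?T (cut ?F) x) + cmod (?T (cut' ?F) x) - cmod (f x + g x)"
  note int = Lp_integrable[OF T[OF c(1)[OF F]]] Lp_integrable[OF T[OF c(2)[OF F]]] Lp_integrable[OF Lp_add[OF f g]]
  have iD: "integrable M ?D" using int p by simp
  have "(LINT x|M. ?D x) = Lp_integral p M (?T (cut ?F)) + Lp_integral p M (?T (cut' ?F)) - Lp_integral p M (\<lambda>x. f x + g x)"
    using int p by (simp add: Lp_integral_def)
  also have "\<dots> \<le> Lp_integral p M (cut ?F) + Lp_integral p M (cut' ?F) - Lp_integral p M (\<lambda>x. f x + g x)"
    using rotation_contractive[OF _ c(1)[OF F], of "cnj l"] rotation_contractive[OF _ c(2)[OF F], of "cnj l"] l by simp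
  also have "Lp_integral p M (cut ?F) + Lp_integral p M (cut' ?F) = Lp_integral p M (\<lambda>x. cut ?F x + cut' ?F x)"
    using c[OF F] by (intro Lp_integral_disjoint_add[symmetric]) (auto simp: cut_def cut'_def)
  also have "(\<lambda>x. cut ?F x + cut' ?F x) = ?F" by (auto simp: cut_def cut'_def)
  finally have "(LINT x|M. ?D x) \<le> 0" using Lp_integral_rotation[OF fg l] by simp
  moreover have nn: "AE x in M. 0 \<le> ?D x"
    using split
  proof eventually_elim
    case (elim x)
    then show ?case using norm_triangle_ineq[of "?T (cut ?F) x" "?T (cut' ?F) x"] by simp
  qed
  ultimately have "(LINT x|M. ?D x) = 0" using integral_nonneg_AE[OF nn] by simp
  then have "AE x in M. ?D x = 0" using integral_nonneg_eq_0_iff_AE[OF iD nn] by simp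
  moreover have "cut ?F = (\<lambda>x. cut f x + l * cut g x)" by (auto simp: cut_def)
  then have "AE x in M. e (cut ?F) x = e (cut f) x + l * e (cut g) x" "AE x in M. d (cut ?F) x = d (cut f) x + l * d (cut g) x"
    using e_linear[OF c(1)[OF f] c(1)[OF g], of l] d_linear[OF c(1)[OF f] c(1)[OF g], of l] by simp_all
  ultimately show ?thesis using split
  proof eventually_elim
    case (elim x)
    have "\<exists>k::real. a = k * (a + b)" if "cmod a + cmod b = cmod (a + b)" for a b :: complex
    proof (cases "cmod a + cmod b = 0")
      case True
      then show ?thesis by (simp add: add_nonneg_eq_0_iff)
    next
      case False
      have eq: "complex_of_real (cmod a) * b = complex_of_real (cmod b) * a"
        using that norm_triangle_eq[of a b] by (simp add: scaleR_conv_of_real)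
      have "complex_of_real (cmod a + cmod b) * a = complex_of_real (cmod a) * (a + b)"
        using eq by (simp add: algebra_simps)
      then have "a = complex_of_real (cmod a / (cmod a + cmod b)) * (a + b)"
        using False by (simp add: field_simps flip: of_real_add)
      then show ?thesis by blast
    qed
    from this[of "?T (cut ?F) x" "?T (cut' ?F) x"] obtain k :: real
      where "?T (cut ?F) x = k * (f x + g x)" using elim by auto
    moreover have "cnj l * (l * d (cut g) x) = d (cut g) x" by (simp add: ll flip: mult.assoc)
    then have "?T (cut ?F) x = e (cut f) x + l * e (cut g) x + cnj l * d (cut f) x + d (cut g) x"
      using elim by (simp add: distrib_left)
    ultimately show ?case by (metis (no_types, lifting))
  qed
qed

text \<open>
  Taking \<open>\<lambda>\<close> among the fourth roots of unity separates the two cross terms and shows that they are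
  multiples of \<open>f + g\<close> by conjugate complex numbers, hence of equal modulus. Replacing \<open>g\<close> by \<open>2 g\<close>
  doubles only one of them.
\<close>

lemma cut_cross_terms_vanish:
  assumes fg: "in_ranges f g" and p: "p = 1" and S: "Measurable.pred M S"
  shows "AE x in M. e (\<lambda>x. if S x then g x else 0) x = 0 \<and> d (\<lambda>x. if S x then f x else 0) x = 0"
proof -
  define cut where "cut u x = (if S x then u x else 0)" for u :: "'x \<Rightarrow> complex" and x
  have g: "g \<in> Lp_functions p M" using fg by (auto simp: in_ranges_def)
  have eq: "AE x in M. cmod (e (cut u) x) = cmod (d (cut f) x)" if fu: "in_ranges f u" for u
  proof -
    have al: "AE x in M. \<exists>k::real. e (cut f) x + l * e (cut u) x + cnj l * d (cut f) x + d (cut u) x = k * (f x + u x)"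
      if "cmod l = 1" for l
      using cut_images_aligned[OF fu that p S] by (simp only: cut_def[abs_def])
    show ?thesis
      using al[of 1, simplified] al[of "-1", simplified] al[of \<i>, simplified] al[of "-\<i>", simplified]
    proof eventually_elim
      case (elim x)
      define P Q R U c where PQ: "P = e (cut f) x" "Q = e (cut u) x" "R = d (cut f) x" "U = d (cut u) x" "c = f x + u x"
      obtain k1 k2 k3 k4 :: real where k: "P + Q + R + U = k1 * c" "P - Q - R + U = k2 * c"
        "P + \<i> * Q - \<i> * R + U = k3 * c" "P - \<i> * Q + \<i> * R + U = k4 * c"
        using elim unfolding PQ by (auto simp: algebra_simps)
      have "2 * (Q + R) = complex_of_real (k1 - k2) * c"
        using arg_cong2[OF k(1) k(2), of "(-)"] by (simp add: algebra_simps)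
      moreover have "2 * (Q - R) = - \<i> * (complex_of_real (k3 - k4) * c)"
      proof -
        have "2 * \<i> * (Q - R) = complex_of_real (k3 - k4) * c"
          using arg_cong2[OF k(3) k(4), of "(-)"] by (simp add: algebra_simps)
        moreover have "2 * (Q - R) = - \<i> * (2 * \<i> * (Q - R))"
          by (simp add: complex_eq_iff)
        ultimately show ?thesis by (simp only:)
      qed
      moreover have "4 * Q = 2 * (Q + R) + 2 * (Q - R)" "4 * R = 2 * (Q + R) - 2 * (Q - R)"
        by (simp_all add: algebra_simps)
      ultimately have "4 * Q = (complex_of_real (k1 - k2) - \<i> * complex_of_real (k3 - k4)) * c"
        "4 * R = (complex_of_real (k1 - k2) + \<i> * complex_of_real (k3 - k4)) * c"
        by (simp_all only:) (simp_all add: left_diff_distrib distrib_right)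
      then have "4 * cmod Q = cmod (complex_of_real (k1 - k2) - \<i> * complex_of_real (k3 - k4)) * cmod c"
        "4 * cmod R = cmod (complex_of_real (k1 - k2) + \<i> * complex_of_real (k3 - k4)) * cmod c"
        by (metis norm_mult norm_numeral)+
      moreover have "cmod (complex_of_real r - \<i> * complex_of_real s) = cmod (complex_of_real r + \<i> * complex_of_real s)" for r s
        by (simp add: cmod_def)
      ultimately have "4 * cmod Q = 4 * cmod R" by (simp only:)
      then show ?case unfolding PQ by simp
    qed
  qed
  have cg: "cut g \<in> Lp_functions p M" using Lp_restrict[OF g S] by (simp add: cut_def[abs_def])
  have "cut (\<lambda>x. 2 * g x) = (\<lambda>x. cut g x + 1 * cut g x)" by (auto simp: cut_def)
  then have "AE x in M. e (cut (\<lambda>x. 2 * g x)) x = e (cut g) x + 1 * e (cut g) x"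
    using e_linear[OF cg cg, of 1] by simp
  with eq[OF fg] eq[OF in_ranges_scale[OF fg, of 2]]
  have "AE x in M. e (cut g) x = 0 \<and> d (cut f) x = 0"
  proof eventually_elim
    case (elim x)
    then have "cmod (2 * e (cut g) x) = cmod (e (cut g) x)" by simp
    then have "e (cut g) x = 0" by (simp add: norm_mult)
    then show ?case using elim by simp
  qed
  then show ?thesis by (simp add: cut_def[abs_def])
qed

text \<open>
  Without the cross terms the image of the cut of \<open>f + \<lambda>g\<close> does not depend on \<open>\<lambda>\<close> after undoing the
  rotation. Additivity of the norm over a set and its complement then makes \<open>\<integral>\<^sub>S \<bar>f + \<lambda>g\<bar>\<close> independent
  of \<open>\<lambda>\<close> for every \<open>S\<close>.
\<close>

lemma abs_rotation_le:
  assumes fg: "in_ranges f g" and l: "cmod l = 1" and m: "cmod m = 1" and p: "p = 1"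
  shows "AE x in M. cmod (f x + l * g x) \<le> cmod (f x + m * g x)"
proof -
  have f: "f \<in> Lp_functions p M" and g: "g \<in> Lp_functions p M" using fg by (auto simp: in_ranges_def)
  note [measurable] = Lp_measurable[OF f] Lp_measurable[OF g]
  define S where "S x \<longleftrightarrow> cmod (f x + m * g x) < cmod (f x + l * g x)" for x
  have S: "Measurable.pred M S" unfolding S_def[abs_def] by measurable
  define cut where "cut Q u x = (if Q x then u x else 0)" for Q and u :: "'x \<Rightarrow> complex" and x
  have c: "cut Q u \<in> Lp_functions p M" if "Measurable.pred M Q" "u \<in> Lp_functions p M" for Q u
    using Lp_restrict[OF that(2,1)] by (simp add: cut_def[abs_def])
  let ?F = "\<lambda>l x. f x + l * g x"
  have F: "?F l \<in> Lp_functions p M" for l using f g by auto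
  define V where "V Q x = e (cut Q f) x + d (cut Q g) x" for Q x
  have V: "V Q \<in> Lp_functions p M" if "Measurable.pred M Q" for Q
    unfolding V_def[abs_def] using c[OF that f] c[OF that g] by (intro Lp_add e_closed d_closed)
  have bound: "Lp_integral p M (V Q) \<le> Lp_integral p M (cut Q (?F l))"
    if Q: "Measurable.pred M Q" and l: "cmod l = 1" for Q l
  proof -
    have ll: "cnj l * l = 1" using l by (rule cnj_mult_self_unimodular)
    have "cut Q (?F l) = (\<lambda>x. cut Q f x + l * cut Q g x)" by (auto simp: cut_def)
    then have "AE x in M. e (cut Q (?F l)) x = e (cut Q f) x + l * e (cut Q g) x"
      "AE x in M. d (cut Q (?F l)) x = d (cut Q f) x + l * d (cut Q g) x"
      using e_linear[OF c[OF Q f] c[OF Q g], of l] d_linear[OF c[OF Q f] c[OF Q g], of l] by simp_all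
    moreover have "AE x in M. e (cut Q g) x = 0 \<and> d (cut Q f) x = 0"
      using cut_cross_terms_vanish[OF fg p Q] by (simp add: cut_def[abs_def])
    ultimately have "AE x in M. V Q x = e (cut Q (?F l)) x + cnj l * d (cut Q (?F l)) x"
      by eventually_elim (simp add: V_def ll flip: mult.assoc)
    then have "Lp_integral p M (V Q) = Lp_integral p M (\<lambda>x. e (cut Q (?F l)) x + cnj l * d (cut Q (?F l)) x)"
      using V[OF Q] c[OF Q F] by (intro Lp_integral_cong_AE Lp_measurable[where p = p] Lp_add Lp_scale e_closed d_closed) auto
    also have "\<dots> \<le> Lp_integral p M (cut Q (?F l))"
      using c[OF Q F] l by (intro rotation_contractive) auto
    finally show ?thesis .
  qed
  let ?S' = "\<lambda>x. \<not> S x"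
  have S': "Measurable.pred M ?S'" using S by simp
  have cutadd: "Lp_integral p M (cut S u) + Lp_integral p M (cut ?S' u) = Lp_integral p M u" if "u \<in> Lp_functions p M" for u
  proof -
    have "Lp_integral p M (\<lambda>x. cut S u x + cut ?S' u x) = Lp_integral p M (cut S u) + Lp_integral p M (cut ?S' u)"
      by (rule Lp_integral_disjoint_add[OF c[OF S that] c[OF S' that]]) (auto simp: cut_def)
    moreover have "(\<lambda>x. cut S u x + cut ?S' u x) = u" by (auto simp: cut_def)
    ultimately show ?thesis by simp
  qed
  have "AE x in M. V S x + V ?S' x = f x + g x"
  proof -
    have sp: "u = (\<lambda>x. cut S u x + 1 * cut ?S' u x)" for u by (auto simp: cut_def)
    have "AE x in M. e f x = e (cut S f) x + 1 * e (cut ?S' f) x" "AE x in M. d g x = d (cut S g) x + 1 * d (cut ?S' g) x"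
      using e_linear[OF c[OF S f] c[OF S' f], of 1] d_linear[OF c[OF S g] c[OF S' g], of 1]
      by (simp_all only: sp[symmetric])
    moreover have "AE x in M. e f x = f x \<and> d f x = 0 \<and> e g x = 0 \<and> d g x = g x"
      using fg by (simp add: in_ranges_def)
    ultimately show ?thesis by eventually_elim (simp add: V_def)
  qed
  then have "Lp_integral p M (\<lambda>x. V S x + V ?S' x) = Lp_integral p M (\<lambda>x. f x + g x)"
    using V[OF S] V[OF S'] f g by (intro Lp_integral_cong_AE Lp_measurable[where p = p] Lp_add)
  moreover have "Lp_norm p M (\<lambda>x. V S x + V ?S' x) \<le> Lp_norm p M (V S) + Lp_norm p M (V ?S')"
    using V[OF S] V[OF S'] by (rule Lp_norm_triangle)
  ultimately have "Lp_integral p M (?F l) \<le> Lp_integral p M (V S) + Lp_integral p M (V ?S')"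
    using p Lp_integral_rotation[OF fg l] by (simp add: Lp_norm_def)
  then have "Lp_integral p M (cut S (?F l)) \<le> Lp_integral p M (V S)"
    using bound[OF S' l] cutadd[OF F[of l]] by simp
  also have "\<dots> \<le> Lp_integral p M (cut S (?F m))" using bound[OF S m] .
  finally have le: "Lp_integral p M (cut S (?F l)) \<le> Lp_integral p M (cut S (?F m))" .
  let ?D = "\<lambda>x. cmod (cut S (?F l) x) - cmod (cut S (?F m) x)"
  have iD: "integrable M ?D"
    using Lp_integrable[OF c[OF S F[of l]]] Lp_integrable[OF c[OF S F[of m]]] p by simp
  have nn: "0 \<le> ?D x" for x by (auto simp: cut_def S_def)
  have "(LINT x|M. ?D x) \<le> 0"
    using le Lp_integrable[OF c[OF S F[of l]]] Lp_integrable[OF c[OF S F[of m]]] p by (simp add: Lp_integral_def)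
  then have "(LINT x|M. ?D x) = 0" using integral_nonneg_AE[of ?D M] nn by simp
  then have "AE x in M. ?D x = 0" using integral_nonneg_eq_0_iff_AE[OF iD] nn by simp
  then show ?thesis by eventually_elim (auto simp: cut_def S_def split: if_splits)
qed

lemma disjoint_if_exponent_eq_1:
  assumes fg: "in_ranges f g" and p: "p = 1"
  shows "AE x in M. f x = 0 \<or> g x = 0"
  using abs_rotation_le[OF fg _ _ p, of 1 "-1", simplified] abs_rotation_le[OF fg _ _ p, of "-1" 1, simplified]
    abs_rotation_le[OF fg _ _ p, of \<i> "-\<i>", simplified] abs_rotation_le[OF fg _ _ p, of "-\<i>" \<i>, simplified]
proof eventually_elim
  case (elim x)
  have "cmod (f x + g x) = cmod (f x - g x)" "cmod (f x + \<i> * g x) = cmod (f x - \<i> * g x)"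
    using elim by auto
  then have "Re (f x * cnj (g x)) = 0" "Re (f x * cnj (\<i> * g x)) = 0"
    using cmod_add_power2[of "f x" "g x"] cmod_add_power2[of "f x" "- g x"]
      cmod_add_power2[of "f x" "\<i> * g x"] cmod_add_power2[of "f x" "- (\<i> * g x)"] by simp_all
  then have "f x * cnj (g x) = 0" by (simp add: complex_eq_iff)
  then show ?case by simp
qed

lemma ranges_disjoint:
  assumes "in_ranges f g" and "p \<noteq> 2"
  shows "AE x in M. f x = 0 \<or> g x = 0"
  using disjoint_if_exponent_eq_1[OF assms(1)] disjoint_if_exponent_gt_1[OF assms(1)] assms(2) p_ge1 by fastforce

end

section \<open>Contractive representations of direct sums of matrix algebras\<close>

text \<open>
  An element of the direct sum of the matrix algebras of sizes \<open>sz 1, \<dots>, sz blocks\<close> is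
  represented by its entries \<open>a k i j\<close>; entries outside the ranges of the indices do not matter.
\<close>

definition block_mult :: "(nat \<Rightarrow> nat) \<Rightarrow> (nat \<Rightarrow> nat \<Rightarrow> nat \<Rightarrow> complex) \<Rightarrow> (nat \<Rightarrow> nat \<Rightarrow> nat \<Rightarrow> complex) \<Rightarrow> nat \<Rightarrow> nat \<Rightarrow> nat \<Rightarrow> complex" where
  "block_mult sz a b k i j = (\<Sum>l=1..sz k. a k i l * b k l j)"

definition matrix_unit :: "nat \<Rightarrow> nat \<Rightarrow> nat \<Rightarrow> nat \<Rightarrow> nat \<Rightarrow> nat \<Rightarrow> complex" where
  "matrix_unit k i j k' i' j' = (if k' = k \<and> i' = i \<and> j' = j then 1 else 0)"

definition block_diagonal :: "(nat \<Rightarrow> nat \<Rightarrow> complex) \<Rightarrow> nat \<Rightarrow> nat \<Rightarrow> nat \<Rightarrow> complex" where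
  "block_diagonal w k i j = (if i = j then w k i else 0)"

text \<open>
  Every block is a contraction of the \<open>\<ell>\<^sup>p\<close> space on which it acts.
\<close>

definition block_contraction :: "real \<Rightarrow> nat \<Rightarrow> (nat \<Rightarrow> nat) \<Rightarrow> (nat \<Rightarrow> nat \<Rightarrow> nat \<Rightarrow> complex) \<Rightarrow> bool" where
  "block_contraction p blocks sz a \<longleftrightarrow> (\<forall>k\<in>{1..blocks}. \<forall>v.
     (\<Sum>i=1..sz k. cmod (\<Sum>j=1..sz k. a k i j * v j) powr p) \<le> (\<Sum>j=1..sz k. cmod (v j) powr p))"

lemma block_contraction_diagonal:
  assumes "0 \<le> p" "\<And>k i. cmod (w k i) \<le> 1"
  shows "block_contraction p blocks sz (block_diagonal w)"
  unfolding block_contraction_def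
proof (intro ballI allI sum_mono)
  fix k i v assume i: "i \<in> {1..sz k}"
  have "(\<Sum>j=1..sz k. block_diagonal w k i j * v j) = (\<Sum>j=1..sz k. if i = j then w k i * v i else 0)"
    by (intro sum.cong) (auto simp: block_diagonal_def)
  also have "\<dots> = w k i * v i" using i by simp
  finally show "cmod (\<Sum>j=1..sz k. block_diagonal w k i j * v j) powr p \<le> cmod (v i) powr p"
    using assms by (auto simp: norm_mult intro!: powr_mono2 mult_left_le_one_le)
qed

lemma block_contraction_matrix_unit: "block_contraction p blocks sz (matrix_unit k i j)"
  unfolding block_contraction_def
proof (intro ballI allI)
  fix k' v
  have row: "cmod (\<Sum>j'=1..sz k'. matrix_unit k i j k' i' j' * v j') powr p
      = (if i' = i then (if k' = k \<and> j \<in> {1..sz k'} then cmod (v j) powr p else 0) else 0)" for i'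
  proof -
    have "(\<Sum>j'=1..sz k'. matrix_unit k i j k' i' j' * v j')
        = (\<Sum>j'=1..sz k'. if j' = j then (if k' = k \<and> i' = i then v j else 0) else 0)"
      by (intro sum.cong) (auto simp: matrix_unit_def)
    then show ?thesis by auto
  qed
  have "(\<Sum>i'=1..sz k'. cmod (\<Sum>j'=1..sz k'. matrix_unit k i j k' i' j' * v j') powr p)
      \<le> (if j \<in> {1..sz k'} then cmod (v j) powr p else 0)"
    unfolding row by auto
  also have "\<dots> \<le> (\<Sum>j=1..sz k'. cmod (v j) powr p)"
    by (auto intro!: sum_nonneg member_le_sum)
  finally show "(\<Sum>i'=1..sz k'. cmod (\<Sum>j'=1..sz k'. matrix_unit k i j k' i' j' * v j') powr p)
      \<le> (\<Sum>j=1..sz k'. cmod (v j) powr p)" .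
qed

lemma block_mult_matrix_units:
  assumes "j \<in> {1..sz k}"
  shows "block_mult sz (matrix_unit k i j) (matrix_unit k j l) = matrix_unit k i l"
proof (intro ext)
  fix k' i' l'
  have "block_mult sz (matrix_unit k i j) (matrix_unit k j l) k' i' l'
      = (\<Sum>j'=1..sz k'. if j' = j then matrix_unit k i l k' i' l' else 0)"
    unfolding block_mult_def by (intro sum.cong) (auto simp: matrix_unit_def)
  also have "\<dots> = matrix_unit k i l k' i' l'" using assms by (auto simp: matrix_unit_def)
  finally show "block_mult sz (matrix_unit k i j) (matrix_unit k j l) k' i' l' = matrix_unit k i l k' i' l'" .
qed

lemma block_mult_matrix_units_zero:
  assumes "(k, j) \<noteq> (k', i')"
  shows "block_mult sz (matrix_unit k i j) (matrix_unit k' i' l) = (\<lambda>_ _ _. 0)"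
  using assms by (auto simp: block_mult_def matrix_unit_def fun_eq_iff intro!: sum.neutral)

lemma block_mult_matrix_unit_left:
  assumes "i \<in> {1..sz k}" "j' \<in> {1..sz k'}"
  shows "block_mult sz (matrix_unit k m i) b k' i' j' = (\<Sum>l=1..sz k. b k i l * matrix_unit k m l k' i' j')"
proof -
  have "block_mult sz (matrix_unit k m i) b k' i' j' = (\<Sum>l=1..sz k'. if l = i then (if k' = k \<and> i' = m then b k i j' else 0) else 0)"
    unfolding block_mult_def by (intro sum.cong) (auto simp: matrix_unit_def)
  also have "\<dots> = (if k' = k \<and> i' = m then b k i j' else 0)"
    using assms by auto
  also have "\<dots> = (\<Sum>l=1..sz k. if l = j' then (if k' = k \<and> i' = m then b k i j' else 0) else 0)"
    using assms by auto
  also have "\<dots> = (\<Sum>l=1..sz k. b k i l * matrix_unit k m l k' i' j')"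
    by (intro sum.cong) (auto simp: matrix_unit_def)
  finally show ?thesis .
qed

lemma block_mult_matrix_unit_right:
  assumes "j \<in> {1..sz k}" "i' \<in> {1..sz k'}"
  shows "block_mult sz b (matrix_unit k j m) k' i' j' = (\<Sum>l=1..sz k. b k l j * matrix_unit k l m k' i' j')"
proof -
  have "block_mult sz b (matrix_unit k j m) k' i' j' = (\<Sum>l=1..sz k'. if l = j then (if k' = k \<and> j' = m then b k i' j else 0) else 0)"
    unfolding block_mult_def by (intro sum.cong) (auto simp: matrix_unit_def)
  also have "\<dots> = (if k' = k \<and> j' = m then b k i' j else 0)"
    using assms by auto
  also have "\<dots> = (\<Sum>l=1..sz k. if l = i' then (if k' = k \<and> j' = m then b k i' j else 0) else 0)"
    using assms by auto
  also have "\<dots> = (\<Sum>l=1..sz k. b k l j * matrix_unit k l m k' i' j')"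
    by (intro sum.cong) (auto simp: matrix_unit_def)
  finally show ?thesis .
qed

definition block_indices :: "nat \<Rightarrow> (nat \<Rightarrow> nat) \<Rightarrow> (nat \<times> nat) set" where
  "block_indices blocks sz = (SIGMA k:{1..blocks}. {1..sz k})"

lemma finite_block_indices [simp]: "finite (block_indices blocks sz)"
  by (simp add: block_indices_def)

lemma block_identity_eq_sum:
  assumes "k \<in> {1..blocks}" "i \<in> {1..sz k}"
  shows "block_diagonal (\<lambda>_ _. 1) k i j = (\<Sum>s\<in>block_indices blocks sz. 1 * matrix_unit (fst s) (snd s) (snd s) k i j)"
proof -
  have "(\<Sum>s\<in>block_indices blocks sz. 1 * matrix_unit (fst s) (snd s) (snd s) k i j)
      = (\<Sum>s\<in>block_indices blocks sz. if s = (k, i) then block_diagonal (\<lambda>_ _. 1) k i j else 0)"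
    by (intro sum.cong) (auto simp: matrix_unit_def block_diagonal_def)
  also have "\<dots> = block_diagonal (\<lambda>_ _. 1) k i j" using assms by (auto simp: block_indices_def)
  finally show ?thesis by simp
qed

lemma block_mult_identity_left:
  assumes "i \<in> {1..sz k}"
  shows "block_mult sz (block_diagonal (\<lambda>_ _. 1)) b k i j = b k i j"
proof -
  have "block_mult sz (block_diagonal (\<lambda>_ _. 1)) b k i j = (\<Sum>l=1..sz k. if l = i then b k i j else 0)"
    unfolding block_mult_def by (intro sum.cong) (auto simp: block_diagonal_def)
  then show ?thesis using assms by simp
qed

text \<open>
  The operators act on functions instead of almost everywhere classes, and the algebraic identities
  hold almost everywhere.
\<close>

locale contractive_block_representation = lp_exponent +
  fixes M :: "'x measure" and blocks :: nat and sz :: "nat \<Rightarrow> nat"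
    and R :: "(nat \<Rightarrow> nat \<Rightarrow> nat \<Rightarrow> complex) \<Rightarrow> ('x \<Rightarrow> complex) \<Rightarrow> 'x \<Rightarrow> complex"
  assumes p_neq_2: "p \<noteq> 2"
    and R_closed: "f \<in> Lp_functions p M \<Longrightarrow> R a f \<in> Lp_functions p M"
    and R_linear: "f \<in> Lp_functions p M \<Longrightarrow> g \<in> Lp_functions p M
      \<Longrightarrow> AE x in M. R a (\<lambda>x. f x + c * g x) x = R a f x + c * R a g x"
    and R_add: "f \<in> Lp_functions p M
      \<Longrightarrow> AE x in M. R (\<lambda>k i j. a k i j + c * b k i j) f x = R a f x + c * R b f x"
    and R_mult: "f \<in> Lp_functions p M \<Longrightarrow> AE x in M. R (block_mult sz a b) f x = R a (R b f) x"
    and R_cong: "(\<And>k i j. k \<in> {1..blocks} \<Longrightarrow> i \<in> {1..sz k} \<Longrightarrow> j \<in> {1..sz k} \<Longrightarrow> a k i j = b k i j)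
      \<Longrightarrow> R a f = R b f"
    and R_contractive: "block_contraction p blocks sz a \<Longrightarrow> f \<in> Lp_functions p M
      \<Longrightarrow> Lp_integral p M (R a f) \<le> Lp_integral p M f"
begin

lemma R_zero:
  assumes "f \<in> Lp_functions p M"
  shows "AE x in M. R (\<lambda>_ _ _. 0) f x = 0"
  using R_add[OF assms, of "\<lambda>_ _ _. 0" "-1" "\<lambda>_ _ _. 0"] by simp

lemma R_of_zero: "AE x in M. R a (\<lambda>_. 0) x = 0"
  using R_linear[of "\<lambda>_. 0" "\<lambda>_. 0" a "-1"] by simp

lemma R_sum:
  assumes "finite S" and f: "f \<in> Lp_functions p M"
  shows "AE x in M. R (\<lambda>k i j. \<Sum>s\<in>S. c s * a s k i j) f x = (\<Sum>s\<in>S. c s * R (a s) f x)"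
  using assms(1)
proof (induction S rule: finite_induct)
  case empty
  then show ?case using R_zero[OF f] by simp
next
  case (insert t S)
  have eq: "(\<lambda>k i j. \<Sum>s\<in>insert t S. c s * a s k i j) = (\<lambda>k i j. (\<Sum>s\<in>S. c s * a s k i j) + c t * a t k i j)"
    using insert by (simp add: add.commute)
  show ?case
    using R_add[OF f, of "\<lambda>k i j. \<Sum>s\<in>S. c s * a s k i j" "c t" "a t"] insert.IH
    unfolding eq by eventually_elim (use insert in \<open>simp add: add.commute\<close>)
qed

lemma R_of_sum:
  assumes "finite S" and f: "\<And>s. s \<in> S \<Longrightarrow> f s \<in> Lp_functions p M"
  shows "AE x in M. R a (\<lambda>x. \<Sum>s\<in>S. c s * f s x) x = (\<Sum>s\<in>S. c s * R a (f s) x)"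
  using assms
proof (induction S rule: finite_induct)
  case empty
  then show ?case using R_of_zero by simp
next
  case (insert t S)
  have eq: "(\<lambda>x. \<Sum>s\<in>insert t S. c s * f s x) = (\<lambda>x. (\<Sum>s\<in>S. c s * f s x) + c t * f t x)"
    using insert by (simp add: add.commute)
  have "(\<lambda>x. \<Sum>s\<in>S. c s * f s x) \<in> Lp_functions p M" using insert by (intro Lp_sum Lp_scale) auto
  then have "AE x in M. R a (\<lambda>x. (\<Sum>s\<in>S. c s * f s x) + c t * f t x) x
      = R a (\<lambda>x. \<Sum>s\<in>S. c s * f s x) x + c t * R a (f t) x"
    using insert by (intro R_linear) auto
  moreover have "AE x in M. R a (\<lambda>x. \<Sum>s\<in>S. c s * f s x) x = (\<Sum>s\<in>S. c s * R a (f s) x)"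
    using insert by auto
  ultimately show ?case
    unfolding eq by eventually_elim (use insert in \<open>simp add: add.commute\<close>)
qed

lemma R_measurable: "f \<in> Lp_functions p M \<Longrightarrow> R a f \<in> borel_measurable M"
  by (rule Lp_measurable[OF R_closed])

abbreviation E :: "nat \<Rightarrow> nat \<Rightarrow> nat \<Rightarrow> ('x \<Rightarrow> complex) \<Rightarrow> 'x \<Rightarrow> complex" where
  "E k i j \<equiv> R (matrix_unit k i j)"

lemma E_E:
  assumes "f \<in> Lp_functions p M" "j \<in> {1..sz k}"
  shows "AE x in M. E k i j (E k j l f) x = E k i l f x"
  using R_mult[OF assms(1), of "matrix_unit k i j" "matrix_unit k j l"]
  unfolding block_mult_matrix_units[where sz = sz and k = k, OF assms(2)] by eventually_elim simp

lemma E_E_zero: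
  assumes "f \<in> Lp_functions p M" "(k, j) \<noteq> (k', i')"
  shows "AE x in M. E k i j (E k' i' l f) x = 0"
  using R_mult[OF assms(1), of "matrix_unit k i j" "matrix_unit k' i' l"] R_zero[OF assms(1)]
  unfolding block_mult_matrix_units_zero[OF assms(2)] by eventually_elim simp

text \<open>
  A diagonal matrix with entries of modulus at most \<open>1\<close> is a contraction, so the two diagonal matrix
  units that fix the given functions form a hermitian pair.
\<close>

lemma E_disjoint:
  assumes f: "f \<in> Lp_functions p M" and g: "g \<in> Lp_functions p M"
    and i: "i \<in> {1..sz k}" "i' \<in> {1..sz k'}" and neq: "(k, i) \<noteq> (k', i')"
  shows "AE x in M. E k i j f x = 0 \<or> E k' i' j' g x = 0"
proof -
  interpret hermitian_pair p M "E k i i" "E k' i' i'"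
  proof
    fix u v c l assume u: "u \<in> Lp_functions p M"
    show "E k i i u \<in> Lp_functions p M" "E k' i' i' u \<in> Lp_functions p M" using u by (auto intro: R_closed)
    {
      assume v: "v \<in> Lp_functions p M"
      show "AE x in M. E k i i (\<lambda>x. u x + c * v x) x = E k i i u x + c * E k i i v x"
        "AE x in M. E k' i' i' (\<lambda>x. u x + c * v x) x = E k' i' i' u x + c * E k' i' i' v x"
        using u v by (auto intro: R_linear)
    }
    assume l: "cmod l = 1"
    let ?a = "\<lambda>k0 i0 j0. matrix_unit k i i k0 i0 j0 + l * matrix_unit k' i' i' k0 i0 j0"
    have "?a = block_diagonal (\<lambda>k0 i0. if (k0, i0) = (k, i) then 1 else if (k0, i0) = (k', i') then l else 0)"
      using neq by (auto simp: block_diagonal_def matrix_unit_def fun_eq_iff)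
    then have "block_contraction p blocks sz ?a"
      using p_ge1 l by (simp only:) (intro block_contraction_diagonal, auto)
    then have "Lp_integral p M (R ?a u) \<le> Lp_integral p M u" using u by (rule R_contractive)
    moreover have "Lp_integral p M (R ?a u) = Lp_integral p M (\<lambda>x. E k i i u x + l * E k' i' i' u x)"
      using R_add[OF u] u by (intro Lp_integral_cong_AE Lp_measurable[where p = p] Lp_add Lp_scale R_closed)
    ultimately show "Lp_integral p M (\<lambda>x. E k i i u x + l * E k' i' i' u x) \<le> Lp_integral p M u" by simp
  qed
  have "AE x in M. E k i i (E k i j f) x = E k i j f x \<and> E k' i' i' (E k i j f) x = 0
      \<and> E k i i (E k' i' j' g) x = 0 \<and> E k' i' i' (E k' i' j' g) x = E k' i' j' g x"
    using E_E[OF f i(1), of i j] E_E[OF g i(2), of i' j'] E_E_zero[OF f neq[symmetric], of i' j] E_E_zero[OF g neq, of i j']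
    by eventually_elim simp
  then have "in_ranges (E k i j f) (E k' i' j' g)"
    using f g by (simp add: in_ranges_def R_closed)
  then show ?thesis using p_neq_2 by (rule ranges_disjoint)
qed

lemma Lp_integral_E_row_le:
  assumes f: "f \<in> Lp_functions p M" and "i' \<in> {1..sz k}"
  shows "Lp_integral p M (E k i j f) \<le> Lp_integral p M (E k i' j f)"
proof -
  have "Lp_integral p M (E k i j f) = Lp_integral p M (E k i i' (E k i' j f))"
    using f by (intro Lp_integral_cong_AE R_measurable R_closed eventually_mono[OF E_E[OF assms, of i j]]) simp_all
  also have "\<dots> \<le> Lp_integral p M (E k i' j f)"
    using f by (intro R_contractive block_contraction_matrix_unit R_closed)
  finally show ?thesis .
qed

lemma Lp_integral_E_row:
  assumes "f \<in> Lp_functions p M" "i \<in> {1..sz k}" "i' \<in> {1..sz k}"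
  shows "Lp_integral p M (E k i j f) = Lp_integral p M (E k i' j f)"
  using Lp_integral_E_row_le[OF assms(1,2)] Lp_integral_E_row_le[OF assms(1,3)] by (intro antisym)

abbreviation one :: "nat \<Rightarrow> nat \<Rightarrow> nat \<Rightarrow> complex" where
  "one \<equiv> block_diagonal (\<lambda>_ _. 1)"

lemma R_one:
  assumes f: "f \<in> Lp_functions p M"
  shows "AE x in M. R one f x = (\<Sum>s\<in>block_indices blocks sz. E (fst s) (snd s) (snd s) f x)"
proof -
  have "R one f = R (\<lambda>k i j. \<Sum>s\<in>block_indices blocks sz. 1 * matrix_unit (fst s) (snd s) (snd s) k i j) f"
    by (intro R_cong block_identity_eq_sum)
  then show ?thesis
    using R_sum[OF finite_block_indices f, of "\<lambda>_. 1" "\<lambda>s. matrix_unit (fst s) (snd s) (snd s)" blocks sz] by simp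
qed

text \<open>
  The summands \<open>E k i i f\<close> are disjoint, and \<open>E k 1 i f\<close> has the norm of \<open>E k i i f\<close>.
\<close>

lemma Lp_integral_R_one:
  assumes f: "f \<in> Lp_functions p M" and "\<And>k. k \<in> {1..blocks} \<Longrightarrow> 0 < sz k"
  shows "Lp_integral p M (R one f) = (\<Sum>k=1..blocks. \<Sum>i=1..sz k. Lp_integral p M (E k 1 i f))"
proof -
  have "Lp_integral p M (R one f) = Lp_integral p M (\<lambda>x. \<Sum>s\<in>block_indices blocks sz. E (fst s) (snd s) (snd s) f x)"
    using R_one[OF f] f by (intro Lp_integral_cong_AE Lp_measurable[where p = p] Lp_sum R_closed)
  also have "\<dots> = (\<Sum>s\<in>block_indices blocks sz. Lp_integral p M (E (fst s) (snd s) (snd s) f))"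
    using f by (intro Lp_integral_disjoint_sum finite_block_indices R_closed E_disjoint)
      (auto simp: block_indices_def)
  also have "\<dots> = (\<Sum>k=1..blocks. \<Sum>i=1..sz k. Lp_integral p M (E k i i f))"
    unfolding block_indices_def by (subst sum.Sigma) (auto simp: case_prod_beta)
  also have "\<dots> = (\<Sum>k=1..blocks. \<Sum>i=1..sz k. Lp_integral p M (E k 1 i f))"
    using assms(2) by (intro sum.cong refl Lp_integral_E_row f) (auto simp: Suc_le_eq)
  finally show ?thesis .
qed

lemma R_one_R:
  assumes f: "f \<in> Lp_functions p M"
  shows "AE x in M. R one (R a f) x = R a f x"
proof -
  have "R (block_mult sz one a) f = R a f" by (intro R_cong block_mult_identity_left)
  then show ?thesis using R_mult[OF f, of one a] by (auto elim: eventually_mono)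
qed

lemma E_R:
  assumes f: "f \<in> Lp_functions p M" and i: "i \<in> {1..sz k}"
  shows "AE x in M. E k m i (R b f) x = (\<Sum>l=1..sz k. b k i l * E k m l f x)"
proof -
  have "R (block_mult sz (matrix_unit k m i) b) f = R (\<lambda>k' i' j'. \<Sum>l=1..sz k. b k i l * matrix_unit k m l k' i' j') f"
    by (intro R_cong block_mult_matrix_unit_left i)
  with R_mult[OF f, of "matrix_unit k m i" b]
    R_sum[OF finite_atLeastAtMost f, of "\<lambda>l. b k i l" "\<lambda>l. matrix_unit k m l" 1 "sz k"]
  show ?thesis by (auto elim: eventually_elim2)
qed

lemma R_E:
  assumes f: "f \<in> Lp_functions p M" and j: "j \<in> {1..sz k}"
  shows "AE x in M. R b (E k j m f) x = (\<Sum>l=1..sz k. b k l j * E k l m f x)"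
proof -
  have "R (block_mult sz b (matrix_unit k j m)) f = R (\<lambda>k' i' j'. \<Sum>l=1..sz k. b k l j * matrix_unit k l m k' i' j') f"
    by (intro R_cong block_mult_matrix_unit_right j)
  with R_mult[OF f, of b "matrix_unit k j m"]
    R_sum[OF finite_atLeastAtMost f, of "\<lambda>l. b k l j" "\<lambda>l. matrix_unit k l m" 1 "sz k"]
  show ?thesis by (auto elim: eventually_elim2)
qed

end

text \<open>
  Here and below \<open>C\<close> bounds the p-th power of an operator norm. The matrix with entries \<open>b i j r s\<close> acts
  on \<open>\<ell>\<^sup>p({1..n} \<times> {1..m})\<close>.
\<close>

definition scalar_bound ::
    "real \<Rightarrow> nat \<Rightarrow> nat \<Rightarrow> (nat \<Rightarrow> nat \<Rightarrow> nat \<Rightarrow> nat \<Rightarrow> complex) \<Rightarrow> real \<Rightarrow> bool" where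
  "scalar_bound p n m b C \<longleftrightarrow> (\<forall>c.
     (\<Sum>i=1..n. \<Sum>r=1..m. cmod (\<Sum>j=1..n. \<Sum>s=1..m. b i j r s * c j s) powr p)
       \<le> C * (\<Sum>j=1..n. \<Sum>s=1..m. cmod (c j s) powr p))"

definition matrix_bound ::
    "real \<Rightarrow> 'x measure \<Rightarrow> nat \<Rightarrow> (nat \<Rightarrow> nat \<Rightarrow> ('x \<Rightarrow> complex) \<Rightarrow> 'x \<Rightarrow> complex) \<Rightarrow> real \<Rightarrow> bool" where
  "matrix_bound p M n t C \<longleftrightarrow> (\<forall>F. (\<forall>j\<in>{1..n}. F j \<in> Lp_functions p M) \<longrightarrow>
     (\<Sum>i=1..n. Lp_integral p M (\<lambda>x. \<Sum>j=1..n. t i j (F j) x)) \<le> C * (\<Sum>j=1..n. Lp_integral p M (F j)))"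

text \<open>
  The bound for scalars holds at every point, and can be integrated.
\<close>

lemma (in lp_exponent) scalar_bound_Lp:
  assumes bound: "scalar_bound p n m b C"
    and H: "\<And>j s. j \<in> {1..n} \<Longrightarrow> s \<in> {1..m} \<Longrightarrow> H j s \<in> Lp_functions p M"
  shows "(\<Sum>i=1..n. \<Sum>r=1..m. Lp_integral p M (\<lambda>x. \<Sum>j=1..n. \<Sum>s=1..m. b i j r s * H j s x))
    \<le> C * (\<Sum>j=1..n. \<Sum>s=1..m. Lp_integral p M (H j s))"
proof -
  have B: "(\<lambda>x. \<Sum>j=1..n. \<Sum>s=1..m. b i j r s * H j s x) \<in> Lp_functions p M" for i r
    using H by (intro Lp_sum Lp_scale) auto
  have "(\<Sum>i=1..n. \<Sum>r=1..m. Lp_integral p M (\<lambda>x. \<Sum>j=1..n. \<Sum>s=1..m. b i j r s * H j s x))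
      = (LINT x|M. (\<Sum>i=1..n. \<Sum>r=1..m. cmod (\<Sum>j=1..n. \<Sum>s=1..m. b i j r s * H j s x) powr p))"
    unfolding Lp_integral_def using Lp_integrable[OF B] by (simp add: Bochner_Integration.integral_sum)
  also have "\<dots> \<le> (LINT x|M. C * (\<Sum>j=1..n. \<Sum>s=1..m. cmod (H j s x) powr p))"
  proof (intro integral_mono)
    show "integrable M (\<lambda>x. \<Sum>i=1..n. \<Sum>r=1..m. cmod (\<Sum>j=1..n. \<Sum>s=1..m. b i j r s * H j s x) powr p)"
      using Lp_integrable[OF B] by (intro Bochner_Integration.integrable_sum) auto
    show "integrable M (\<lambda>x. C * (\<Sum>j=1..n. \<Sum>s=1..m. cmod (H j s x) powr p))"
      using Lp_integrable[OF H] by (intro integrable_mult_right Bochner_Integration.integrable_sum) auto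
  next
    fix x
    show "(\<Sum>i=1..n. \<Sum>r=1..m. cmod (\<Sum>j=1..n. \<Sum>s=1..m. b i j r s * H j s x) powr p)
        \<le> C * (\<Sum>j=1..n. \<Sum>s=1..m. cmod (H j s x) powr p)"
      using bound[unfolded scalar_bound_def, rule_format, of "\<lambda>j s. H j s x"] .
  qed
  also have "\<dots> = C * (\<Sum>j=1..n. \<Sum>s=1..m. Lp_integral p M (H j s))"
  proof -
    have "(LINT x|M. (\<Sum>j=1..n. \<Sum>s=1..m. cmod (H j s x) powr p))
        = (\<Sum>j=1..n. LINT x|M. (\<Sum>s=1..m. cmod (H j s x) powr p))"
      by (intro Bochner_Integration.integral_sum Bochner_Integration.integrable_sum Lp_integrable H)
    also have "\<dots> = (\<Sum>j=1..n. \<Sum>s=1..m. Lp_integral p M (H j s))"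
      unfolding Lp_integral_def by (intro sum.cong refl Bochner_Integration.integral_sum Lp_integrable H)
    finally show ?thesis by (simp only: integral_mult_right_zero)
  qed
  finally show ?thesis .
qed

context contractive_block_representation
begin

text \<open>
  Columns \<open>F j = \<Sum>\<^sub>s c j s E\<^sub>s\<^sub>1 f\<close> turn the action of a matrix over the algebra into that of the
  scalar matrix formed by its \<open>k\<close>-th blocks, because \<open>E\<^sub>1\<^sub>1 f, E\<^sub>2\<^sub>1 f, \<dots>\<close> are disjoint and of equal norm.
\<close>

lemma scalar_bound_of_matrix_bound:
  assumes bound: "matrix_bound p M n (\<lambda>i j. R (b i j)) C"
    and k: "k \<in> {1..blocks}" and pos: "0 < sz k"
    and f: "f \<in> Lp_functions p M" and nz: "Lp_integral p M (E k 1 1 f) \<noteq> 0"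
  shows "scalar_bound p n (sz k) (\<lambda>i j. b i j k) C"
  unfolding scalar_bound_def
proof
  fix c :: "nat \<Rightarrow> nat \<Rightarrow> complex"
  let ?m = "sz k" and ?J = "Lp_integral p M (E k 1 1 f)"
  have J: "0 < ?J" using nz by (simp add: order.strict_iff_order)
  have Ef: "E k r 1 f \<in> Lp_functions p M" for r using f by (rule R_closed)
  have comb: "Lp_integral p M (\<lambda>x. \<Sum>r=1..?m. w r * E k r 1 f x) = (\<Sum>r=1..?m. cmod (w r) powr p) * ?J" for w
  proof -
    have "Lp_integral p M (\<lambda>x. \<Sum>r=1..?m. w r * E k r 1 f x) = (\<Sum>r=1..?m. Lp_integral p M (\<lambda>x. w r * E k r 1 f x))"
    proof (intro Lp_integral_disjoint_sum Lp_scale Ef finite_atLeastAtMost)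
      fix r s assume "r \<in> {1..?m}" "s \<in> {1..?m}" "r \<noteq> s"
      then have "AE x in M. E k r 1 f x = 0 \<or> E k s 1 f x = 0"
        using f by (intro E_disjoint) auto
      then show "AE x in M. w r * E k r 1 f x = 0 \<or> w s * E k s 1 f x = 0"
        by eventually_elim auto
    qed
    also have "\<dots> = (\<Sum>r=1..?m. cmod (w r) powr p * ?J)"
    proof (intro sum.cong refl)
      fix r assume "r \<in> {1..?m}"
      then have "Lp_integral p M (E k r 1 f) = ?J"
        using pos by (intro Lp_integral_E_row f) auto
      then show "Lp_integral p M (\<lambda>x. w r * E k r 1 f x) = cmod (w r) powr p * ?J"
        by (simp add: Lp_integral_scale)
    qed
    finally show ?thesis by (simp add: sum_distrib_right)
  qed
  define F where "F j = (\<lambda>x. \<Sum>s=1..?m. c j s * E k s 1 f x)" for j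
  have F: "F j \<in> Lp_functions p M" for j unfolding F_def by (intro Lp_sum Lp_scale Ef)
  have RF: "AE x in M. R (b i j) (F j) x = (\<Sum>r=1..?m. (\<Sum>s=1..?m. b i j k r s * c j s) * E k r 1 f x)" for i j
  proof -
    have "AE x in M. R (b i j) (F j) x = (\<Sum>s=1..?m. c j s * R (b i j) (E k s 1 f) x)"
      unfolding F_def by (intro R_of_sum Ef finite_atLeastAtMost)
    moreover have "AE x in M. \<forall>s\<in>{1..?m}. R (b i j) (E k s 1 f) x = (\<Sum>r=1..?m. b i j k r s * E k r 1 f x)"
      by (intro AE_finite_allI finite_atLeastAtMost R_E f)
    ultimately show ?thesis
    proof eventually_elim
      case (elim x)
      have "R (b i j) (F j) x = (\<Sum>s=1..?m. \<Sum>r=1..?m. b i j k r s * c j s * E k r 1 f x)"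
        unfolding elim(1) using elim(2) by (intro sum.cong) (auto simp: sum_distrib_left mult_ac)
      also have "\<dots> = (\<Sum>r=1..?m. (\<Sum>s=1..?m. b i j k r s * c j s) * E k r 1 f x)"
        by (subst sum.swap) (simp add: sum_distrib_right)
      finally show ?case .
    qed
  qed
  have G: "Lp_integral p M (\<lambda>x. \<Sum>j=1..n. R (b i j) (F j) x)
      = (\<Sum>r=1..?m. cmod (\<Sum>j=1..n. \<Sum>s=1..?m. b i j k r s * c j s) powr p) * ?J" for i
  proof -
    have "AE x in M. \<forall>j\<in>{1..n}. R (b i j) (F j) x = (\<Sum>r=1..?m. (\<Sum>s=1..?m. b i j k r s * c j s) * E k r 1 f x)"
      by (intro AE_finite_allI finite_atLeastAtMost RF)
    then have "AE x in M. (\<Sum>j=1..n. R (b i j) (F j) x)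
        = (\<Sum>r=1..?m. (\<Sum>j=1..n. \<Sum>s=1..?m. b i j k r s * c j s) * E k r 1 f x)"
    proof eventually_elim
      case (elim x)
      then have "(\<Sum>j=1..n. R (b i j) (F j) x)
          = (\<Sum>j=1..n. \<Sum>r=1..?m. (\<Sum>s=1..?m. b i j k r s * c j s) * E k r 1 f x)" by simp
      also have "\<dots> = (\<Sum>r=1..?m. (\<Sum>j=1..n. \<Sum>s=1..?m. b i j k r s * c j s) * E k r 1 f x)"
        by (subst sum.swap) (simp add: sum_distrib_right)
      finally show ?case .
    qed
    then have "Lp_integral p M (\<lambda>x. \<Sum>j=1..n. R (b i j) (F j) x)
        = Lp_integral p M (\<lambda>x. \<Sum>r=1..?m. (\<Sum>j=1..n. \<Sum>s=1..?m. b i j k r s * c j s) * E k r 1 f x)"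
      by (intro Lp_integral_cong_AE Lp_measurable[where p = p] Lp_sum Lp_scale Ef R_closed F)
    then show ?thesis by (simp only: comb)
  qed
  have IF: "Lp_integral p M (F j) = (\<Sum>s=1..?m. cmod (c j s) powr p) * ?J" for j
    unfolding F_def comb ..
  have "(\<Sum>i=1..n. Lp_integral p M (\<lambda>x. \<Sum>j=1..n. R (b i j) (F j) x)) \<le> C * (\<Sum>j=1..n. Lp_integral p M (F j))"
    using bound F unfolding matrix_bound_def by blast
  then have "(\<Sum>i=1..n. \<Sum>r=1..?m. cmod (\<Sum>j=1..n. \<Sum>s=1..?m. b i j k r s * c j s) powr p) * ?J
      \<le> (C * (\<Sum>j=1..n. \<Sum>s=1..?m. cmod (c j s) powr p)) * ?J"
    unfolding G IF by (simp add: sum_distrib_right mult.assoc)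
  then show "(\<Sum>i=1..n. \<Sum>r=1..?m. cmod (\<Sum>j=1..n. \<Sum>s=1..?m. b i j k r s * c j s) powr p)
      \<le> C * (\<Sum>j=1..n. \<Sum>s=1..?m. cmod (c j s) powr p)"
    using J by (simp only: mult_le_cancel_right_pos)
qed

text \<open>
  The image \<open>G\<close> of a column lies in the range of \<open>R one\<close>, so its norm is computed from the functions
  \<open>E k 1 r (G i)\<close>. These are the scalar combinations of the functions \<open>E k 1 s (F j)\<close> with coefficients
  \<open>b i j k r s\<close>, and the p-th powers of the norms of the latter add up to at most those of the \<open>F j\<close>.
\<close>

lemma matrix_bound_of_scalar_bounds:
  assumes pos: "\<And>k. k \<in> {1..blocks} \<Longrightarrow> 0 < sz k" and C: "0 \<le> C"
    and bound: "\<And>k. k \<in> {1..blocks} \<Longrightarrow>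
      scalar_bound p n (sz k) (\<lambda>i j. b i j k) C \<or> (\<forall>f\<in>Lp_functions p M. Lp_integral p M (E k 1 1 f) = 0)"
  shows "matrix_bound p M n (\<lambda>i j. R (b i j)) C"
  unfolding matrix_bound_def
proof (intro allI impI)
  fix F assume "\<forall>j\<in>{1..n}. F j \<in> Lp_functions p M"
  then have F: "F j \<in> Lp_functions p M" if "j \<in> {1..n}" for j using that by blast
  define G where "G i = (\<lambda>x. \<Sum>j=1..n. 1 * R (b i j) (F j) x)" for i
  have G: "G i \<in> Lp_functions p M" for i
    unfolding G_def using F by (intro Lp_sum Lp_scale R_closed) auto
  have one_G: "AE x in M. R one (G i) x = G i x" for i
  proof -
    have "AE x in M. R one (G i) x = (\<Sum>j=1..n. 1 * R one (R (b i j) (F j)) x)"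
      unfolding G_def using F by (intro R_of_sum R_closed finite_atLeastAtMost) auto
    moreover have "AE x in M. \<forall>j\<in>{1..n}. R one (R (b i j) (F j)) x = R (b i j) (F j) x"
      using F by (intro AE_finite_allI finite_atLeastAtMost R_one_R) auto
    ultimately show ?thesis by eventually_elim (simp add: G_def)
  qed
  define H where "H k j s = E k 1 s (F j)" for k j s
  have H: "H k j s \<in> Lp_functions p M" if "j \<in> {1..n}" for k j s
    unfolding H_def using F[OF that] by (rule R_closed)
  have EG: "Lp_integral p M (E k 1 r (G i)) = Lp_integral p M (\<lambda>x. \<Sum>j=1..n. \<Sum>s=1..sz k. b i j k r s * H k j s x)"
    if "r \<in> {1..sz k}" for k r i
  proof -
    have "AE x in M. E k 1 r (G i) x = (\<Sum>j=1..n. 1 * E k 1 r (R (b i j) (F j)) x)"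
      unfolding G_def using F by (intro R_of_sum R_closed finite_atLeastAtMost) auto
    moreover have "AE x in M. \<forall>j\<in>{1..n}. E k 1 r (R (b i j) (F j)) x = (\<Sum>s=1..sz k. b i j k r s * H k j s x)"
      unfolding H_def using F that by (intro AE_finite_allI finite_atLeastAtMost E_R) auto
    ultimately have "AE x in M. E k 1 r (G i) x = (\<Sum>j=1..n. \<Sum>s=1..sz k. b i j k r s * H k j s x)"
      by eventually_elim simp
    then show ?thesis
      by (intro Lp_integral_cong_AE Lp_measurable[where p = p] Lp_sum Lp_scale R_closed G H)
  qed
  have block: "(\<Sum>i=1..n. \<Sum>r=1..sz k. Lp_integral p M (E k 1 r (G i)))
      \<le> C * (\<Sum>j=1..n. \<Sum>s=1..sz k. Lp_integral p M (H k j s))" if k: "k \<in> {1..blocks}" for k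
    using bound[OF k]
  proof
    assume sb: "scalar_bound p n (sz k) (\<lambda>i j. b i j k) C"
    have "(\<Sum>i=1..n. \<Sum>r=1..sz k. Lp_integral p M (E k 1 r (G i)))
        = (\<Sum>i=1..n. \<Sum>r=1..sz k. Lp_integral p M (\<lambda>x. \<Sum>j=1..n. \<Sum>s=1..sz k. b i j k r s * H k j s x))"
      by (intro sum.cong refl EG)
    also have "\<dots> \<le> C * (\<Sum>j=1..n. \<Sum>s=1..sz k. Lp_integral p M (H k j s))"
      by (intro scalar_bound_Lp[OF sb] H)
    finally show ?thesis .
  next
    assume zero: "\<forall>f\<in>Lp_functions p M. Lp_integral p M (E k 1 1 f) = 0"
    have "Lp_integral p M (E k 1 r (G i)) = 0" for r i
    proof -
      have "Lp_integral p M (E k 1 r (G i)) = Lp_integral p M (E k 1 1 (E k 1 r (G i)))"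
        using pos[OF k] G
        by (intro Lp_integral_cong_AE R_measurable R_closed eventually_mono[OF E_E[OF G[of i], of 1 k 1 r]]) simp_all
      then show ?thesis using zero R_closed[OF G] by simp
    qed
    then show ?thesis using C by (simp add: sum_nonneg)
  qed
  have "(\<Sum>i=1..n. Lp_integral p M (\<lambda>x. \<Sum>j=1..n. R (b i j) (F j) x)) = (\<Sum>i=1..n. Lp_integral p M (R one (G i)))"
  proof (rule sum.cong[OF refl])
    fix i
    have "Lp_integral p M (R one (G i)) = Lp_integral p M (G i)"
      by (intro Lp_integral_cong_AE Lp_measurable[where p = p] R_closed G one_G)
    then show "Lp_integral p M (\<lambda>x. \<Sum>j=1..n. R (b i j) (F j) x) = Lp_integral p M (R one (G i))"
      by (simp add: G_def)
  qed
  also have "\<dots> = (\<Sum>i=1..n. \<Sum>k=1..blocks. \<Sum>r=1..sz k. Lp_integral p M (E k 1 r (G i)))"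
    by (intro sum.cong refl Lp_integral_R_one G pos)
  also have "\<dots> = (\<Sum>k=1..blocks. \<Sum>i=1..n. \<Sum>r=1..sz k. Lp_integral p M (E k 1 r (G i)))"
    by (rule sum.swap)
  also have "\<dots> \<le> (\<Sum>k=1..blocks. C * (\<Sum>j=1..n. \<Sum>s=1..sz k. Lp_integral p M (H k j s)))"
    by (intro sum_mono block)
  also have "\<dots> = C * (\<Sum>j=1..n. \<Sum>k=1..blocks. \<Sum>s=1..sz k. Lp_integral p M (H k j s))"
    by (subst sum.swap) (simp add: sum_distrib_left)
  also have "\<dots> = C * (\<Sum>j=1..n. Lp_integral p M (R one (F j)))"
    unfolding H_def using F pos by (intro arg_cong[where f = "(*) C"] sum.cong refl Lp_integral_R_one[symmetric]) auto
  also have "\<dots> \<le> C * (\<Sum>j=1..n. Lp_integral p M (F j))"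
    using F C p_ge1 by (intro mult_left_mono sum_mono R_contractive block_contraction_diagonal) auto
  finally show "(\<Sum>i=1..n. Lp_integral p M (\<lambda>x. \<Sum>j=1..n. R (b i j) (F j) x)) \<le> C * (\<Sum>j=1..n. Lp_integral p M (F j))" .
qed

end

text \<open>
  The norm of a matrix over the algebra is the largest norm of the scalar matrices formed by those of
  its blocks on which the representation does not vanish.
\<close>

lemma matrix_bound_transfer:
  assumes R: "contractive_block_representation p M blocks sz R"
    and Q: "contractive_block_representation p N blocks sz Q"
    and pos: "\<And>k. k \<in> {1..blocks} \<Longrightarrow> 0 < sz k" and C: "0 \<le> C"
    and kernels: "\<And>k. k \<in> {1..blocks} \<Longrightarrow>
      (\<forall>f\<in>Lp_functions p M. Lp_integral p M (R (matrix_unit k 1 1) f) = 0) \<Longrightarrow>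
      (\<forall>f\<in>Lp_functions p N. Lp_integral p N (Q (matrix_unit k 1 1) f) = 0)"
    and bound: "matrix_bound p M n (\<lambda>i j. R (b i j)) C"
  shows "matrix_bound p N n (\<lambda>i j. Q (b i j)) C"
proof (rule contractive_block_representation.matrix_bound_of_scalar_bounds[OF Q pos C])
  fix k assume k: "k \<in> {1..blocks}"
  show "scalar_bound p n (sz k) (\<lambda>i j. b i j k) C
      \<or> (\<forall>f\<in>Lp_functions p N. Lp_integral p N (Q (matrix_unit k 1 1) f) = 0)"
    using contractive_block_representation.scalar_bound_of_matrix_bound[OF R bound k pos[OF k]] kernels[OF k]
    by blast
qed

(* Keeps index sets in the form {1..n} under simplification. *)
declare One_nat_def [simp del]

section \<open>Operators on classes of functions and the norms of matrices\<close>

lemma mem_Lp_class: "g \<in> Lp_class p M f \<longleftrightarrow> g \<in> Lp_functions p M \<and> (AE x in M. g x = f x)"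
  by (simp add: Lp_class_def)

lemma Lp_class_self: "f \<in> Lp_functions p M \<Longrightarrow> f \<in> Lp_class p M f"
  by (simp add: mem_Lp_class)

lemma Lp_class_cong_AE:
  assumes "AE x in M. f x = g x"
  shows "Lp_class p M f = Lp_class p M g"
proof -
  have "(AE x in M. h x = f x) \<longleftrightarrow> (AE x in M. h x = g x)" for h
    using assms by (auto elim: eventually_elim2)
  then show ?thesis by (simp add: Lp_class_def)
qed

lemma Lp_class_eq_iff:
  assumes "f \<in> Lp_functions p M"
  shows "Lp_class p M f = Lp_class p M g \<longleftrightarrow> (AE x in M. f x = g x)"
proof
  assume "Lp_class p M f = Lp_class p M g"
  then have "f \<in> Lp_class p M g" using Lp_class_self[OF assms] by simp
  then show "AE x in M. f x = g x" by (simp add: mem_Lp_class)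
qed (rule Lp_class_cong_AE)

lemma carrier_Lp: "carrier_of (Lp p M) = Lp_class p M ` Lp_functions p M"
  by (simp add: Lp_def)

lemma Lp_class_in_carrier: "f \<in> Lp_functions p M \<Longrightarrow> Lp_class p M f \<in> carrier_of (Lp p M)"
  by (simp add: carrier_Lp)

lemma scale_Lp_class:
  assumes "f \<in> Lp_functions p M"
  shows "scale_of (Lp p M) c (Lp_class p M f) = Lp_class p M (\<lambda>x. c * f x)"
proof -
  have "Lp_class p M (\<lambda>x. c * f' x) = Lp_class p M (\<lambda>x. c * f x)" if "f' \<in> Lp_class p M f" for f'
    using that by (intro Lp_class_cong_AE) (auto simp: mem_Lp_class elim: eventually_mono)
  then have "scale_of (Lp p M) c (Lp_class p M f) = (\<Union>f'\<in>Lp_class p M f. Lp_class p M (\<lambda>x. c * f x))"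
    by (simp add: Lp_def)
  also have "\<dots> = Lp_class p M (\<lambda>x. c * f x)"
    using Lp_class_self[OF assms] by blast
  finally show ?thesis .
qed

lemma add_Lp_class:
  assumes "f \<in> Lp_functions p M" "g \<in> Lp_functions p M"
  shows "add_of (Lp p M) (Lp_class p M f) (Lp_class p M g) = Lp_class p M (\<lambda>x. f x + g x)"
proof -
  have "Lp_class p M (\<lambda>x. f' x + g' x) = Lp_class p M (\<lambda>x. f x + g x)"
    if "f' \<in> Lp_class p M f" "g' \<in> Lp_class p M g" for f' g'
    using that by (intro Lp_class_cong_AE) (auto simp: mem_Lp_class elim: eventually_elim2)
  then have "add_of (Lp p M) (Lp_class p M f) (Lp_class p M g)
      = (\<Union>f'\<in>Lp_class p M f. \<Union>g'\<in>Lp_class p M g. Lp_class p M (\<lambda>x. f x + g x))"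
    by (simp add: Lp_def)
  also have "\<dots> = Lp_class p M (\<lambda>x. f x + g x)"
    using Lp_class_self[OF assms(1)] Lp_class_self[OF assms(2)] by blast
  finally show ?thesis .
qed

lemma norm_Lp_class:
  assumes "f \<in> Lp_functions p M"
  shows "norm_of (Lp p M) (Lp_class p M f) = Lp_norm p M f"
proof -
  let ?g = "SOME g. g \<in> Lp_class p M f"
  have "?g \<in> Lp_class p M f" using Lp_class_self[OF assms] by (auto simp: some_in_eq)
  then have "Lp_integral p M ?g = Lp_integral p M f"
    using assms by (intro Lp_integral_cong_AE) (auto simp: mem_Lp_class Lp_measurable)
  then show ?thesis by (simp add: Lp_def Lp_norm_def Lp_integral_def)
qed

abbreviation Lp_operators :: "real \<Rightarrow> 'x measure \<Rightarrow> (('x \<Rightarrow> complex) set \<Rightarrow> ('x \<Rightarrow> complex) set) nalg" where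
  "Lp_operators p M \<equiv> bounded_operators (Lp p M)"

definition act :: "real \<Rightarrow> 'x measure \<Rightarrow> (('x \<Rightarrow> complex) set \<Rightarrow> ('x \<Rightarrow> complex) set) \<Rightarrow> ('x \<Rightarrow> complex) \<Rightarrow> 'x \<Rightarrow> complex" where
  "act p M T f = (SOME g. g \<in> T (Lp_class p M f))"

lemma act_cong_AE: "AE x in M. f x = g x \<Longrightarrow> act p M T f = act p M T g"
  by (simp add: act_def Lp_class_cong_AE[where M = M and f = f and g = g])

definition represents ::
    "real \<Rightarrow> 'x measure \<Rightarrow> (('x \<Rightarrow> complex) set \<Rightarrow> ('x \<Rightarrow> complex) set) \<Rightarrow> (('x \<Rightarrow> complex) \<Rightarrow> 'x \<Rightarrow> complex) \<Rightarrow> bool" where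
  "represents p M T t \<longleftrightarrow> (\<forall>f\<in>Lp_functions p M. t f \<in> Lp_functions p M \<and> T (Lp_class p M f) = Lp_class p M (t f))"

context lp_exponent
begin

lemma represents_act:
  assumes "T \<in> carrier_of (Lp_operators p M)"
  shows "represents p M T (act p M T)"
  unfolding represents_def
proof
  fix f assume f: "f \<in> Lp_functions p M"
  have "T \<in> carrier_of (Lp p M) \<rightarrow>\<^sub>E carrier_of (Lp p M)" using assms by (simp add: bounded_operators_def)
  then have "T (Lp_class p M f) \<in> carrier_of (Lp p M)" using Lp_class_in_carrier[OF f] by auto
  then obtain h where h: "h \<in> Lp_functions p M" "T (Lp_class p M f) = Lp_class p M h" by (auto simp: carrier_Lp)
  have "act p M T f \<in> Lp_class p M h"
    unfolding act_def h(2) using Lp_class_self[OF h(1)] by (auto simp: some_in_eq)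
  then show "act p M T f \<in> Lp_functions p M \<and> T (Lp_class p M f) = Lp_class p M (act p M T f)"
    unfolding h(2) using Lp_class_cong_AE[where M = M and f = "act p M T f" and g = h and p = p] by (auto simp: mem_Lp_class)
qed

lemma act_closed: "T \<in> carrier_of (Lp_operators p M) \<Longrightarrow> f \<in> Lp_functions p M \<Longrightarrow> act p M T f \<in> Lp_functions p M"
  using represents_act by (auto simp: represents_def)

lemma apply_Lp_class:
  "T \<in> carrier_of (Lp_operators p M) \<Longrightarrow> f \<in> Lp_functions p M \<Longrightarrow> T (Lp_class p M f) = Lp_class p M (act p M T f)"
  using represents_act by (auto simp: represents_def)

lemma act_linear:
  assumes T: "T \<in> carrier_of (Lp_operators p M)" and f: "f \<in> Lp_functions p M" and g: "g \<in> Lp_functions p M"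
  shows "AE x in M. act p M T (\<lambda>x. f x + c * g x) x = act p M T f x + c * act p M T g x"
proof -
  have cg: "(\<lambda>x. c * g x) \<in> Lp_functions p M" using g by auto
  have fg: "(\<lambda>x. f x + c * g x) \<in> Lp_functions p M" using f cg by (rule Lp_add)
  have add: "T (add_of (Lp p M) X Y) = add_of (Lp p M) (T X) (T Y)"
    and scl: "T (scale_of (Lp p M) c X) = scale_of (Lp p M) c (T X)"
    if "X \<in> carrier_of (Lp p M)" "Y \<in> carrier_of (Lp p M)" for X Y
    using T that by (simp_all add: bounded_operators_def)
  have "Lp_class p M (act p M T (\<lambda>x. f x + c * g x)) = T (Lp_class p M (\<lambda>x. f x + c * g x))"
    using apply_Lp_class[OF T fg] by simp
  also have "\<dots> = T (add_of (Lp p M) (Lp_class p M f) (scale_of (Lp p M) c (Lp_class p M g)))"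
    by (simp add: scale_Lp_class[OF g] add_Lp_class[OF f cg])
  also have "\<dots> = add_of (Lp p M) (T (Lp_class p M f)) (scale_of (Lp p M) c (T (Lp_class p M g)))"
    using Lp_class_in_carrier[OF f] Lp_class_in_carrier[OF g] Lp_class_in_carrier[OF cg]
    by (simp add: scl add scale_Lp_class[OF g, symmetric])
  also have "\<dots> = Lp_class p M (\<lambda>x. act p M T f x + c * act p M T g x)"
    using act_closed[OF T f] act_closed[OF T g]
    by (simp add: apply_Lp_class[OF T f] apply_Lp_class[OF T g] scale_Lp_class add_Lp_class Lp_scale)
  finally show ?thesis using act_closed[OF T fg] by (simp add: Lp_class_eq_iff)
qed

lemma act_scale:
  assumes T: "T \<in> carrier_of (Lp_operators p M)" and f: "f \<in> Lp_functions p M"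
  shows "AE x in M. act p M T (\<lambda>x. c * f x) x = c * act p M T f x"
  using act_linear[OF T f f, of "c - 1"] by (simp add: algebra_simps)

lemma act_eqI:
  assumes "f \<in> Lp_functions p M" "g \<in> Lp_functions p M" "T (Lp_class p M f) = Lp_class p M g"
  shows "AE x in M. act p M T f x = g x"
proof -
  have "act p M T f \<in> Lp_class p M g"
    unfolding act_def assms(3) using Lp_class_self[OF assms(2)] by (auto simp: some_in_eq)
  then show ?thesis by (simp add: mem_Lp_class)
qed

lemma act_add:
  assumes S: "S \<in> carrier_of (Lp_operators p M)" and T: "T \<in> carrier_of (Lp_operators p M)"
    and f: "f \<in> Lp_functions p M"
  shows "AE x in M. act p M (add_of (Lp_operators p M) S T) f x = act p M S f x + act p M T f x"
proof (rule act_eqI[OF f])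
  show "(\<lambda>x. act p M S f x + act p M T f x) \<in> Lp_functions p M"
    using act_closed[OF S f] act_closed[OF T f] by auto
  show "add_of (Lp_operators p M) S T (Lp_class p M f) = Lp_class p M (\<lambda>x. act p M S f x + act p M T f x)"
    using Lp_class_in_carrier[OF f] act_closed[OF S f] act_closed[OF T f]
    by (simp add: bounded_operators_def apply_Lp_class[OF S f] apply_Lp_class[OF T f] add_Lp_class)
qed

lemma act_scale_op:
  assumes T: "T \<in> carrier_of (Lp_operators p M)" and f: "f \<in> Lp_functions p M"
  shows "AE x in M. act p M (scale_of (Lp_operators p M) c T) f x = c * act p M T f x"
proof (rule act_eqI[OF f])
  show "(\<lambda>x. c * act p M T f x) \<in> Lp_functions p M"
    using act_closed[OF T f] by auto
  show "scale_of (Lp_operators p M) c T (Lp_class p M f) = Lp_class p M (\<lambda>x. c * act p M T f x)"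
    using Lp_class_in_carrier[OF f] act_closed[OF T f]
    by (simp add: bounded_operators_def apply_Lp_class[OF T f] scale_Lp_class)
qed

lemma act_mult:
  assumes S: "S \<in> carrier_of (Lp_operators p M)" and T: "T \<in> carrier_of (Lp_operators p M)"
    and f: "f \<in> Lp_functions p M"
  shows "AE x in M. act p M (mult_of (Lp_operators p M) S T) f x = act p M S (act p M T f) x"
proof (rule act_eqI[OF f])
  show "act p M S (act p M T f) \<in> Lp_functions p M"
    using act_closed[OF S act_closed[OF T f]] .
  show "mult_of (Lp_operators p M) S T (Lp_class p M f) = Lp_class p M (act p M S (act p M T f))"
    using Lp_class_in_carrier[OF f]
    by (simp add: bounded_operators_def apply_Lp_class[OF T f] apply_Lp_class[OF S act_closed[OF T f]])
qed

text \<open>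
  Stated for a map \<open>t\<close> on functions that represents \<open>T\<close>, so that it applies both to \<open>act\<close> and to the
  action of a matrix on columns of functions.
\<close>

lemma opnorm:
  assumes rep: "represents p M T t"
    and hom: "\<And>f c. f \<in> Lp_functions p M \<Longrightarrow> Lp_norm p M (t (\<lambda>x. c * f x)) = cmod c * Lp_norm p M (t f)"
    and bounded: "\<And>f. f \<in> Lp_functions p M \<Longrightarrow> Lp_norm p M (t f) \<le> K * Lp_norm p M f"
  shows opnorm_nonneg: "0 \<le> norm_of (Lp_operators p M) T"
    and opnorm_le_iff: "0 \<le> C \<Longrightarrow> norm_of (Lp_operators p M) T \<le> C
      \<longleftrightarrow> (\<forall>f\<in>Lp_functions p M. Lp_norm p M (t f) \<le> C * Lp_norm p M f)"
proof -
  let ?B = "{X \<in> carrier_of (Lp p M). norm_of (Lp p M) X \<le> 1}"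
  have norm: "norm_of (Lp_operators p M) T = (SUP X\<in>?B. norm_of (Lp p M) (T X))"
    by (simp add: bounded_operators_def)
  have B: "?B = Lp_class p M ` {f \<in> Lp_functions p M. Lp_norm p M f \<le> 1}"
    by (auto simp: carrier_Lp norm_Lp_class)
  have T: "norm_of (Lp p M) (T (Lp_class p M f)) = Lp_norm p M (t f)" if "f \<in> Lp_functions p M" for f
    using rep that by (auto simp: represents_def norm_Lp_class)
  have bdd: "bdd_above ((\<lambda>X. norm_of (Lp p M) (T X)) ` ?B)"
  proof (rule bdd_aboveI)
    fix r assume "r \<in> (\<lambda>X. norm_of (Lp p M) (T X)) ` ?B"
    then obtain f where f: "f \<in> Lp_functions p M" "Lp_norm p M f \<le> 1" "r = Lp_norm p M (t f)"
      unfolding B using T by auto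
    have "r \<le> K * Lp_norm p M f" using bounded[OF f(1)] f(3) by simp
    also have "\<dots> \<le> \<bar>K\<bar> * 1" using f(2) by (intro mult_mono) auto
    finally show "r \<le> \<bar>K\<bar>" by simp
  qed
  have upper: "Lp_norm p M (t f) \<le> norm_of (Lp_operators p M) T" if "f \<in> Lp_functions p M" "Lp_norm p M f \<le> 1" for f
  proof -
    have "Lp_class p M f \<in> ?B" using that unfolding B by auto
    from cSUP_upper[OF this bdd] show ?thesis unfolding norm T[OF that(1)] .
  qed
  show nonneg: "0 \<le> norm_of (Lp_operators p M) T"
    by (rule order_trans[OF Lp_norm_nonneg upper[of "\<lambda>_. 0"]]) simp_all
  show "norm_of (Lp_operators p M) T \<le> C \<longleftrightarrow> (\<forall>f\<in>Lp_functions p M. Lp_norm p M (t f) \<le> C * Lp_norm p M f)"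
    if C: "0 \<le> C"
  proof
    assume le: "norm_of (Lp_operators p M) T \<le> C"
    show "\<forall>f\<in>Lp_functions p M. Lp_norm p M (t f) \<le> C * Lp_norm p M f"
    proof
      fix f assume f: "f \<in> Lp_functions p M"
      let ?r = "Lp_norm p M f"
      show "Lp_norm p M (t f) \<le> C * ?r"
      proof (cases "?r = 0")
        case True
        then show ?thesis using bounded[OF f] by simp
      next
        case False
        then have r: "0 < ?r" by (simp add: order.strict_iff_order)
        let ?g = "\<lambda>x. complex_of_real (1 / ?r) * f x"
        have "Lp_norm p M ?g = 1" using r by (simp only: Lp_norm_scale norm_of_real) simp
        then have "Lp_norm p M (t ?g) \<le> C" using upper[of ?g] f le Lp_scale[OF f] by fastforce
        moreover have "Lp_norm p M (t ?g) = (1 / ?r) * Lp_norm p M (t f)"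
          using r by (simp only: hom[OF f] norm_of_real) simp
        then have "Lp_norm p M (t f) = ?r * Lp_norm p M (t ?g)" using r by simp
        moreover have "?r * Lp_norm p M (t ?g) \<le> ?r * C"
          using calculation(1) r by (intro mult_left_mono) auto
        ultimately show ?thesis by (simp add: mult.commute)
      qed
    qed
  next
    assume le: "\<forall>f\<in>Lp_functions p M. Lp_norm p M (t f) \<le> C * Lp_norm p M f"
    have "(\<lambda>_. 0) \<in> {f \<in> Lp_functions p M. Lp_norm p M f \<le> 1}" by simp
    then have "?B \<noteq> {}" unfolding B by blast
    then show "norm_of (Lp_operators p M) T \<le> C"
      unfolding norm
    proof (rule cSUP_least)
      fix X assume "X \<in> ?B"
      then obtain f where f: "f \<in> Lp_functions p M" "Lp_norm p M f \<le> 1" "X = Lp_class p M f" unfolding B by auto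
      have "Lp_norm p M (t f) \<le> C * Lp_norm p M f" using le f(1) by auto
      also have "\<dots> \<le> C * 1" using f(2) C by (intro mult_left_mono)
      finally show "norm_of (Lp p M) (T X) \<le> C" using T[OF f(1)] f(3) by simp
    qed
  qed
qed

lemma act_bounded:
  assumes T: "T \<in> carrier_of (Lp_operators p M)"
  shows "\<exists>K. \<forall>f\<in>Lp_functions p M. Lp_norm p M (act p M T f) \<le> K * Lp_norm p M f"
proof -
  obtain K where "\<forall>X\<in>carrier_of (Lp p M). norm_of (Lp p M) (T X) \<le> K * norm_of (Lp p M) X"
    using T by (auto simp: bounded_operators_def)
  then have "Lp_norm p M (act p M T f) \<le> K * Lp_norm p M f" if "f \<in> Lp_functions p M" for f
    using Lp_class_in_carrier[OF that] act_closed[OF T that]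
    by (metis norm_Lp_class apply_Lp_class T that)
  then show ?thesis by blast
qed

lemma Lp_norm_cong_AE:
  assumes "f \<in> Lp_functions p M" "g \<in> Lp_functions p M" "AE x in M. f x = g x"
  shows "Lp_norm p M f = Lp_norm p M g"
  using Lp_integral_cong_AE[OF Lp_measurable[OF assms(1)] Lp_measurable[OF assms(2)] assms(3)]
  by (simp add: Lp_norm_def)

lemma act_norm_scale:
  assumes T: "T \<in> carrier_of (Lp_operators p M)" and f: "f \<in> Lp_functions p M"
  shows "Lp_norm p M (act p M T (\<lambda>x. c * f x)) = cmod c * Lp_norm p M (act p M T f)"
proof -
  have "Lp_norm p M (act p M T (\<lambda>x. c * f x)) = Lp_norm p M (\<lambda>x. c * act p M T f x)"
    by (intro Lp_norm_cong_AE act_closed[OF T] Lp_scale f act_scale[OF T f])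
  then show ?thesis by (simp add: Lp_norm_scale)
qed

lemma norm_operator_nonneg:
  assumes T: "T \<in> carrier_of (Lp_operators p M)"
  shows "0 \<le> norm_of (Lp_operators p M) T"
proof -
  obtain K where "\<forall>f\<in>Lp_functions p M. Lp_norm p M (act p M T f) \<le> K * Lp_norm p M f"
    using act_bounded[OF T] by blast
  from opnorm_nonneg[OF represents_act[OF T] act_norm_scale[OF T] this[rule_format]] show ?thesis .
qed

lemma norm_operator_le_iff:
  assumes T: "T \<in> carrier_of (Lp_operators p M)" and "0 \<le> C"
  shows "norm_of (Lp_operators p M) T \<le> C \<longleftrightarrow> (\<forall>f\<in>Lp_functions p M. Lp_norm p M (act p M T f) \<le> C * Lp_norm p M f)"
proof -
  obtain K where "\<forall>f\<in>Lp_functions p M. Lp_norm p M (act p M T f) \<le> K * Lp_norm p M f"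
    using act_bounded[OF T] by blast
  from opnorm_le_iff[OF represents_act[OF T] act_norm_scale[OF T] this[rule_format] assms(2)] show ?thesis .
qed

lemma Lp_norm_act_le:
  assumes "T \<in> carrier_of (Lp_operators p M)" "f \<in> Lp_functions p M"
  shows "Lp_norm p M (act p M T f) \<le> norm_of (Lp_operators p M) T * Lp_norm p M f"
  using norm_operator_le_iff[OF assms(1) norm_operator_nonneg[OF assms(1)]] assms(2) by auto

end

section \<open>Amplification\<close>

locale amplification = lp_exponent + sigma_finite_measure M for M :: "'x measure" +
  fixes n :: nat
begin

abbreviation amp :: "(nat \<times> 'x) measure" where
  "amp \<equiv> amplified_measure n M"

lemma slice_measurable:
  assumes "f \<in> borel_measurable amp" "i \<in> {1..n}"
  shows "(\<lambda>x. f (i, x)) \<in> borel_measurable M"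
proof -
  have "Pair i \<in> M \<rightarrow>\<^sub>M amp" using assms(2) by (intro measurable_Pair1') simp
  from measurable_compose[OF this assms(1)] show ?thesis .
qed

lemma nn_integral_amp:
  assumes "f \<in> borel_measurable amp"
  shows "(\<integral>\<^sup>+ z. f z \<partial>amp) = (\<Sum>i=1..n. \<integral>\<^sup>+ x. f (i, x) \<partial>M)"
  using nn_integral_fst[OF assms] by (simp add: nn_integral_count_space_finite)

lemma Lp_amp_iff: "f \<in> Lp_functions p amp \<longleftrightarrow> (\<forall>i\<in>{1..n}. (\<lambda>x. f (i, x)) \<in> Lp_functions p M)"
proof -
  have "f \<in> borel_measurable amp \<longleftrightarrow> (\<forall>i\<in>{1..n}. (\<lambda>x. f (i, x)) \<in> borel_measurable M)"
  proof (intro iffI ballI)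
    show "(\<lambda>x. f (i, x)) \<in> borel_measurable M" if "f \<in> borel_measurable amp" "i \<in> {1..n}" for i
      using that by (rule slice_measurable)
    show "f \<in> borel_measurable amp" if "\<forall>i\<in>{1..n}. (\<lambda>x. f (i, x)) \<in> borel_measurable M"
      by (rule measurable_pair_measure_countable1) (use that in simp_all)
  qed
  moreover have "integrable amp (\<lambda>z. cmod (f z) powr p) \<longleftrightarrow> (\<forall>i\<in>{1..n}. integrable M (\<lambda>x. cmod (f (i, x)) powr p))"
    if f: "f \<in> borel_measurable amp"
  proof -
    have "(\<integral>\<^sup>+ z. ennreal (norm (cmod (f z) powr p)) \<partial>amp) = (\<Sum>i=1..n. \<integral>\<^sup>+ x. ennreal (norm (cmod (f (i, x)) powr p)) \<partial>M)"
      using f by (intro nn_integral_amp) auto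
    then show ?thesis
      using f slice_measurable[OF f] by (auto simp: integrable_iff_bounded ennreal_sum_less_top)
  qed
  ultimately show ?thesis by (auto simp: Lp_functions_def)
qed

lemma Lp_integral_amp:
  assumes "f \<in> Lp_functions p amp"
  shows "Lp_integral p amp f = (\<Sum>i=1..n. Lp_integral p M (\<lambda>x. f (i, x)))"
proof -
  have fi: "(\<lambda>x. f (i, x)) \<in> Lp_functions p M" if "i \<in> {1..n}" for i using assms that by (simp add: Lp_amp_iff)
  have "ennreal (Lp_integral p amp f) = (\<integral>\<^sup>+ z. ennreal (cmod (f z) powr p) \<partial>amp)"
    unfolding Lp_integral_def using Lp_integrable[OF assms] by (intro nn_integral_eq_integral[symmetric]) auto
  also have "\<dots> = (\<Sum>i=1..n. \<integral>\<^sup>+ x. ennreal (cmod (f (i, x)) powr p) \<partial>M)"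
    using Lp_measurable[OF assms] by (intro nn_integral_amp) auto
  also have "\<dots> = (\<Sum>i=1..n. ennreal (Lp_integral p M (\<lambda>x. f (i, x))))"
    unfolding Lp_integral_def using Lp_integrable[OF fi] by (intro sum.cong refl nn_integral_eq_integral) auto
  also have "\<dots> = ennreal (\<Sum>i=1..n. Lp_integral p M (\<lambda>x. f (i, x)))"
    by (rule sum_ennreal) simp
  finally show ?thesis by (simp add: sum_nonneg)
qed

text \<open>
  Both sides say that the p-th power of the norm of \<open>f - g\<close> vanishes, and this number is the sum over
  the slices.
\<close>

lemma AE_amp_iff:
  assumes "f \<in> Lp_functions p amp" "g \<in> Lp_functions p amp"
  shows "(AE z in amp. f z = g z) \<longleftrightarrow> (\<forall>i\<in>{1..n}. AE x in M. f (i, x) = g (i, x))"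
proof -
  have d: "(\<lambda>z. f z - g z) \<in> Lp_functions p amp" using assms by auto
  then have di: "(\<lambda>x. f (i, x) - g (i, x)) \<in> Lp_functions p M" if "i \<in> {1..n}" for i
    using that unfolding Lp_amp_iff by auto
  have "(AE z in amp. f z = g z) \<longleftrightarrow> Lp_integral p amp (\<lambda>z. f z - g z) = 0"
    using Lp_integral_eq_zero[OF d] by simp
  also have "\<dots> \<longleftrightarrow> (\<forall>i\<in>{1..n}. Lp_integral p M (\<lambda>x. f (i, x) - g (i, x)) = 0)"
    unfolding Lp_integral_amp[OF d] by (intro sum_nonneg_eq_0_iff) auto
  also have "\<dots> \<longleftrightarrow> (\<forall>i\<in>{1..n}. AE x in M. f (i, x) = g (i, x))"
    using Lp_integral_eq_zero[OF di] by simp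
  finally show ?thesis .
qed

definition column :: "(nat \<Rightarrow> 'x \<Rightarrow> complex) \<Rightarrow> nat \<times> 'x \<Rightarrow> complex" where
  "column F z = F (fst z) (snd z)"

lemma column_pair [simp]: "column F (i, x) = F i x"
  by (simp add: column_def)

lemma column_closed: "(\<And>i. i \<in> {1..n} \<Longrightarrow> F i \<in> Lp_functions p M) \<Longrightarrow> column F \<in> Lp_functions p amp"
  by (simp add: Lp_amp_iff)

lemma Lp_integral_column:
  "(\<And>i. i \<in> {1..n} \<Longrightarrow> F i \<in> Lp_functions p M) \<Longrightarrow> Lp_integral p amp (column F) = (\<Sum>i=1..n. Lp_integral p M (F i))"
  using Lp_integral_amp[OF column_closed[of F]] by simp

definition row_action :: "(nat \<Rightarrow> nat \<Rightarrow> ('x \<Rightarrow> complex) \<Rightarrow> 'x \<Rightarrow> complex) \<Rightarrow> (nat \<times> 'x \<Rightarrow> complex) \<Rightarrow> nat \<times> 'x \<Rightarrow> complex" where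
  "row_action t f = column (\<lambda>i x. \<Sum>j=1..n. t i j (\<lambda>x. f (j, x)) x)"

lemma row_action_closed:
  assumes "\<And>i j f. i \<in> {1..n} \<Longrightarrow> j \<in> {1..n} \<Longrightarrow> f \<in> Lp_functions p M \<Longrightarrow> t i j f \<in> Lp_functions p M"
    and "f \<in> Lp_functions p amp"
  shows "row_action t f \<in> Lp_functions p amp"
  unfolding row_action_def using assms by (intro column_closed Lp_sum) (auto simp: Lp_amp_iff)

lemma matrix_bound_iff:
  assumes t: "\<And>i j f. i \<in> {1..n} \<Longrightarrow> j \<in> {1..n} \<Longrightarrow> f \<in> Lp_functions p M \<Longrightarrow> t i j f \<in> Lp_functions p M"
    and C: "0 \<le> C"
  shows "matrix_bound p M n t (C powr p) \<longleftrightarrow>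
    (\<forall>f\<in>Lp_functions p amp. Lp_norm p amp (row_action t f) \<le> C * Lp_norm p amp f)"
proof -
  have norm: "Lp_norm p amp (row_action t f) \<le> C * Lp_norm p amp f \<longleftrightarrow>
      (\<Sum>i=1..n. Lp_integral p M (\<lambda>x. \<Sum>j=1..n. t i j (\<lambda>x. f (j, x)) x))
        \<le> C powr p * (\<Sum>j=1..n. Lp_integral p M (\<lambda>x. f (j, x)))"
    if f: "f \<in> Lp_functions p amp" for f
  proof -
    have "Lp_integral p amp (row_action t f) = (\<Sum>i=1..n. Lp_integral p M (\<lambda>x. \<Sum>j=1..n. t i j (\<lambda>x. f (j, x)) x))"
      unfolding row_action_def using t f by (intro Lp_integral_column Lp_sum) (auto simp: Lp_amp_iff)
    then show ?thesis
      using C Lp_integral_amp[OF f] by (simp add: Lp_norm_le_iff powr_mult Lp_norm_powr)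
  qed
  show ?thesis
  proof
    assume "matrix_bound p M n t (C powr p)"
    then show "\<forall>f\<in>Lp_functions p amp. Lp_norm p amp (row_action t f) \<le> C * Lp_norm p amp f"
      using norm by (auto simp: matrix_bound_def Lp_amp_iff)
  next
    assume *: "\<forall>f\<in>Lp_functions p amp. Lp_norm p amp (row_action t f) \<le> C * Lp_norm p amp f"
    show "matrix_bound p M n t (C powr p)"
      unfolding matrix_bound_def
    proof (intro allI impI)
      fix F assume F: "\<forall>j\<in>{1..n}. F j \<in> Lp_functions p M"
      then have "column F \<in> Lp_functions p amp" by (intro column_closed) auto
      with * norm[OF this] show "(\<Sum>i=1..n. Lp_integral p M (\<lambda>x. \<Sum>j=1..n. t i j (F j) x))
          \<le> C powr p * (\<Sum>j=1..n. Lp_integral p M (F j))" by simp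
    qed
  qed
qed

text \<open>
  A crude bound. It shows that matrices act boundedly, and that small entries give a small norm.
\<close>

lemma matrix_bound_entries:
  assumes t: "\<And>i j f. i \<in> {1..n} \<Longrightarrow> j \<in> {1..n} \<Longrightarrow> f \<in> Lp_functions p M \<Longrightarrow> t i j f \<in> Lp_functions p M"
    and d: "0 \<le> d"
    and bound: "\<And>i j f. i \<in> {1..n} \<Longrightarrow> j \<in> {1..n} \<Longrightarrow> f \<in> Lp_functions p M \<Longrightarrow> Lp_norm p M (t i j f) \<le> d * Lp_norm p M f"
  shows "matrix_bound p M n t ((real n * (real n * d)) powr p)"
  unfolding matrix_bound_def
proof (intro allI impI)
  fix F assume F: "\<forall>j\<in>{1..n}. F j \<in> Lp_functions p M"
  let ?S = "\<Sum>j=1..n. Lp_integral p M (F j)"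
  have S: "0 \<le> ?S" by (simp add: sum_nonneg)
  have entry: "Lp_norm p M (F j) \<le> ?S powr (1 / p)" if "j \<in> {1..n}" for j
    unfolding Lp_norm_def using that p_ge1 by (intro powr_mono2 member_le_sum) auto
  have row: "Lp_integral p M (\<lambda>x. \<Sum>j=1..n. t i j (F j) x) \<le> (real n * d) powr p * ?S" if i: "i \<in> {1..n}" for i
  proof -
    have "Lp_norm p M (\<lambda>x. \<Sum>j=1..n. t i j (F j) x) \<le> (\<Sum>j=1..n. Lp_norm p M (t i j (F j)))"
      using t[OF i] F by (intro Lp_norm_sum) auto
    also have "\<dots> \<le> (\<Sum>j=1..n. d * ?S powr (1 / p))"
      using bound[OF i] F entry d by (intro sum_mono order_trans[OF bound[OF i]] mult_left_mono) auto
    also have "\<dots> = (real n * d) * ?S powr (1 / p)" by simp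
    finally have "Lp_integral p M (\<lambda>x. \<Sum>j=1..n. t i j (F j) x) \<le> ((real n * d) * ?S powr (1 / p)) powr p"
      using d by (simp add: Lp_norm_le_iff)
    also have "\<dots> = (real n * d) powr p * ?S"
      using d p_ge1 S by (simp add: powr_mult powr_powr)
    finally show ?thesis .
  qed
  have "(\<Sum>i=1..n. Lp_integral p M (\<lambda>x. \<Sum>j=1..n. t i j (F j) x)) \<le> (\<Sum>i=1..n. (real n * d) powr p * ?S)"
    by (intro sum_mono row)
  also have "\<dots> = real n * ((real n * d) powr p * ?S)" by simp
  also have "\<dots> \<le> real n powr p * ((real n * d) powr p * ?S)"
    using p_ge1 S powr_mono[of 1 p "real n"] by (intro mult_right_mono) (cases n, auto)
  also have "\<dots> = (real n * (real n * d)) powr p * ?S"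
    using d by (simp add: powr_mult)
  finally show "(\<Sum>i=1..n. Lp_integral p M (\<lambda>x. \<Sum>j=1..n. t i j (F j) x)) \<le> (real n * (real n * d)) powr p * ?S" .
qed

text \<open>
  Minkowski's inequality on the product space, with the crude bound for the difference.
\<close>

lemma matrix_bound_perturb:
  assumes t: "\<And>i j f. i \<in> {1..n} \<Longrightarrow> j \<in> {1..n} \<Longrightarrow> f \<in> Lp_functions p M \<Longrightarrow> t i j f \<in> Lp_functions p M"
    and u: "\<And>i j f. i \<in> {1..n} \<Longrightarrow> j \<in> {1..n} \<Longrightarrow> f \<in> Lp_functions p M \<Longrightarrow> u i j f \<in> Lp_functions p M"
    and d: "0 \<le> d" and C: "0 \<le> C"
    and close: "\<And>i j f. i \<in> {1..n} \<Longrightarrow> j \<in> {1..n} \<Longrightarrow> f \<in> Lp_functions p M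
      \<Longrightarrow> Lp_norm p M (\<lambda>x. u i j f x - t i j f x) \<le> d * Lp_norm p M f"
    and bound: "matrix_bound p M n t (C powr p)"
  shows "matrix_bound p M n u ((C + real n * (real n * d)) powr p)"
proof -
  let ?v = "\<lambda>i j f x. u i j f x - t i j f x"
  have v: "?v i j f \<in> Lp_functions p M" if "i \<in> {1..n}" "j \<in> {1..n}" "f \<in> Lp_functions p M" for i j f
    using t[OF that] u[OF that] by (rule Lp_diff[rotated])
  have "matrix_bound p M n ?v ((real n * (real n * d)) powr p)"
    by (intro matrix_bound_entries v d close)
  then have 1: "Lp_norm p amp (row_action ?v f) \<le> (real n * (real n * d)) * Lp_norm p amp f" if "f \<in> Lp_functions p amp" for f
    using matrix_bound_iff[of ?v "real n * (real n * d)"] v d that by simp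
  have 2: "Lp_norm p amp (row_action t f) \<le> C * Lp_norm p amp f" if "f \<in> Lp_functions p amp" for f
    using matrix_bound_iff[of t C] t C bound that by simp
  have "Lp_norm p amp (row_action u f) \<le> (C + real n * (real n * d)) * Lp_norm p amp f" if f: "f \<in> Lp_functions p amp" for f
  proof -
    have "row_action u f = (\<lambda>z. row_action t f z + row_action ?v f z)"
      by (auto simp: row_action_def column_def fun_eq_iff simp flip: sum.distrib)
    then have "Lp_norm p amp (row_action u f) \<le> Lp_norm p amp (row_action t f) + Lp_norm p amp (row_action ?v f)"
      using Lp_norm_triangle[OF row_action_closed[OF t f] row_action_closed[OF v f]] by simp
    then show ?thesis using 1[OF f] 2[OF f] by (simp add: algebra_simps)
  qed
  then show ?thesis
    using matrix_bound_iff[of u "C + real n * (real n * d)"] u C d by simp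
qed

lemma Lp_slice_class:
  assumes f: "f \<in> Lp_functions p amp" and j: "j \<in> {1..n}"
  shows "Lp_slice p M j (Lp_class p amp f) = Lp_class p M (\<lambda>x. f (j, x))"
proof -
  have "Lp_class p M (\<lambda>x. g (j, x)) = Lp_class p M (\<lambda>x. f (j, x))" if "g \<in> Lp_class p amp f" for g
    using that j AE_amp_iff[OF _ f, of g] by (intro Lp_class_cong_AE) (auto simp: mem_Lp_class)
  then have "Lp_slice p M j (Lp_class p amp f) = (\<Union>g\<in>Lp_class p amp f. Lp_class p M (\<lambda>x. f (j, x)))"
    by (simp add: Lp_slice_def)
  also have "\<dots> = Lp_class p M (\<lambda>x. f (j, x))" using Lp_class_self[OF f] by blast
  finally show ?thesis .
qed

context
  fixes b :: "nat \<Rightarrow> nat \<Rightarrow> ('x \<Rightarrow> complex) set \<Rightarrow> ('x \<Rightarrow> complex) set"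
  assumes b: "\<And>i j. i \<in> {1..n} \<Longrightarrow> j \<in> {1..n} \<Longrightarrow> b i j \<in> carrier_of (Lp_operators p M)"
begin

lemma entry_closed:
  "i \<in> {1..n} \<Longrightarrow> j \<in> {1..n} \<Longrightarrow> f \<in> Lp_functions p M \<Longrightarrow> act p M (b i j) f \<in> Lp_functions p M"
  by (intro act_closed b)

text \<open>
  The representatives chosen in the definition of \<open>matrix_operator\<close> agree almost everywhere with the
  values of \<open>act\<close>, for the finitely many entries simultaneously.
\<close>

lemma represents_matrix_operator:
  "represents p amp (matrix_operator p M n b) (row_action (\<lambda>i j. act p M (b i j)))"
  unfolding represents_def
proof (intro ballI conjI)
  fix f assume f: "f \<in> Lp_functions p amp"
  let ?t = "row_action (\<lambda>i j. act p M (b i j))"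
  show tf: "?t f \<in> Lp_functions p amp" by (intro row_action_closed entry_closed f)
  have fj: "(\<lambda>x. f (j, x)) \<in> Lp_functions p M" if "j \<in> {1..n}" for j using f that by (simp add: Lp_amp_iff)
  have image: "b i j (Lp_slice p M j (Lp_class p amp f)) = Lp_class p M (act p M (b i j) (\<lambda>x. f (j, x)))"
    if "i \<in> {1..n}" "j \<in> {1..n}" for i j
    using that by (simp add: Lp_slice_class[OF f] apply_Lp_class[OF b fj])
  have "(\<exists>g. (\<forall>i\<in>{1..n}. \<forall>j\<in>{1..n}. g i j \<in> b i j (Lp_slice p M j (Lp_class p amp f)))
          \<and> (\<forall>i\<in>{1..n}. AE x in M. h (i, x) = (\<Sum>j=1..n. g i j x)))
      \<longleftrightarrow> (\<forall>i\<in>{1..n}. AE x in M. h (i, x) = ?t f (i, x))" for h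
  proof
    assume "\<exists>g. (\<forall>i\<in>{1..n}. \<forall>j\<in>{1..n}. g i j \<in> b i j (Lp_slice p M j (Lp_class p amp f)))
          \<and> (\<forall>i\<in>{1..n}. AE x in M. h (i, x) = (\<Sum>j=1..n. g i j x))"
    then obtain g where g: "\<And>i j. i \<in> {1..n} \<Longrightarrow> j \<in> {1..n} \<Longrightarrow> g i j \<in> b i j (Lp_slice p M j (Lp_class p amp f))"
      and h: "\<And>i. i \<in> {1..n} \<Longrightarrow> AE x in M. h (i, x) = (\<Sum>j=1..n. g i j x)" by blast
    show "\<forall>i\<in>{1..n}. AE x in M. h (i, x) = ?t f (i, x)"
    proof
      fix i assume i: "i \<in> {1..n}"
      have "AE x in M. \<forall>j\<in>{1..n}. g i j x = act p M (b i j) (\<lambda>x. f (j, x)) x"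
        using g[OF i] image[OF i] by (intro AE_finite_allI finite_atLeastAtMost) (simp add: mem_Lp_class)
      with h[OF i] show "AE x in M. h (i, x) = ?t f (i, x)"
        by eventually_elim (simp add: row_action_def)
    qed
  next
    assume "\<forall>i\<in>{1..n}. AE x in M. h (i, x) = ?t f (i, x)"
    then show "\<exists>g. (\<forall>i\<in>{1..n}. \<forall>j\<in>{1..n}. g i j \<in> b i j (Lp_slice p M j (Lp_class p amp f)))
          \<and> (\<forall>i\<in>{1..n}. AE x in M. h (i, x) = (\<Sum>j=1..n. g i j x))"
      using image Lp_class_self[OF entry_closed[OF _ _ fj]]
      by (intro exI[of _ "\<lambda>i j. act p M (b i j) (\<lambda>x. f (j, x))"]) (simp add: row_action_def)
  qed
  then show "matrix_operator p M n b (Lp_class p amp f) = Lp_class p amp (?t f)"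
    using Lp_class_in_carrier[OF f] AE_amp_iff[OF _ tf]
    unfolding matrix_operator_def by (auto simp: Lp_class_def)
qed

lemma row_action_scale:
  assumes f: "f \<in> Lp_functions p amp"
  shows "Lp_norm p amp (row_action (\<lambda>i j. act p M (b i j)) (\<lambda>z. c * f z))
    = cmod c * Lp_norm p amp (row_action (\<lambda>i j. act p M (b i j)) f)"
proof -
  let ?t = "row_action (\<lambda>i j. act p M (b i j))"
  have fj: "(\<lambda>x. f (j, x)) \<in> Lp_functions p M" if "j \<in> {1..n}" for j using f that by (simp add: Lp_amp_iff)
  have t: "?t g \<in> Lp_functions p amp" if "g \<in> Lp_functions p amp" for g
    by (intro row_action_closed entry_closed that)
  have "AE z in amp. ?t (\<lambda>z. c * f z) z = c * ?t f z"
    unfolding AE_amp_iff[OF t[OF Lp_scale[OF f]] Lp_scale[OF t[OF f]]]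
  proof
    fix i assume i: "i \<in> {1..n}"
    have "AE x in M. \<forall>j\<in>{1..n}. act p M (b i j) (\<lambda>x. c * f (j, x)) x = c * act p M (b i j) (\<lambda>x. f (j, x)) x"
      using i by (intro AE_finite_allI finite_atLeastAtMost act_scale b fj)
    then show "AE x in M. ?t (\<lambda>z. c * f z) (i, x) = c * ?t f (i, x)"
      by eventually_elim (simp add: row_action_def sum_distrib_left)
  qed
  then have "Lp_norm p amp (?t (\<lambda>z. c * f z)) = Lp_norm p amp (\<lambda>z. c * ?t f z)"
    by (intro Lp_norm_cong_AE t Lp_scale f)
  then show ?thesis by (simp add: Lp_norm_scale)
qed

lemma matrix_operator_bounded:
  "\<exists>K. \<forall>f\<in>Lp_functions p amp. Lp_norm p amp (row_action (\<lambda>i j. act p M (b i j)) f) \<le> K * Lp_norm p amp f"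
proof -
  define d where "d = (\<Sum>i=1..n. \<Sum>j=1..n. norm_of (Lp_operators p M) (b i j))"
  have nn: "0 \<le> norm_of (Lp_operators p M) (b i j)" if "i \<in> {1..n}" "j \<in> {1..n}" for i j
    using b[OF that] by (rule norm_operator_nonneg)
  have d: "norm_of (Lp_operators p M) (b i j) \<le> d" if "i \<in> {1..n}" "j \<in> {1..n}" for i j
  proof -
    have "norm_of (Lp_operators p M) (b i j) \<le> (\<Sum>j=1..n. norm_of (Lp_operators p M) (b i j))"
      using that nn by (intro member_le_sum) auto
    also have "\<dots> \<le> d" unfolding d_def
      using that nn by (intro member_le_sum[where f = "\<lambda>i. \<Sum>j=1..n. norm_of (Lp_operators p M) (b i j)"] sum_nonneg) auto
    finally show ?thesis .
  qed
  have d0: "0 \<le> d" unfolding d_def by (intro sum_nonneg nn)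
  have "matrix_bound p M n (\<lambda>i j. act p M (b i j)) ((real n * (real n * d)) powr p)"
    using d d0 by (intro matrix_bound_entries entry_closed order_trans[OF Lp_norm_act_le[OF b]] mult_right_mono) auto
  then show ?thesis
    using matrix_bound_iff[OF entry_closed, where C = "real n * (real n * d)"] d0 by auto
qed

lemma matrix_norm_nonneg: "0 \<le> matrix_norm p M n b"
proof -
  obtain K where "\<forall>f\<in>Lp_functions p amp. Lp_norm p amp (row_action (\<lambda>i j. act p M (b i j)) f) \<le> K * Lp_norm p amp f"
    using matrix_operator_bounded by blast
  from opnorm_nonneg[OF represents_matrix_operator row_action_scale this[rule_format]]
  show ?thesis unfolding matrix_norm_def .
qed

lemma matrix_norm_le_iff:
  assumes "0 \<le> C"
  shows "matrix_norm p M n b \<le> C \<longleftrightarrow> matrix_bound p M n (\<lambda>i j. act p M (b i j)) (C powr p)"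
proof -
  obtain K where "\<forall>f\<in>Lp_functions p amp. Lp_norm p amp (row_action (\<lambda>i j. act p M (b i j)) f) \<le> K * Lp_norm p amp f"
    using matrix_operator_bounded by blast
  from opnorm_le_iff[OF represents_matrix_operator row_action_scale this[rule_format] assms]
  show ?thesis unfolding matrix_norm_def using matrix_bound_iff[OF entry_closed assms] by simp
qed

end

end

section \<open>Direct sums of matrix algebras by entries\<close>

abbreviation points :: "nat \<Rightarrow> nat measure" where
  "points m \<equiv> count_space {1..m}"

definition matrix_op ::
    "real \<Rightarrow> nat \<Rightarrow> (nat \<Rightarrow> nat \<Rightarrow> complex) \<Rightarrow> (nat \<Rightarrow> complex) set \<Rightarrow> (nat \<Rightarrow> complex) set" where
  "matrix_op p m a = (\<lambda>F\<in>carrier_of (Lp p (points m)).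
     Lp_class p (points m) (\<lambda>i. \<Sum>j=1..m. a i j * (SOME f. f \<in> F) j))"

definition block_element ::
    "real \<Rightarrow> nat \<Rightarrow> (nat \<Rightarrow> nat) \<Rightarrow> (nat \<Rightarrow> nat \<Rightarrow> nat \<Rightarrow> complex)
      \<Rightarrow> nat \<Rightarrow> (nat \<Rightarrow> complex) set \<Rightarrow> (nat \<Rightarrow> complex) set" where
  "block_element p blocks sz a = (\<lambda>k\<in>{1..blocks}. matrix_op p (sz k) (a k))"

context lp_exponent
begin

lemma Lp_points [simp]: "f \<in> Lp_functions p (points m)"
  by (simp add: Lp_functions_def integrable_count_space)

lemma Lp_integral_points: "Lp_integral p (points m) f = (\<Sum>j=1..m. cmod (f j) powr p)"
  by (simp add: Lp_integral_def lebesgue_integral_count_space_finite)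

lemma AE_points: "(AE x in points m. P x) \<longleftrightarrow> (\<forall>x\<in>{1..m}. P x)"
  by (simp add: AE_count_space)

lemma matrix_op_class:
  "matrix_op p m a (Lp_class p (points m) f) = Lp_class p (points m) (\<lambda>i. \<Sum>j=1..m. a i j * f j)"
proof -
  let ?g = "SOME g. g \<in> Lp_class p (points m) f"
  have "?g \<in> Lp_class p (points m) f"
    using Lp_class_self[OF Lp_points, of f m] by (auto simp: some_in_eq)
  then have "\<forall>j\<in>{1..m}. ?g j = f j" by (simp add: mem_Lp_class AE_points)
  then have "(\<lambda>i. \<Sum>j=1..m. a i j * ?g j) = (\<lambda>i. \<Sum>j=1..m. a i j * f j)"
    by (intro ext sum.cong) auto
  then show ?thesis
    using Lp_class_in_carrier[OF Lp_points, of m f] by (simp add: matrix_op_def)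
qed

lemma matrix_op_eqI:
  assumes "T \<in> extensional (carrier_of (Lp p (points m)))"
    and "\<And>f. T (Lp_class p (points m) f) = Lp_class p (points m) (\<lambda>i. \<Sum>j=1..m. a i j * f j)"
  shows "T = matrix_op p m a"
proof (rule extensionalityI[OF assms(1)])
  show "matrix_op p m a \<in> extensional (carrier_of (Lp p (points m)))" by (simp add: matrix_op_def)
  show "T X = matrix_op p m a X" if "X \<in> carrier_of (Lp p (points m))" for X
    using that by (auto simp: carrier_Lp assms(2) matrix_op_class)
qed

lemma abs_entry_le_Lp_norm: "j \<in> {1..m} \<Longrightarrow> cmod (f j) \<le> Lp_norm p (points m) f"
proof -
  assume j: "j \<in> {1..m}"
  have "cmod (f j) powr p \<le> Lp_norm p (points m) f powr p"
    unfolding Lp_norm_powr Lp_integral_points using j by (intro member_le_sum) auto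
  then show ?thesis
    using p_ge1 by (metis Lp_norm_nonneg powr_less_mono2 linorder_not_le less_le_trans zero_less_one)
qed

lemma represents_matrix_op: "represents p (points m) (matrix_op p m a) (\<lambda>f i. \<Sum>j=1..m. a i j * f j)"
  by (simp add: represents_def matrix_op_class)

text \<open>
  The image is the combination of the columns of the matrix with coefficients \<open>f j\<close>, and no
  coefficient exceeds the norm of \<open>f\<close>.
\<close>

lemma Lp_norm_matrix_le:
  "Lp_norm p (points m) (\<lambda>i. \<Sum>j=1..m. a i j * f j)
    \<le> (\<Sum>j=1..m. Lp_norm p (points m) (\<lambda>i. a i j)) * Lp_norm p (points m) f"
proof -
  have "Lp_norm p (points m) (\<lambda>i. \<Sum>j=1..m. f j * a i j) \<le> (\<Sum>j=1..m. Lp_norm p (points m) (\<lambda>i. f j * a i j))"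
    by (intro Lp_norm_sum) auto
  also have "\<dots> \<le> (\<Sum>j=1..m. Lp_norm p (points m) f * Lp_norm p (points m) (\<lambda>i. a i j))"
    unfolding Lp_norm_scale by (intro sum_mono mult_right_mono abs_entry_le_Lp_norm) auto
  finally show ?thesis by (simp add: sum_distrib_left mult.commute)
qed

lemma matrix_op_closed: "matrix_op p m a \<in> carrier_of (matrix_algebra p m)"
proof -
  let ?M = "points m"
  have "matrix_op p m a \<in> carrier_of (Lp p ?M) \<rightarrow>\<^sub>E carrier_of (Lp p ?M)"
    by (intro PiE_I) (auto simp: matrix_op_def intro: Lp_class_in_carrier)
  moreover have "matrix_op p m a (add_of (Lp p ?M) X Y) = add_of (Lp p ?M) (matrix_op p m a X) (matrix_op p m a Y)"
    if XY: "X \<in> carrier_of (Lp p ?M)" "Y \<in> carrier_of (Lp p ?M)" for X Y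
  proof -
    obtain f g where "X = Lp_class p ?M f" "Y = Lp_class p ?M g" using XY by (auto simp: carrier_Lp)
    then show ?thesis by (simp add: add_Lp_class matrix_op_class sum.distrib distrib_left)
  qed
  moreover have "matrix_op p m a (scale_of (Lp p ?M) c X) = scale_of (Lp p ?M) c (matrix_op p m a X)"
    if X: "X \<in> carrier_of (Lp p ?M)" for X c
  proof -
    obtain f where "X = Lp_class p ?M f" using X by (auto simp: carrier_Lp)
    then show ?thesis by (simp add: scale_Lp_class matrix_op_class sum_distrib_left mult.left_commute)
  qed
  moreover have "norm_of (Lp p ?M) (matrix_op p m a X)
      \<le> (\<Sum>j=1..m. Lp_norm p ?M (\<lambda>i. a i j)) * norm_of (Lp p ?M) X"
    if X: "X \<in> carrier_of (Lp p ?M)" for X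
  proof -
    obtain f where "X = Lp_class p ?M f" using X by (auto simp: carrier_Lp)
    then show ?thesis using Lp_norm_matrix_le[of m a f] by (simp add: norm_Lp_class matrix_op_class)
  qed
  ultimately show ?thesis unfolding matrix_algebra_def bounded_operators_def
    by (auto intro!: exI[of _ "\<Sum>j=1..m. Lp_norm p ?M (\<lambda>i. a i j)"])
qed

lemma matrix_op_add_scale:
  "add_of (matrix_algebra p m) (matrix_op p m a) (scale_of (matrix_algebra p m) c (matrix_op p m b))
    = matrix_op p m (\<lambda>i j. a i j + c * b i j)"
proof (rule matrix_op_eqI)
  show "add_of (matrix_algebra p m) (matrix_op p m a) (scale_of (matrix_algebra p m) c (matrix_op p m b)) (Lp_class p (points m) f)
      = Lp_class p (points m) (\<lambda>i. \<Sum>j=1..m. (a i j + c * b i j) * f j)" for f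
    by (simp add: matrix_algebra_def bounded_operators_def Lp_class_in_carrier matrix_op_class scale_Lp_class add_Lp_class
        distrib_right sum.distrib sum_distrib_left mult.assoc)
qed (simp add: matrix_algebra_def bounded_operators_def)

lemma matrix_op_mult:
  "mult_of (matrix_algebra p m) (matrix_op p m a) (matrix_op p m b) = matrix_op p m (\<lambda>i j. \<Sum>l=1..m. a i l * b l j)"
proof (rule matrix_op_eqI)
  fix f :: "nat \<Rightarrow> complex"
  have "(\<lambda>i. \<Sum>l=1..m. a i l * (\<Sum>j=1..m. b l j * f j)) = (\<lambda>i. \<Sum>j=1..m. (\<Sum>l=1..m. a i l * b l j) * f j)"
    unfolding sum_distrib_left sum_distrib_right mult.assoc by (intro ext sum.swap)
  then show "mult_of (matrix_algebra p m) (matrix_op p m a) (matrix_op p m b) (Lp_class p (points m) f)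
      = Lp_class p (points m) (\<lambda>i. \<Sum>j=1..m. (\<Sum>l=1..m. a i l * b l j) * f j)"
    by (simp add: matrix_algebra_def bounded_operators_def Lp_class_in_carrier matrix_op_class)
qed (simp add: matrix_algebra_def bounded_operators_def)

lemma matrix_op_cong:
  assumes "\<And>i j. i \<in> {1..m} \<Longrightarrow> j \<in> {1..m} \<Longrightarrow> a i j = b i j"
  shows "matrix_op p m a = matrix_op p m b"
proof (rule matrix_op_eqI)
  show "matrix_op p m a (Lp_class p (points m) f) = Lp_class p (points m) (\<lambda>i. \<Sum>j=1..m. b i j * f j)" for f
    unfolding matrix_op_class using assms by (intro Lp_class_cong_AE) (simp add: AE_points)
qed (simp add: matrix_op_def)

lemma norm_matrix_op_le_1:
  assumes "\<And>v. (\<Sum>i=1..m. cmod (\<Sum>j=1..m. a i j * v j) powr p) \<le> (\<Sum>j=1..m. cmod (v j) powr p)"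
  shows "norm_of (matrix_algebra p m) (matrix_op p m a) \<le> 1"
proof -
  have hom: "Lp_norm p (points m) (\<lambda>i. \<Sum>j=1..m. a i j * (c * f j)) = cmod c * Lp_norm p (points m) (\<lambda>i. \<Sum>j=1..m. a i j * f j)" for c f
    unfolding Lp_norm_scale[symmetric] by (simp add: sum_distrib_left mult.left_commute)
  have "Lp_norm p (points m) (\<lambda>i. \<Sum>j=1..m. a i j * f j) \<le> Lp_norm p (points m) f" for f
    unfolding Lp_norm_le_Lp_norm_iff Lp_integral_points using assms .
  then show ?thesis
    unfolding matrix_algebra_def
    using opnorm_le_iff[OF represents_matrix_op hom Lp_norm_matrix_le, of 1] by simp
qed

lemma matrix_op_surj:
  assumes T: "T \<in> carrier_of (matrix_algebra p m)"
  shows "\<exists>a. T = matrix_op p m a"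
proof -
  have T': "T \<in> carrier_of (Lp_operators p (points m))" using T by (simp add: matrix_algebra_def)
  let ?e = "\<lambda>j i. if i = j then 1 else (0 :: complex)"
  have sum: "AE x in points m. act p (points m) T (\<lambda>x. \<Sum>j\<in>S. f j * ?e j x) x = (\<Sum>j\<in>S. f j * act p (points m) T (?e j) x)"
    if "finite S" for S and f :: "nat \<Rightarrow> complex"
    using that
  proof (induction S rule: finite_induct)
    case empty
    show ?case using act_linear[OF T' Lp_points Lp_points, of "\<lambda>_. 0" "-1" "\<lambda>_. 0"] by simp
  next
    case (insert t S)
    have eq: "(\<lambda>x. \<Sum>j\<in>insert t S. f j * ?e j x) = (\<lambda>x. (\<Sum>j\<in>S. f j * ?e j x) + f t * ?e t x)"
      using insert by (simp add: add.commute)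
    have "AE x in points m. act p (points m) T (\<lambda>x. (\<Sum>j\<in>S. f j * ?e j x) + f t * ?e t x) x
        = act p (points m) T (\<lambda>x. \<Sum>j\<in>S. f j * ?e j x) x + f t * act p (points m) T (?e t) x"
      by (rule act_linear[OF T' Lp_points Lp_points])
    with insert.IH show ?case
      unfolding eq by eventually_elim (use insert in \<open>simp add: add.commute\<close>)
  qed
  have "T = matrix_op p m (\<lambda>i j. act p (points m) T (?e j) i)"
  proof (rule matrix_op_eqI)
    show "T \<in> extensional (carrier_of (Lp p (points m)))"
      using T' by (auto simp: bounded_operators_def PiE_def)
    fix f
    have "AE x in points m. f x = (\<Sum>j=1..m. f j * ?e j x)"
      by (simp add: AE_points if_distrib[of "(*) _"] cong: if_cong)
    then have "T (Lp_class p (points m) f) = Lp_class p (points m) (act p (points m) T (\<lambda>x. \<Sum>j=1..m. f j * ?e j x))"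
      using apply_Lp_class[OF T' Lp_points, of f] by (simp only: act_cong_AE)
    also have "\<dots> = Lp_class p (points m) (\<lambda>i. \<Sum>j=1..m. act p (points m) T (?e j) i * f j)"
      using sum[of "{1..m}" f] by (intro Lp_class_cong_AE) (simp add: mult.commute)
    finally show "T (Lp_class p (points m) f) = Lp_class p (points m) (\<lambda>i. \<Sum>j=1..m. act p (points m) T (?e j) i * f j)" .
  qed
  then show ?thesis by blast
qed

lemma block_element_closed: "block_element p blocks sz a \<in> carrier_of (block_algebra p blocks sz)"
  by (simp add: block_algebra_def direct_sum_def block_element_def matrix_op_closed)

lemma block_element_add_scale:
  "add_of (block_algebra p blocks sz) (block_element p blocks sz a)
      (scale_of (block_algebra p blocks sz) c (block_element p blocks sz b))
    = block_element p blocks sz (\<lambda>k i j. a k i j + c * b k i j)"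
  by (auto simp: block_algebra_def direct_sum_def block_element_def matrix_op_add_scale fun_eq_iff)

lemma block_element_mult:
  "mult_of (block_algebra p blocks sz) (block_element p blocks sz a) (block_element p blocks sz b)
    = block_element p blocks sz (block_mult sz a b)"
  by (auto simp: block_algebra_def direct_sum_def block_element_def matrix_op_mult block_mult_def[abs_def] fun_eq_iff)

lemma block_element_cong:
  assumes "\<And>k i j. k \<in> {1..blocks} \<Longrightarrow> i \<in> {1..sz k} \<Longrightarrow> j \<in> {1..sz k} \<Longrightarrow> a k i j = b k i j"
  shows "block_element p blocks sz a = block_element p blocks sz b"
  unfolding block_element_def using assms by (intro restrict_ext matrix_op_cong) auto

lemma norm_block_element_le_1:
  assumes "block_contraction p blocks sz a" "0 < blocks"
  shows "norm_of (block_algebra p blocks sz) (block_element p blocks sz a) \<le> 1"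
proof -
  have "norm_of (matrix_algebra p (sz k)) (matrix_op p (sz k) (a k)) \<le> 1" if "k \<in> {1..blocks}" for k
    using assms(1) that by (intro norm_matrix_op_le_1) (auto simp: block_contraction_def)
  then show ?thesis
    using assms(2) by (auto simp: block_algebra_def direct_sum_def block_element_def Max_le_iff)
qed

lemma block_element_surj:
  assumes "x \<in> carrier_of (block_algebra p blocks sz)"
  shows "\<exists>a. x = block_element p blocks sz a"
proof -
  have x: "x \<in> (\<Pi>\<^sub>E k\<in>{1..blocks}. carrier_of (matrix_algebra p (sz k)))"
    using assms by (simp add: block_algebra_def direct_sum_def)
  have "\<forall>k\<in>{1..blocks}. \<exists>a. x k = matrix_op p (sz k) a"
    using x by (auto intro: matrix_op_surj)
  then obtain a where "\<forall>k\<in>{1..blocks}. x k = matrix_op p (sz k) (a k)" by metis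
  then have "x = block_element p blocks sz a"
    using x by (auto simp: block_element_def PiE_def extensional_def fun_eq_iff)
  then show ?thesis by blast
qed

lemma contractive_block_representation_of_hom:
  assumes p: "p \<noteq> 2" and blocks: "0 < blocks"
    and hom: "algebra_hom (block_algebra p blocks sz) (Lp_operators p M) \<rho>"
    and contr: "contractive (block_algebra p blocks sz) (Lp_operators p M) \<rho>"
  shows "contractive_block_representation p M blocks sz (\<lambda>a. act p M (\<rho> (block_element p blocks sz a)))"
proof -
  let ?B = "block_algebra p blocks sz" and ?e = "block_element p blocks sz" and ?L = "Lp_operators p M"
  have e: "?e a \<in> carrier_of ?B" for a by (rule block_element_closed)
  have r: "\<rho> (?e a) \<in> carrier_of ?L" for a using hom e by (auto simp: algebra_hom_def)
  have scl: "scale_of ?B c (?e a) \<in> carrier_of ?B" for c a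
  proof -
    have "scale_of ?B c (?e a) = ?e (\<lambda>k i j. 0 + c * a k i j)"
      by (auto simp: block_algebra_def direct_sum_def block_element_def fun_eq_iff intro!: matrix_op_eqI[THEN fun_cong])
         (auto simp: matrix_algebra_def bounded_operators_def Lp_class_in_carrier matrix_op_class scale_Lp_class sum_distrib_left mult.assoc)
    then show ?thesis by (simp only: e)
  qed
  show ?thesis
  proof
    show "p \<noteq> 2" by fact
    fix a b f g c
    assume f: "f \<in> Lp_functions p M"
    show "act p M (\<rho> (?e a)) f \<in> Lp_functions p M" by (intro act_closed r f)
    show "AE x in M. act p M (\<rho> (?e (\<lambda>k i j. a k i j + c * b k i j))) f x = act p M (\<rho> (?e a)) f x + c * act p M (\<rho> (?e b)) f x"
    proof -
      have "\<rho> (?e (\<lambda>k i j. a k i j + c * b k i j)) = add_of ?L (\<rho> (?e a)) (scale_of ?L c (\<rho> (?e b)))"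
        unfolding block_element_add_scale[symmetric] using hom e scl by (simp add: algebra_hom_def)
      moreover have "scale_of ?L c (\<rho> (?e b)) \<in> carrier_of ?L"
        using hom e scl unfolding algebra_hom_def by (metis funcset_mem)
      ultimately show ?thesis
        using act_add[OF r _ f, of "scale_of ?L c (\<rho> (?e b))" a] act_scale_op[OF r f, of c b] 
        by (auto elim: eventually_elim2)
    qed
    show "AE x in M. act p M (\<rho> (?e (block_mult sz a b))) f x = act p M (\<rho> (?e a)) (act p M (\<rho> (?e b)) f) x"
    proof -
      have "\<rho> (?e (block_mult sz a b)) = mult_of ?L (\<rho> (?e a)) (\<rho> (?e b))"
        unfolding block_element_mult[symmetric] using hom e by (simp add: algebra_hom_def)
      then show ?thesis using act_mult[OF r r f] by simp
    qed
    {
      assume g: "g \<in> Lp_functions p M"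
      show "AE x in M. act p M (\<rho> (?e a)) (\<lambda>x. f x + c * g x) x = act p M (\<rho> (?e a)) f x + c * act p M (\<rho> (?e a)) g x"
        by (intro act_linear r f g)
    }
    assume c: "block_contraction p blocks sz a"
    have "norm_of ?L (\<rho> (?e a)) \<le> 1"
      using contr norm_block_element_le_1[OF c blocks] e unfolding contractive_def by (meson order_trans)
    then have "Lp_norm p M (act p M (\<rho> (?e a)) f) \<le> Lp_norm p M f"
      using norm_operator_le_iff[OF r, of 1] f by simp
    then show "Lp_integral p M (act p M (\<rho> (?e a)) f) \<le> Lp_integral p M f"
      by (simp add: Lp_norm_le_Lp_norm_iff)
  next
    fix a b :: "nat \<Rightarrow> nat \<Rightarrow> nat \<Rightarrow> complex"
    fix f
    assume "\<And>k i j. k \<in> {1..blocks} \<Longrightarrow> i \<in> {1..sz k} \<Longrightarrow> j \<in> {1..sz k} \<Longrightarrow> a k i j = b k i j"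
    then show "act p M (\<rho> (?e a)) f = act p M (\<rho> (?e b)) f"
      using block_element_cong[of blocks sz a b] by simp
  qed
qed

end

section \<open>Direct limits\<close>

context complex_normed_space
begin

lemma add_left_comm:
  "\<lbrakk>x \<in> carrier_of E; y \<in> carrier_of E; z \<in> carrier_of E\<rbrakk>
    \<Longrightarrow> add_of E x (add_of E y z) = add_of E y (add_of E x z)"
  by (metis add_assoc add_comm)

lemmas add_ac = add_assoc add_comm add_left_comm

lemma diff_closed: "\<lbrakk>x \<in> carrier_of E; y \<in> carrier_of E\<rbrakk> \<Longrightarrow> diff_of E x y \<in> carrier_of E"
  by (simp add: diff_of_def add_closed scale_closed)

lemma diff_add:
  assumes "x \<in> carrier_of E" "y \<in> carrier_of E" "x' \<in> carrier_of E" "y' \<in> carrier_of E"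
  shows "diff_of E (add_of E x y) (add_of E x' y') = add_of E (diff_of E x x') (diff_of E y y')"
  using assms by (simp add: diff_of_def scale_add add_closed scale_closed add_ac)

lemma diff_scale:
  assumes "x \<in> carrier_of E" "y \<in> carrier_of E"
  shows "diff_of E (scale_of E c x) (scale_of E c y) = scale_of E c (diff_of E x y)"
  using assms by (simp add: diff_of_def scale_add scale_scale add_closed scale_closed)

lemma diff_flip:
  assumes "x \<in> carrier_of E" "y \<in> carrier_of E"
  shows "diff_of E y x = scale_of E (- 1) (diff_of E x y)"
proof -
  have "scale_of E (- 1) (diff_of E x y) = add_of E (scale_of E (- 1) x) y"
    using assms by (simp add: diff_of_def scale_add scale_scale scale_one scale_closed)
  then show ?thesis using assms by (simp add: diff_of_def add_comm scale_closed)
qed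

lemma norm_diff_comm:
  "\<lbrakk>x \<in> carrier_of E; y \<in> carrier_of E\<rbrakk> \<Longrightarrow> norm_of E (diff_of E x y) = norm_of E (diff_of E y x)"
  by (simp add: diff_flip[of x y] norm_scale diff_closed)

lemma diff_add_cancel_middle:
  assumes "x \<in> carrier_of E" "y \<in> carrier_of E" "z \<in> carrier_of E"
  shows "add_of E (diff_of E x y) (diff_of E y z) = diff_of E x z"
proof -
  have "add_of E (diff_of E x y) (diff_of E y z) = add_of E (add_of E x (scale_of E (- 1) z)) (diff_of E y y)"
    using assms by (simp add: diff_of_def add_closed scale_closed add_ac)
  then show ?thesis
    using assms by (simp add: diff_self add_zero add_closed scale_closed) (simp add: diff_of_def)
qed

end

context complex_normed_algebra
begin

lemma diff_mult:
  assumes "x \<in> carrier_of A" "y \<in> carrier_of A" "x' \<in> carrier_of A" "y' \<in> carrier_of A"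
  shows "diff_of A (mult_of A x y) (mult_of A x' y')
    = add_of A (mult_of A (diff_of A x x') y) (mult_of A x' (diff_of A y y'))"
proof -
  have "mult_of A (diff_of A x x') y = diff_of A (mult_of A x y) (mult_of A x' y)"
    using assms by (simp add: diff_of_def mult_add_left mult_scale_left scale_closed)
  moreover have "mult_of A x' (diff_of A y y') = diff_of A (mult_of A x' y) (mult_of A x' y')"
    using assms by (simp add: diff_of_def mult_add_right mult_scale_right scale_closed)
  ultimately show ?thesis using assms by (simp add: diff_add_cancel_middle mult_closed)
qed

end

lemma algebra_hom_closed: "algebra_hom A B f \<Longrightarrow> x \<in> carrier_of A \<Longrightarrow> f x \<in> carrier_of B"
  by (auto simp: algebra_hom_def)

lemma algebra_hom_add:
  "algebra_hom A B f \<Longrightarrow> x \<in> carrier_of A \<Longrightarrow> y \<in> carrier_of A \<Longrightarrow> f (add_of A x y) = add_of B (f x) (f y)"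
  by (simp add: algebra_hom_def)

lemma algebra_hom_scale: "algebra_hom A B f \<Longrightarrow> x \<in> carrier_of A \<Longrightarrow> f (scale_of A c x) = scale_of B c (f x)"
  by (simp add: algebra_hom_def)

lemma algebra_hom_mult:
  "algebra_hom A B f \<Longrightarrow> x \<in> carrier_of A \<Longrightarrow> y \<in> carrier_of A \<Longrightarrow> f (mult_of A x y) = mult_of B (f x) (f y)"
  by (simp add: algebra_hom_def)

lemma algebra_hom_diff:
  assumes "algebra_hom A B f" "complex_normed_space A" "x \<in> carrier_of A" "y \<in> carrier_of A"
  shows "f (diff_of A x y) = diff_of B (f x) (f y)"
  using assms by (simp add: diff_of_def algebra_hom_add algebra_hom_scale complex_normed_space.scale_closed)

lemma algebra_hom_comp:
  "algebra_hom A B f \<Longrightarrow> algebra_hom B C g \<Longrightarrow> algebra_hom A C (g \<circ> f)"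
  by (auto simp: algebra_hom_def Pi_iff)

text \<open>
  The norms \<open>\<parallel>\<phi> n m a\<parallel>\<close> decrease with \<open>n\<close>, so the seminorm of the algebraic direct limit exists.
\<close>

locale normed_algebra_system =
  fixes S :: "nat \<Rightarrow> 'b nalg" and \<phi> :: "nat \<Rightarrow> nat \<Rightarrow> 'b \<Rightarrow> 'b"
  assumes algebra: "complex_normed_algebra (S m)"
    and hom: "m \<le> n \<Longrightarrow> algebra_hom (S m) (S n) (\<phi> n m)"
    and contr: "m \<le> n \<Longrightarrow> contractive (S m) (S n) (\<phi> n m)"
    and ident: "a \<in> carrier_of (S m) \<Longrightarrow> \<phi> m m a = a"
    and comp: "k \<le> m \<Longrightarrow> m \<le> n \<Longrightarrow> a \<in> carrier_of (S k) \<Longrightarrow> \<phi> n m (\<phi> m k a) = \<phi> n k a"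
begin

lemma normed_space: "complex_normed_space (S m)"
  using algebra by (rule complex_normed_algebra.axioms)

lemmas closed_rules =
  complex_normed_space.add_closed[OF normed_space] complex_normed_space.scale_closed[OF normed_space]
  complex_normed_space.diff_closed[OF normed_space] complex_normed_algebra.mult_closed[OF algebra]

abbreviation L where "L \<equiv> algebraic_limit S \<phi>"
abbreviation cl where "cl \<equiv> limit_class S \<phi>"

lemma phi_closed: "m \<le> n \<Longrightarrow> a \<in> carrier_of (S m) \<Longrightarrow> \<phi> n m a \<in> carrier_of (S n)"
  using hom by (rule algebra_hom_closed)

lemma phi_contractive: "m \<le> n \<Longrightarrow> a \<in> carrier_of (S m) \<Longrightarrow> norm_of (S n) (\<phi> n m a) \<le> norm_of (S m) a"
  using contr by (auto simp: contractive_def)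

lemma limit_relI:
  "\<lbrakk>a \<in> carrier_of (S m); b \<in> carrier_of (S n); m \<le> k; n \<le> k; \<phi> k m a = \<phi> k n b\<rbrakk> \<Longrightarrow> ((m, a), (n, b)) \<in> limit_rel S \<phi>"
  by (auto simp: limit_rel_def)

lemma limit_rel_later:
  assumes "((m, a), (n, b)) \<in> limit_rel S \<phi>"
  obtains k where "m \<le> k" "n \<le> k" "\<And>l. k \<le> l \<Longrightarrow> \<phi> l m a = \<phi> l n b"
proof -
  obtain k where k: "a \<in> carrier_of (S m)" "b \<in> carrier_of (S n)" "m \<le> k" "n \<le> k" "\<phi> k m a = \<phi> k n b"
    using assms by (auto simp: limit_rel_def)
  have "\<phi> l m a = \<phi> l n b" if "k \<le> l" for l
    using comp[OF k(3) that k(1)] comp[OF k(4) that k(2)] k(5) by simp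
  then show thesis using that k by blast
qed

lemma equiv_limit_rel: "equiv (SIGMA m:UNIV. carrier_of (S m)) (limit_rel S \<phi>)"
proof (rule equivI)
  show "limit_rel S \<phi> \<subseteq> (SIGMA m:UNIV. carrier_of (S m)) \<times> (SIGMA m:UNIV. carrier_of (S m))"
    by (auto simp: limit_rel_def)
  show "refl_on (SIGMA m:UNIV. carrier_of (S m)) (limit_rel S \<phi>)"
    by (auto simp: refl_on_def limit_rel_def)
  show "sym (limit_rel S \<phi>)" by (auto simp: sym_def limit_rel_def)
  show "trans (limit_rel S \<phi>)"
  proof (rule transI, clarify)
    fix m a n b q c
    assume 1: "((m, a), (n, b)) \<in> limit_rel S \<phi>" and 2: "((n, b), (q, c)) \<in> limit_rel S \<phi>"
    obtain k where k: "m \<le> k" "n \<le> k" "\<And>l. k \<le> l \<Longrightarrow> \<phi> l m a = \<phi> l n b" using 1 by (rule limit_rel_later) blast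
    obtain k' where k': "n \<le> k'" "q \<le> k'" "\<And>l. k' \<le> l \<Longrightarrow> \<phi> l n b = \<phi> l q c" using 2 by (rule limit_rel_later) blast
    show "((m, a), (q, c)) \<in> limit_rel S \<phi>"
      using 1 2 k k' by (intro limit_relI[of _ _ _ _ "max k k'"]) (auto simp: limit_rel_def)
  qed
qed

lemma cl_eqI: "((m, a), (n, b)) \<in> limit_rel S \<phi> \<Longrightarrow> cl m a = cl n b"
  unfolding limit_class_def by (rule equiv_class_eq[OF equiv_limit_rel])

lemma mem_cl: "(n, b) \<in> cl m a \<longleftrightarrow> ((m, a), (n, b)) \<in> limit_rel S \<phi>"
  by (simp add: limit_class_def)

lemma cl_self: "a \<in> carrier_of (S m) \<Longrightarrow> (m, a) \<in> cl m a"
  by (auto simp: mem_cl intro: limit_relI)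

lemma cl_phi:
  assumes "m \<le> n" "a \<in> carrier_of (S m)"
  shows "cl n (\<phi> n m a) = cl m a"
  using assms by (intro cl_eqI limit_relI[of _ _ _ _ n]) (auto simp: phi_closed ident)

lemma carrier_L: "carrier_of L = {cl m a | m a. a \<in> carrier_of (S m)}"
  by (auto simp: algebraic_limit_def quotient_def limit_class_def)

lemma cl_in_carrier: "a \<in> carrier_of (S m) \<Longrightarrow> cl m a \<in> carrier_of L"
  by (auto simp: carrier_L)

text \<open>The eventual form allows finitely many elements to be moved to one algebra of the system.\<close>

lemma carrier_L_level:
  assumes "X \<in> carrier_of L"
  obtains k where "\<And>n. k \<le> n \<Longrightarrow> \<exists>a\<in>carrier_of (S n). X = cl n a"
proof -
  obtain m a where a: "a \<in> carrier_of (S m)" "X = cl m a" using assms by (auto simp: carrier_L)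
  have "\<exists>b\<in>carrier_of (S n). X = cl n b" if "m \<le> n" for n
    using cl_phi[OF that a(1)] phi_closed[OF that a(1)] a(2) by (intro bexI[of _ "\<phi> n m a"]) auto
  then show thesis by (rule that)
qed

text \<open>
  Two representatives of a class become equal from some index on, so both sides can be compared in an
  algebra of the system that lies beyond all the indices involved.
\<close>

lemma binary_op_well_defined:
  assumes closed: "\<And>k a b. a \<in> carrier_of (S k) \<Longrightarrow> b \<in> carrier_of (S k) \<Longrightarrow> f k a b \<in> carrier_of (S k)"
    and pres: "\<And>m n a b. m \<le> n \<Longrightarrow> a \<in> carrier_of (S m) \<Longrightarrow> b \<in> carrier_of (S m) \<Longrightarrow> \<phi> n m (f m a b) = f n (\<phi> n m a) (\<phi> n m b)"
    and a: "a \<in> carrier_of (S q)" and b: "b \<in> carrier_of (S q)"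
  shows "(\<Union>(m, a')\<in>cl q a. \<Union>(n, b')\<in>cl q b. cl (max m n) (f (max m n) (\<phi> (max m n) m a') (\<phi> (max m n) n b'))) = cl q (f q a b)"
proof -
  have eq: "cl (max m n) (f (max m n) (\<phi> (max m n) m a') (\<phi> (max m n) n b')) = cl q (f q a b)"
    if a': "(m, a') \<in> cl q a" and b': "(n, b') \<in> cl q b" for m a' n b'
  proof -
    obtain k where k: "q \<le> k" "m \<le> k" "\<And>l. k \<le> l \<Longrightarrow> \<phi> l q a = \<phi> l m a'"
      using a' unfolding mem_cl by (rule limit_rel_later) blast
    obtain k' where k': "q \<le> k'" "n \<le> k'" "\<And>l. k' \<le> l \<Longrightarrow> \<phi> l q b = \<phi> l n b'"
      using b' unfolding mem_cl by (rule limit_rel_later) blast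
    have ca: "a' \<in> carrier_of (S m)" and cb: "b' \<in> carrier_of (S n)"
      using a' b' by (auto simp: mem_cl limit_rel_def)
    let ?l = "max k k'" and ?r = "max m n"
    have r: "\<phi> ?r m a' \<in> carrier_of (S ?r)" "\<phi> ?r n b' \<in> carrier_of (S ?r)"
      using ca cb by (auto intro: phi_closed)
    have "\<phi> ?l ?r (f ?r (\<phi> ?r m a') (\<phi> ?r n b')) = f ?l (\<phi> ?l m a') (\<phi> ?l n b')"
    proof -
      have le: "m \<le> ?r" "n \<le> ?r" "?r \<le> ?l" using k k' by auto
      then show ?thesis using pres[OF le(3) r] comp[OF le(1,3) ca] comp[OF le(2,3) cb] by (simp only:)
    qed
    also have "\<dots> = \<phi> ?l q (f q a b)"
      using pres[OF _ a b, of ?l] k k' by simp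
    finally show ?thesis
      using k k' r a b by (intro cl_eqI limit_relI[of _ _ _ _ ?l] closed) auto
  qed
  have "(\<Union>(m, a')\<in>cl q a. \<Union>(n, b')\<in>cl q b. cl (max m n) (f (max m n) (\<phi> (max m n) m a') (\<phi> (max m n) n b')))
      = (\<Union>x\<in>cl q a. \<Union>y\<in>cl q b. cl q (f q a b))"
  proof (intro SUP_cong refl)
    fix x assume x: "x \<in> cl q a"
    show "(case x of (m, a') \<Rightarrow> \<Union>(n, b')\<in>cl q b. cl (max m n) (f (max m n) (\<phi> (max m n) m a') (\<phi> (max m n) n b')))
        = (\<Union>y\<in>cl q b. cl q (f q a b))"
    proof (cases x)
      case (Pair m a')
      have "(case y of (n, b') \<Rightarrow> cl (max m n) (f (max m n) (\<phi> (max m n) m a') (\<phi> (max m n) n b'))) = cl q (f q a b)"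
        if "y \<in> cl q b" for y
        using that x unfolding Pair by (cases y) (simp only: prod.case, rule eq)
      then show ?thesis unfolding Pair prod.case by (intro SUP_cong refl)
    qed
  qed
  also have "\<dots> = cl q (f q a b)" using cl_self[OF a] cl_self[OF b] by blast
  finally show ?thesis .
qed

lemma add_cl: "a \<in> carrier_of (S m) \<Longrightarrow> b \<in> carrier_of (S m) \<Longrightarrow> add_of L (cl m a) (cl m b) = cl m (add_of (S m) a b)"
  unfolding algebraic_limit_def nalg.simps nspace.simps
  by (rule binary_op_well_defined) (auto intro: closed_rules algebra_hom_add[OF hom])

lemma mult_cl: "a \<in> carrier_of (S m) \<Longrightarrow> b \<in> carrier_of (S m) \<Longrightarrow> mult_of L (cl m a) (cl m b) = cl m (mult_of (S m) a b)"
  unfolding algebraic_limit_def nalg.simps nspace.simps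
  by (rule binary_op_well_defined) (auto intro: closed_rules algebra_hom_mult[OF hom])

lemma scale_cl:
  assumes a: "a \<in> carrier_of (S q)"
  shows "scale_of L c (cl q a) = cl q (scale_of (S q) c a)"
proof -
  have eq: "cl m (scale_of (S m) c a') = cl q (scale_of (S q) c a)" if a': "(m, a') \<in> cl q a" for m a'
  proof -
    obtain k where k: "q \<le> k" "m \<le> k" "\<And>l. k \<le> l \<Longrightarrow> \<phi> l q a = \<phi> l m a'"
      using a' unfolding mem_cl by (rule limit_rel_later) blast
    have ca: "a' \<in> carrier_of (S m)" using a' by (auto simp: mem_cl limit_rel_def)
    show ?thesis
      using k ca a by (intro cl_eqI limit_relI[of _ _ _ _ k])
        (auto simp: closed_rules algebra_hom_scale[OF hom])
  qed
  have "scale_of L c (cl q a) = (\<Union>(m, a')\<in>cl q a. cl m (scale_of (S m) c a'))"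
    by (simp add: algebraic_limit_def)
  also have "\<dots> = (\<Union>x\<in>cl q a. cl q (scale_of (S q) c a))"
  proof (rule SUP_cong[OF refl])
    fix x assume "x \<in> cl q a"
    then show "(case x of (m, a') \<Rightarrow> cl m (scale_of (S m) c a')) = cl q (scale_of (S q) c a)"
      by (cases x) (simp only: prod.case, rule eq)
  qed
  also have "\<dots> = cl q (scale_of (S q) c a)" using cl_self[OF a] by blast
  finally show ?thesis .
qed

lemma diff_cl: "a \<in> carrier_of (S m) \<Longrightarrow> b \<in> carrier_of (S m) \<Longrightarrow> diff_of L (cl m a) (cl m b) = cl m (diff_of (S m) a b)"
  by (simp add: diff_of_def scale_cl add_cl closed_rules)

definition limit_norm :: "nat \<Rightarrow> 'b \<Rightarrow> real" where
  "limit_norm m a = lim (\<lambda>n. norm_of (S n) (\<phi> n m a))"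

lemma limit_norm_tendsto:
  assumes a: "a \<in> carrier_of (S m)"
  shows "(\<lambda>n. norm_of (S n) (\<phi> n m a)) \<longlonglongrightarrow> limit_norm m a"
proof -
  let ?s = "\<lambda>n. norm_of (S (n + m)) (\<phi> (n + m) m a)"
  have "decseq ?s"
  proof (rule decseq_SucI)
    fix n
    have "\<phi> (Suc n + m) (n + m) (\<phi> (n + m) m a) = \<phi> (Suc n + m) m a" using a by (intro comp) auto
    then show "?s (Suc n) \<le> ?s n"
      using phi_contractive[of "n + m" "Suc n + m" "\<phi> (n + m) m a"] phi_closed[of m "n + m" a] a by simp
  qed
  moreover have "0 \<le> ?s n" for n
    using complex_normed_space.norm_nonneg[OF normed_space] phi_closed[of m "n + m" a] a by simp
  ultimately have "convergent ?s"
    by (intro Bseq_monoseq_convergent decseq_bounded[of _ 0]) (auto simp: monoseq_iff)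
  then obtain l where "?s \<longlonglongrightarrow> l" by (auto simp: convergent_def)
  then have "(\<lambda>n. norm_of (S n) (\<phi> n m a)) \<longlonglongrightarrow> l" by (rule LIMSEQ_offset)
  then show ?thesis by (simp add: limit_norm_def limI)
qed

lemma limit_norm_eqI:
  assumes "a \<in> carrier_of (S m)" "b \<in> carrier_of (S n)" "\<And>l. k \<le> l \<Longrightarrow> \<phi> l m a = \<phi> l n b"
  shows "limit_norm m a = limit_norm n b"
proof (rule LIMSEQ_unique[OF limit_norm_tendsto[OF assms(1)]])
  have "eventually (\<lambda>l. norm_of (S l) (\<phi> l n b) = norm_of (S l) (\<phi> l m a)) sequentially"
    unfolding eventually_sequentially using assms(3) by (intro exI[of _ k]) simp
  then show "(\<lambda>l. norm_of (S l) (\<phi> l m a)) \<longlonglongrightarrow> limit_norm n b"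
    using limit_norm_tendsto[OF assms(2)] by (rule Lim_transform_eventually[rotated])
qed

lemma norm_cl:
  assumes a: "a \<in> carrier_of (S m)"
  shows "norm_of L (cl m a) = limit_norm m a"
proof -
  obtain n b where nb: "(SOME x. x \<in> cl m a) = (n, b)" by (metis surj_pair)
  have "(n, b) \<in> cl m a" unfolding nb[symmetric] using cl_self[OF a] by (auto simp: some_in_eq)
  then have r: "((m, a), (n, b)) \<in> limit_rel S \<phi>" by (simp add: mem_cl)
  then obtain k where "\<And>l. k \<le> l \<Longrightarrow> \<phi> l m a = \<phi> l n b" by (rule limit_rel_later) blast
  moreover have "b \<in> carrier_of (S n)" using r by (auto simp: limit_rel_def)
  ultimately have "limit_norm m a = limit_norm n b" using a by (intro limit_norm_eqI)
  then show ?thesis by (simp add: algebraic_limit_def nb limit_norm_def)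
qed

lemma limit_norm_le: "a \<in> carrier_of (S m) \<Longrightarrow> limit_norm m a \<le> norm_of (S m) a"
  by (rule LIMSEQ_le_const2[OF limit_norm_tendsto]) (auto intro: phi_contractive)

lemma limit_norm_nonneg: "a \<in> carrier_of (S m) \<Longrightarrow> 0 \<le> limit_norm m a"
  by (rule LIMSEQ_le_const[OF limit_norm_tendsto])
    (auto intro!: exI[of _ m] complex_normed_space.norm_nonneg[OF normed_space] phi_closed)

lemma limit_norm_add:
  assumes "a \<in> carrier_of (S m)" "b \<in> carrier_of (S m)"
  shows "limit_norm m (add_of (S m) a b) \<le> limit_norm m a + limit_norm m b"
  using assms
  by (intro LIMSEQ_le[OF limit_norm_tendsto tendsto_add[OF limit_norm_tendsto limit_norm_tendsto]] exI[of _ m])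
    (auto simp: closed_rules algebra_hom_add[OF hom] intro!: complex_normed_space.norm_triangle[OF normed_space] phi_closed)

lemma limit_norm_mult:
  assumes "a \<in> carrier_of (S m)" "b \<in> carrier_of (S m)"
  shows "limit_norm m (mult_of (S m) a b) \<le> limit_norm m a * limit_norm m b"
  using assms
  by (intro LIMSEQ_le[OF limit_norm_tendsto tendsto_mult[OF limit_norm_tendsto limit_norm_tendsto]] exI[of _ m])
    (auto simp: closed_rules algebra_hom_mult[OF hom] intro!: complex_normed_algebra.norm_mult[OF algebra] phi_closed)

lemma limit_norm_scale:
  assumes a: "a \<in> carrier_of (S m)"
  shows "limit_norm m (scale_of (S m) c a) = cmod c * limit_norm m a"
proof (rule LIMSEQ_unique[OF limit_norm_tendsto])
  show "scale_of (S m) c a \<in> carrier_of (S m)" using a by (simp add: closed_rules)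
  have "eventually (\<lambda>n. cmod c * norm_of (S n) (\<phi> n m a) = norm_of (S n) (\<phi> n m (scale_of (S m) c a))) sequentially"
    unfolding eventually_sequentially using a
    by (intro exI[of _ m]) (auto simp: algebra_hom_scale[OF hom] complex_normed_space.norm_scale[OF normed_space] phi_closed)
  then show "(\<lambda>n. norm_of (S n) (\<phi> n m (scale_of (S m) c a))) \<longlonglongrightarrow> cmod c * limit_norm m a"
    by (rule Lim_transform_eventually[rotated]) (intro tendsto_mult tendsto_const limit_norm_tendsto a)
qed

abbreviation Q where "Q \<equiv> null_quotient L"

text \<open>
  The relation of \<open>null_rel\<close> between elements of one algebra of the system. It is a congruence because
  \<open>limit_norm m\<close> is a submultiplicative seminorm.
\<close>

definition null :: "nat \<Rightarrow> 'b \<Rightarrow> 'b \<Rightarrow> bool" where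
  "null m a b \<longleftrightarrow> a \<in> carrier_of (S m) \<and> b \<in> carrier_of (S m) \<and> limit_norm m (diff_of (S m) a b) = 0"

lemma null_rel_cl:
  "a \<in> carrier_of (S m) \<Longrightarrow> b \<in> carrier_of (S m) \<Longrightarrow> (cl m a, cl m b) \<in> null_rel L \<longleftrightarrow> null m a b"
  by (simp add: null_rel_def null_def cl_in_carrier diff_cl norm_cl closed_rules)

lemma null_refl: "a \<in> carrier_of (S m) \<Longrightarrow> null m a a"
  using limit_norm_scale[of a m 0] complex_normed_space.diff_flip[OF normed_space, of a m a]
    complex_normed_space.add_scale[OF normed_space, of a m 1 "-1"]
    complex_normed_space.scale_one[OF normed_space, of a m]
  by (simp add: null_def diff_of_def)

lemma null_sym: "null m a b \<Longrightarrow> null m b a"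
  using complex_normed_space.diff_flip[OF normed_space, of a m b]
  by (auto simp: null_def limit_norm_scale closed_rules)

lemma null_add:
  assumes "null m a a'" "null m b b'"
  shows "null m (add_of (S m) a b) (add_of (S m) a' b')"
proof -
  have c: "a \<in> carrier_of (S m)" "a' \<in> carrier_of (S m)" "b \<in> carrier_of (S m)" "b' \<in> carrier_of (S m)"
    using assms by (auto simp: null_def)
  have "limit_norm m (diff_of (S m) (add_of (S m) a b) (add_of (S m) a' b')) \<le> 0"
    using limit_norm_add[of "diff_of (S m) a a'" m "diff_of (S m) b b'"] assms c
    by (simp add: complex_normed_space.diff_add[OF normed_space] null_def closed_rules)
  then show ?thesis
    using limit_norm_nonneg[of "diff_of (S m) (add_of (S m) a b) (add_of (S m) a' b')" m] c
    by (simp add: null_def closed_rules)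
qed

lemma null_trans:
  assumes "null m a b" "null m b c"
  shows "null m a c"
proof -
  have c: "a \<in> carrier_of (S m)" "b \<in> carrier_of (S m)" "c \<in> carrier_of (S m)"
    using assms by (auto simp: null_def)
  have "limit_norm m (diff_of (S m) a c) \<le> 0"
    using limit_norm_add[of "diff_of (S m) a b" m "diff_of (S m) b c"] assms c
    by (simp add: complex_normed_space.diff_add_cancel_middle[OF normed_space] null_def closed_rules)
  then show ?thesis
    using limit_norm_nonneg[of "diff_of (S m) a c" m] c by (simp add: null_def closed_rules)
qed

lemma null_scale: "null m a b \<Longrightarrow> null m (scale_of (S m) c a) (scale_of (S m) c b)"
  by (simp add: null_def closed_rules complex_normed_space.diff_scale[OF normed_space] limit_norm_scale)

lemma null_mult:
  assumes "null m a a'" "null m b b'"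
  shows "null m (mult_of (S m) a b) (mult_of (S m) a' b')"
proof -
  have c: "a \<in> carrier_of (S m)" "a' \<in> carrier_of (S m)" "b \<in> carrier_of (S m)" "b' \<in> carrier_of (S m)"
    using assms by (auto simp: null_def)
  have z: "limit_norm m (diff_of (S m) a a') = 0" "limit_norm m (diff_of (S m) b b') = 0"
    using assms by (auto simp: null_def)
  have "limit_norm m (diff_of (S m) (mult_of (S m) a b) (mult_of (S m) a' b'))
      \<le> limit_norm m (mult_of (S m) (diff_of (S m) a a') b) + limit_norm m (mult_of (S m) a' (diff_of (S m) b b'))"
    using c limit_norm_add by (simp add: complex_normed_algebra.diff_mult[OF algebra] closed_rules)
  also have "\<dots> \<le> 0"
    using limit_norm_mult[of "diff_of (S m) a a'" m b] limit_norm_mult[of a' m "diff_of (S m) b b'"] z c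
    by (simp add: closed_rules)
  finally show ?thesis
    using limit_norm_nonneg[of "diff_of (S m) (mult_of (S m) a b) (mult_of (S m) a' b')" m] c
    by (simp add: null_def closed_rules)
qed

lemma null_norm: "null m a b \<Longrightarrow> limit_norm m a = limit_norm m b"
proof -
  have le: "limit_norm m a \<le> limit_norm m b" if n: "null m a b" for a b
  proof -
    have c: "a \<in> carrier_of (S m)" "b \<in> carrier_of (S m)" using n by (auto simp: null_def)
    interpret complex_normed_space "S m" by (rule normed_space)
    have "add_of (S m) (diff_of (S m) a b) b = a"
    proof -
      have "add_of (S m) (diff_of (S m) a b) b = add_of (S m) a (diff_of (S m) b b)"
        using c by (simp add: diff_of_def add_ac scale_closed add_closed)
      then show ?thesis using c by (simp add: diff_self add_zero)
    qed
    then show ?thesis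
      using limit_norm_add[of "diff_of (S m) a b" m b] n c by (simp add: null_def closed_rules)
  qed
  show "null m a b \<Longrightarrow> limit_norm m a = limit_norm m b"
    using le null_sym by (intro antisym) auto
qed

lemma equiv_null_rel: "equiv (carrier_of L) (null_rel L)"
proof (rule equivI)
  show "null_rel L \<subseteq> carrier_of L \<times> carrier_of L" by (auto simp: null_rel_def)
  show "refl_on (carrier_of L) (null_rel L)"
    using null_refl null_rel_cl by (auto simp: refl_on_def carrier_L)
  show "sym (null_rel L)"
  proof (rule symI)
    fix X Y assume XY: "(X, Y) \<in> null_rel L"
    then have "X \<in> carrier_of L" "Y \<in> carrier_of L" by (auto simp: null_rel_def)
    then obtain k k' where k: "\<And>n. k \<le> n \<Longrightarrow> \<exists>a\<in>carrier_of (S n). X = cl n a"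
      "\<And>n. k' \<le> n \<Longrightarrow> \<exists>a\<in>carrier_of (S n). Y = cl n a" by (metis carrier_L_level)
    let ?n = "max k k'"
    obtain a b where ab: "a \<in> carrier_of (S ?n)" "X = cl ?n a" "b \<in> carrier_of (S ?n)" "Y = cl ?n b"
      using k(1)[of ?n] k(2)[of ?n] by auto
    show "(Y, X) \<in> null_rel L" using XY ab null_sym[of ?n a b] by (simp add: null_rel_cl)
  qed
  show "trans (null_rel L)"
  proof (rule transI)
    fix X Y Z assume XY: "(X, Y) \<in> null_rel L" and YZ: "(Y, Z) \<in> null_rel L"
    then have "X \<in> carrier_of L" "Y \<in> carrier_of L" "Z \<in> carrier_of L" by (auto simp: null_rel_def)
    then obtain k k' k'' where k: "\<And>n. k \<le> n \<Longrightarrow> \<exists>a\<in>carrier_of (S n). X = cl n a"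
      "\<And>n. k' \<le> n \<Longrightarrow> \<exists>a\<in>carrier_of (S n). Y = cl n a"
      "\<And>n. k'' \<le> n \<Longrightarrow> \<exists>a\<in>carrier_of (S n). Z = cl n a" by (metis carrier_L_level)
    let ?n = "max k (max k' k'')"
    obtain a b c where ab: "a \<in> carrier_of (S ?n)" "X = cl ?n a" "b \<in> carrier_of (S ?n)" "Y = cl ?n b"
      "c \<in> carrier_of (S ?n)" "Z = cl ?n c"
      using k(1)[of ?n, OF max.cobounded1] k(2)[of ?n, OF max.coboundedI2, OF max.cobounded1]
        k(3)[of ?n, OF max.coboundedI2, OF max.cobounded2] by blast
    have "null ?n a b" "null ?n b c" using XY YZ ab by (simp_all add: null_rel_cl)
    then have "null ?n a c" by (rule null_trans)
    then show "(X, Z) \<in> null_rel L" using ab by (simp add: null_rel_cl)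
  qed
qed

definition to_limit :: "nat \<Rightarrow> 'b \<Rightarrow> (nat \<times> 'b) set set" where
  "to_limit m a = null_rel L `` {cl m a}"

lemma to_limit_eqI: "null m a b \<Longrightarrow> to_limit m a = to_limit m b"
  unfolding to_limit_def by (rule equiv_class_eq[OF equiv_null_rel]) (auto simp: null_rel_cl null_def)

lemma to_limit_phi: "m \<le> n \<Longrightarrow> a \<in> carrier_of (S m) \<Longrightarrow> to_limit n (\<phi> n m a) = to_limit m a"
  by (simp add: to_limit_def cl_phi)

lemma carrier_Q: "carrier_of Q = {to_limit m a | m a. a \<in> carrier_of (S m)}"
  by (auto simp: null_quotient_def quotient_def to_limit_def carrier_L)

lemma to_limit_representative:
  assumes "X \<in> to_limit m a" "a \<in> carrier_of (S m)"
  obtains k where "m \<le> k" "\<And>n. k \<le> n \<Longrightarrow> \<exists>a'. X = cl n a' \<and> null n (\<phi> n m a) a'"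
proof -
  have r: "(cl m a, X) \<in> null_rel L" using assms by (simp add: to_limit_def)
  then have "X \<in> carrier_of L" by (auto simp: null_rel_def)
  then obtain k where k: "\<And>n. k \<le> n \<Longrightarrow> \<exists>a\<in>carrier_of (S n). X = cl n a" by (rule carrier_L_level) blast
  have "\<exists>a'. X = cl n a' \<and> null n (\<phi> n m a) a'" if n: "max k m \<le> n" for n
  proof -
    obtain a' where a': "a' \<in> carrier_of (S n)" "X = cl n a'" using k[of n] n by auto
    have "(cl n (\<phi> n m a), cl n a') \<in> null_rel L" using r a' cl_phi[of m n a] n assms by simp
    then show ?thesis using a' n assms by (auto simp: null_rel_cl phi_closed)
  qed
  then show thesis using that[of "max k m"] by simp
qed

lemma binary_op_to_limit:
  assumes op_cl: "\<And>k a b. a \<in> carrier_of (S k) \<Longrightarrow> b \<in> carrier_of (S k) \<Longrightarrow> op (cl k a) (cl k b) = cl k (f k a b)"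
    and closed: "\<And>k a b. a \<in> carrier_of (S k) \<Longrightarrow> b \<in> carrier_of (S k) \<Longrightarrow> f k a b \<in> carrier_of (S k)"
    and pres: "\<And>m n a b. m \<le> n \<Longrightarrow> a \<in> carrier_of (S m) \<Longrightarrow> b \<in> carrier_of (S m) \<Longrightarrow> \<phi> n m (f m a b) = f n (\<phi> n m a) (\<phi> n m b)"
    and null_op: "\<And>k a a' b b'. null k a a' \<Longrightarrow> null k b b' \<Longrightarrow> null k (f k a b) (f k a' b')"
    and a: "a \<in> carrier_of (S m)" and b: "b \<in> carrier_of (S m)"
  shows "(\<Union>X\<in>to_limit m a. \<Union>Y\<in>to_limit m b. null_rel L `` {op X Y}) = to_limit m (f m a b)"
proof -
  have "null_rel L `` {op X Y} = to_limit m (f m a b)" if X: "X \<in> to_limit m a" and Y: "Y \<in> to_limit m b" for X Y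
  proof -
    obtain k where k: "m \<le> k" "\<And>n. k \<le> n \<Longrightarrow> \<exists>a'. X = cl n a' \<and> null n (\<phi> n m a) a'"
      using X a by (rule to_limit_representative) blast
    obtain k' where k': "m \<le> k'" "\<And>n. k' \<le> n \<Longrightarrow> \<exists>b'. Y = cl n b' \<and> null n (\<phi> n m b) b'"
      using Y b by (rule to_limit_representative) blast
    let ?n = "max k k'"
    have mn: "m \<le> ?n" using k by auto
    obtain a' b' where ab: "X = cl ?n a'" "null ?n (\<phi> ?n m a) a'" "Y = cl ?n b'" "null ?n (\<phi> ?n m b) b'"
      using k(2)[of ?n] k'(2)[of ?n] by auto
    then have "null_rel L `` {op X Y} = to_limit ?n (f ?n a' b')"
      by (simp add: op_cl null_def to_limit_def)
    also have "\<dots> = to_limit ?n (f ?n (\<phi> ?n m a) (\<phi> ?n m b))"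
      by (rule to_limit_eqI[symmetric]) (rule null_op[OF ab(2,4)])
    also have "\<dots> = to_limit m (f m a b)"
      using to_limit_phi[OF mn closed[OF a b]] pres[OF mn a b] by simp
    finally show ?thesis .
  qed
  then have "(\<Union>X\<in>to_limit m a. \<Union>Y\<in>to_limit m b. null_rel L `` {op X Y})
      = (\<Union>X\<in>to_limit m a. \<Union>Y\<in>to_limit m b. to_limit m (f m a b))" by simp
  also have "\<dots> = to_limit m (f m a b)"
    using equiv_class_self[OF equiv_null_rel cl_in_carrier[OF a]] equiv_class_self[OF equiv_null_rel cl_in_carrier[OF b]]
    unfolding to_limit_def by blast
  finally show ?thesis .
qed

lemma add_to_limit:
  "a \<in> carrier_of (S m) \<Longrightarrow> b \<in> carrier_of (S m) \<Longrightarrow> add_of Q (to_limit m a) (to_limit m b) = to_limit m (add_of (S m) a b)"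
  unfolding null_quotient_def nalg.simps nspace.simps
  by (rule binary_op_to_limit[where op = "add_of L" and f = "\<lambda>k. add_of (S k)", OF add_cl]) (auto intro: closed_rules algebra_hom_add[OF hom] null_add)

lemma mult_to_limit:
  "a \<in> carrier_of (S m) \<Longrightarrow> b \<in> carrier_of (S m) \<Longrightarrow> mult_of Q (to_limit m a) (to_limit m b) = to_limit m (mult_of (S m) a b)"
  unfolding null_quotient_def nalg.simps nspace.simps
  by (rule binary_op_to_limit[where op = "mult_of L" and f = "\<lambda>k. mult_of (S k)", OF mult_cl]) (auto intro: closed_rules algebra_hom_mult[OF hom] null_mult)

lemma scale_to_limit:
  assumes a: "a \<in> carrier_of (S m)"
  shows "scale_of Q c (to_limit m a) = to_limit m (scale_of (S m) c a)"
proof -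
  have "null_rel L `` {scale_of L c X} = to_limit m (scale_of (S m) c a)" if X: "X \<in> to_limit m a" for X
  proof -
    obtain k where k: "m \<le> k" "\<And>n. k \<le> n \<Longrightarrow> \<exists>a'. X = cl n a' \<and> null n (\<phi> n m a) a'"
      using X a by (rule to_limit_representative) blast
    obtain a' where ab: "X = cl k a'" "null k (\<phi> k m a) a'" using k(2)[of k] by auto
    then have "null_rel L `` {scale_of L c X} = to_limit k (scale_of (S k) c a')"
      by (simp add: scale_cl null_def to_limit_def)
    also have "\<dots> = to_limit k (scale_of (S k) c (\<phi> k m a))"
      by (rule to_limit_eqI[symmetric]) (rule null_scale[OF ab(2)])
    also have "\<dots> = to_limit m (scale_of (S m) c a)"
      using to_limit_phi[OF k(1), of "scale_of (S m) c a"] a algebra_hom_scale[OF hom[OF k(1)] a] by (simp add: closed_rules)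
    finally show ?thesis .
  qed
  then have "scale_of Q c (to_limit m a) = (\<Union>X\<in>to_limit m a. to_limit m (scale_of (S m) c a))"
    by (simp add: null_quotient_def)
  also have "\<dots> = to_limit m (scale_of (S m) c a)"
    using equiv_class_self[OF equiv_null_rel cl_in_carrier[OF a]] unfolding to_limit_def by blast
  finally show ?thesis .
qed

lemma norm_to_limit:
  assumes a: "a \<in> carrier_of (S m)"
  shows "norm_of Q (to_limit m a) = limit_norm m a"
proof -
  let ?X = "SOME X. X \<in> to_limit m a"
  have "cl m a \<in> to_limit m a"
    using equiv_class_self[OF equiv_null_rel cl_in_carrier[OF a]] by (simp add: to_limit_def)
  then have "?X \<in> to_limit m a" by (auto simp only: some_in_eq)
  then obtain k where k: "m \<le> k" "\<And>n. k \<le> n \<Longrightarrow> \<exists>a'. ?X = cl n a' \<and> null n (\<phi> n m a) a'"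
    using a by (rule to_limit_representative) blast
  obtain a' where a': "?X = cl k a'" "null k (\<phi> k m a) a'" using k(2)[of k] by auto
  have "norm_of L ?X = limit_norm k a'"
    using a'(2) unfolding a'(1) by (intro norm_cl) (simp add: null_def)
  also have "\<dots> = limit_norm k (\<phi> k m a)" using null_norm[OF a'(2)] by simp
  also have "\<dots> = limit_norm m a"
    using k(1) a by (intro limit_norm_eqI[of _ _ _ _ k]) (auto simp: phi_closed comp)
  finally show ?thesis by (simp add: null_quotient_def)
qed

lemma to_limit_hom: "algebra_hom (S m) Q (to_limit m)"
  unfolding algebra_hom_def by (auto simp: carrier_Q add_to_limit scale_to_limit mult_to_limit)

lemma to_limit_contractive: "contractive (S m) Q (to_limit m)"
  by (simp add: contractive_def norm_to_limit limit_norm_le)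

end

section \<open>Uniqueness of the matrix norms\<close>

text \<open>
  This is how the limit enters the comparison of norms: the finitely many entries of a matrix are
  simultaneously close to the image of one direct sum of matrix algebras.
\<close>

definition block_approximable :: "real \<Rightarrow> ('a, 'm) nalg_scheme \<Rightarrow> bool" where
  "block_approximable p A \<longleftrightarrow> (\<forall>(n :: nat) x \<epsilon>. (\<forall>i\<in>{1..n}. \<forall>j\<in>{1..n}. x i j \<in> carrier_of A) \<and> 0 < \<epsilon> \<longrightarrow>
     (\<exists>blocks sz \<tau> a. 0 < blocks \<and> (\<forall>k\<in>{1..blocks}. 0 < sz k) \<and>
        algebra_hom (block_algebra p blocks sz) A \<tau> \<and> contractive (block_algebra p blocks sz) A \<tau> \<and>
        (\<forall>i\<in>{1..n}. \<forall>j\<in>{1..n}.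
           norm_of A (diff_of A (x i j) (\<tau> (block_element p blocks sz (a i j)))) < \<epsilon>)))"

lemma contractive_comp:
  assumes "algebra_hom A B f" "contractive A B f" "contractive B C g"
  shows "contractive A C (g \<circ> f)"
  using assms by (auto simp: contractive_def intro: order_trans algebra_hom_closed)

lemma isometric_homD:
  assumes "isometric_hom A B f"
  shows "algebra_hom A B f" "contractive A B f"
  using assms by (auto simp: isometric_hom_def contractive_def)

context lp_exponent
begin

lemma block_approximable_AF:
  assumes "spatial_Lp_AF_algebra TYPE('b) p A"
  shows "complex_normed_space A" and "block_approximable p A"
proof -
  obtain S :: "nat \<Rightarrow> 'b nalg" and \<phi> where sys: "spatial_AF_system p S \<phi>"
    and compl: "is_completion (null_quotient (algebraic_limit S \<phi>)) A"
    using assms by (auto simp: spatial_Lp_AF_algebra_def)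
  have fd: "spatial_fd_algebra p (S m)" for m
    using sys by (simp add: spatial_AF_system_def)
  interpret normed_algebra_system S \<phi>
  proof (rule normed_algebra_system.intro)
    show "complex_normed_algebra (S m)" for m
      using fd[of m] by (auto simp: spatial_fd_algebra_def dest: banach_algebra.axioms(1))
    show "algebra_hom (S m) (S n) (\<phi> n m)" if "m \<le> n" for m n
      using sys that by (simp add: spatial_AF_system_def spatial_hom_def)
    show "contractive (S m) (S n) (\<phi> n m)" if "m \<le> n" for m n
      using sys that by (simp add: spatial_AF_system_def)
    show "\<phi> m m a = a" if "a \<in> carrier_of (S m)" for m a
      using sys that by (simp add: spatial_AF_system_def)
    show "\<phi> n m (\<phi> m k a) = \<phi> n k a" if "k \<le> m" "m \<le> n" "a \<in> carrier_of (S k)" for k m n a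
      using sys that by (auto simp: spatial_AF_system_def)
  qed
  have "complex_normed_algebra A"
    using compl by (auto simp: is_completion_def dest: banach_algebra.axioms(1))
  then show A: "complex_normed_space A" by (rule complex_normed_algebra.axioms(1))
  obtain \<iota> where \<iota>: "isometric_hom Q A \<iota>" and dense: "dense_in A (\<iota> ` carrier_of Q)"
    using compl by (auto simp: is_completion_def)
  define \<psi> where "\<psi> m = \<iota> \<circ> to_limit m" for m
  have \<psi>_hom: "algebra_hom (S m) A (\<psi> m)" for m
    unfolding \<psi>_def by (rule algebra_hom_comp[OF to_limit_hom isometric_homD(1)[OF \<iota>]])
  have \<psi>_contr: "contractive (S m) A (\<psi> m)" for m
    unfolding \<psi>_def by (rule contractive_comp[OF to_limit_hom to_limit_contractive isometric_homD(2)[OF \<iota>]])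
  have \<psi>_phi: "\<psi> n (\<phi> n m a) = \<psi> m a" if "m \<le> n" "a \<in> carrier_of (S m)" for m n a
    using that by (simp add: \<psi>_def to_limit_phi)
  show "block_approximable p A"
    unfolding block_approximable_def
  proof (intro allI impI, elim conjE)
    fix n :: nat and x :: "nat \<Rightarrow> nat \<Rightarrow> 'a" and \<epsilon> :: real
    assume x: "\<forall>i\<in>{1..n}. \<forall>j\<in>{1..n}. x i j \<in> carrier_of A" and \<epsilon>: "0 < \<epsilon>"
    have "\<exists>m a. a \<in> carrier_of (S m) \<and> norm_of A (diff_of A (x i j) (\<psi> m a)) < \<epsilon>"
      if "i \<in> {1..n}" "j \<in> {1..n}" for i j
    proof -
      have "\<exists>d\<in>\<iota> ` carrier_of Q. norm_of A (diff_of A (x i j) d) < \<epsilon>"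
        using dense x that \<epsilon> by (auto simp: dense_in_def)
      then show ?thesis by (auto simp: carrier_Q \<psi>_def)
    qed
    then obtain lev el where el: "el i j \<in> carrier_of (S (lev i j))" "norm_of A (diff_of A (x i j) (\<psi> (lev i j) (el i j))) < \<epsilon>"
      if "i \<in> {1..n}" "j \<in> {1..n}" for i j by metis
    define m where "m = Max ((\<lambda>(i, j). lev i j) ` ({1..n} \<times> {1..n}))"
    have m: "lev i j \<le> m" if "i \<in> {1..n}" "j \<in> {1..n}" for i j
      unfolding m_def using that by (intro Max_ge) auto
    obtain blocks sz \<theta> where \<theta>: "0 < blocks" "\<forall>k\<in>{1..blocks}. 0 < sz k" "isometric_iso (block_algebra p blocks sz) (S m) \<theta>"
      using fd[of m] by (auto simp: spatial_fd_algebra_def block_presentation_def)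
    have \<theta>_iso: "isometric_hom (block_algebra p blocks sz) (S m) \<theta>" and \<theta>_surj: "\<theta> ` carrier_of (block_algebra p blocks sz) = carrier_of (S m)"
      using \<theta>(3) by (auto simp: isometric_iso_def bij_betw_def)
    have "\<exists>a. \<phi> m (lev i j) (el i j) = \<theta> (block_element p blocks sz a)" if "i \<in> {1..n}" "j \<in> {1..n}" for i j
    proof -
      have "\<phi> m (lev i j) (el i j) \<in> \<theta> ` carrier_of (block_algebra p blocks sz)"
        unfolding \<theta>_surj by (intro phi_closed m el that)
      then show ?thesis using block_element_surj by fastforce
    qed
    then obtain a where a: "\<phi> m (lev i j) (el i j) = \<theta> (block_element p blocks sz (a i j))"
      if "i \<in> {1..n}" "j \<in> {1..n}" for i j by metis
    have "norm_of A (diff_of A (x i j) ((\<psi> m \<circ> \<theta>) (block_element p blocks sz (a i j)))) < \<epsilon>"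
      if ij: "i \<in> {1..n}" "j \<in> {1..n}" for i j
      using el(2)[OF ij] \<psi>_phi[OF m[OF ij] el(1)[OF ij]] by (simp add: a[OF ij])
    moreover have "algebra_hom (block_algebra p blocks sz) A (\<psi> m \<circ> \<theta>)"
      by (rule algebra_hom_comp[OF isometric_homD(1)[OF \<theta>_iso] \<psi>_hom])
    moreover have "contractive (block_algebra p blocks sz) A (\<psi> m \<circ> \<theta>)"
      by (rule contractive_comp[OF isometric_homD[OF \<theta>_iso] \<psi>_contr])
    ultimately show "\<exists>blocks sz \<tau> a. 0 < blocks \<and> (\<forall>k\<in>{1..blocks}. 0 < sz k) \<and>
        algebra_hom (block_algebra p blocks sz) A \<tau> \<and> contractive (block_algebra p blocks sz) A \<tau> \<and>
        (\<forall>i\<in>{1..n}. \<forall>j\<in>{1..n}. norm_of A (diff_of A (x i j) (\<tau> (block_element p blocks sz (a i j)))) < \<epsilon>)"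
      using \<theta>(1,2) by blast
  qed
qed

lemma Lp_norm_act_diff_le:
  assumes A: "complex_normed_space A" and \<pi>: "isometric_hom A (Lp_operators p M) \<pi>"
    and u: "u \<in> carrier_of A" and v: "v \<in> carrier_of A" and f: "f \<in> Lp_functions p M"
  shows "Lp_norm p M (\<lambda>x. act p M (\<pi> u) f x - act p M (\<pi> v) f x) \<le> norm_of A (diff_of A u v) * Lp_norm p M f"
proof -
  let ?L = "Lp_operators p M"
  note hom = isometric_homD(1)[OF \<pi>]
  interpret complex_normed_space A by (rule A)
  have c: "\<pi> u \<in> carrier_of ?L" "\<pi> v \<in> carrier_of ?L" "\<pi> (diff_of A u v) \<in> carrier_of ?L"
    using u v by (auto intro!: algebra_hom_closed[OF hom] diff_closed)
  have sc: "scale_of ?L (- 1) (\<pi> v) \<in> carrier_of ?L"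
    using algebra_hom_closed[OF hom scale_closed[OF v]] algebra_hom_scale[OF hom v] by simp
  have "\<pi> (diff_of A u v) = add_of ?L (\<pi> u) (scale_of ?L (- 1) (\<pi> v))"
    using algebra_hom_diff[OF hom A u v] by (simp add: diff_of_def)
  then have "AE x in M. act p M (\<pi> (diff_of A u v)) f x = act p M (\<pi> u) f x + act p M (scale_of ?L (- 1) (\<pi> v)) f x"
    using act_add[OF c(1) sc f] by simp
  then have "AE x in M. act p M (\<pi> u) f x - act p M (\<pi> v) f x = act p M (\<pi> (diff_of A u v)) f x"
    using act_scale_op[OF c(2) f, of "- 1"] by eventually_elim simp
  then have "Lp_norm p M (\<lambda>x. act p M (\<pi> u) f x - act p M (\<pi> v) f x) = Lp_norm p M (act p M (\<pi> (diff_of A u v)) f)"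
    by (intro Lp_norm_cong_AE Lp_diff act_closed c f)
  also have "\<dots> \<le> norm_of ?L (\<pi> (diff_of A u v)) * Lp_norm p M f" by (rule Lp_norm_act_le[OF c(3) f])
  also have "norm_of ?L (\<pi> (diff_of A u v)) = norm_of A (diff_of A u v)"
    using \<pi> diff_closed[OF u v] by (simp add: isometric_hom_def)
  finally show ?thesis .
qed

text \<open>
  Applied to the images of matrix units, this shows that any two isometric representations vanish on
  the same blocks, which is the hypothesis on kernels in \<open>matrix_bound_transfer\<close>.
\<close>

lemma act_vanishes_iff:
  assumes \<pi>: "isometric_hom A (Lp_operators p M) \<pi>" and u: "u \<in> carrier_of A"
  shows "(\<forall>f\<in>Lp_functions p M. Lp_integral p M (act p M (\<pi> u) f) = 0) \<longleftrightarrow> norm_of A u \<le> 0"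
proof -
  have c: "\<pi> u \<in> carrier_of (Lp_operators p M)"
    using algebra_hom_closed[OF isometric_homD(1)[OF \<pi>] u] .
  have "Lp_integral p M g = 0 \<longleftrightarrow> Lp_norm p M g \<le> 0" for g
    using Lp_norm_nonneg[of p M g] by (auto simp: Lp_norm_def)
  then have "(\<forall>f\<in>Lp_functions p M. Lp_integral p M (act p M (\<pi> u) f) = 0) \<longleftrightarrow> norm_of (Lp_operators p M) (\<pi> u) \<le> 0"
    using norm_operator_le_iff[OF c, of 0] by simp
  then show ?thesis using \<pi> u by (simp add: isometric_hom_def)
qed

text \<open>
  The bound for \<open>\<pi>\<close> passes to nearby entries in the image of a direct sum of matrix algebras, from there
  to \<open>\<sigma>\<close>, and back to the given entries; the two approximations cost \<open>n\<^sup>2\<delta>\<close> each.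
\<close>

lemma matrix_norm_le:
  fixes M :: "'x measure" and N :: "'y measure" and A :: "('a, 'm) nalg_scheme"
  assumes p: "p \<noteq> 2" and A: "complex_normed_space A" and approx: "block_approximable p A"
    and M: "sigma_finite_measure M" and N: "sigma_finite_measure N"
    and \<pi>: "isometric_hom A (Lp_operators p M) \<pi>" and \<sigma>: "isometric_hom A (Lp_operators p N) \<sigma>"
    and x: "\<And>i j. i \<in> {1..n} \<Longrightarrow> j \<in> {1..n} \<Longrightarrow> x i j \<in> carrier_of A"
    and b: "\<And>i j. i \<in> {1..n} \<Longrightarrow> j \<in> {1..n} \<Longrightarrow> b i j = \<pi> (x i j)"
    and c: "\<And>i j. i \<in> {1..n} \<Longrightarrow> j \<in> {1..n} \<Longrightarrow> c i j = \<sigma> (x i j)"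
  shows "matrix_norm p N n c \<le> matrix_norm p M n b"
proof -
  interpret AM: amplification p M n using M by (intro amplification.intro lp_exponent_axioms)
  interpret AN: amplification p N n using N by (intro amplification.intro lp_exponent_axioms)
  let ?L = "Lp_operators p M" and ?K = "Lp_operators p N" and ?C = "matrix_norm p M n b"
  have bL: "b i j \<in> carrier_of ?L" and cK: "c i j \<in> carrier_of ?K" if "i \<in> {1..n}" "j \<in> {1..n}" for i j
    using b[OF that] c[OF that] algebra_hom_closed[OF isometric_homD(1)[OF \<pi>] x[OF that]]
      algebra_hom_closed[OF isometric_homD(1)[OF \<sigma>] x[OF that]] by simp_all
  have C: "0 \<le> ?C" using bL by (rule AM.matrix_norm_nonneg)
  have bound: "matrix_bound p M n (\<lambda>i j. act p M (b i j)) (?C powr p)"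
    using AM.matrix_norm_le_iff[of b ?C] bL C by simp
  have step: "matrix_norm p N n c \<le> ?C + real n * (real n * \<delta>) + real n * (real n * \<delta>)" if \<delta>: "0 < \<delta>" for \<delta>
  proof -
    have "(\<forall>i\<in>{1..n}. \<forall>j\<in>{1..n}. x i j \<in> carrier_of A) \<and> 0 < \<delta>" using x \<delta> by blast
    then obtain blocks sz \<tau> a where blocks: "0 < blocks" and sz: "\<forall>k\<in>{1..blocks}. 0 < sz k"
      and \<tau>: "algebra_hom (block_algebra p blocks sz) A \<tau>" "contractive (block_algebra p blocks sz) A \<tau>"
      and near: "\<forall>i\<in>{1..n}. \<forall>j\<in>{1..n}. norm_of A (diff_of A (x i j) (\<tau> (block_element p blocks sz (a i j)))) < \<delta>"
      using approx[unfolded block_approximable_def, rule_format, of n x \<delta>] by blast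
    let ?y = "\<lambda>a. \<tau> (block_element p blocks sz a)"
    have y: "?y a \<in> carrier_of A" for a
      by (rule algebra_hom_closed[OF \<tau>(1) block_element_closed])
    have yL: "\<pi> (?y a) \<in> carrier_of ?L" and yK: "\<sigma> (?y a) \<in> carrier_of ?K" for a
      using algebra_hom_closed[OF isometric_homD(1)[OF \<pi>] y] algebra_hom_closed[OF isometric_homD(1)[OF \<sigma>] y] by auto
    have RM: "contractive_block_representation p M blocks sz (\<lambda>a. act p M (\<pi> (?y a)))"
      using contractive_block_representation_of_hom[OF p blocks algebra_hom_comp[OF \<tau>(1) isometric_homD(1)[OF \<pi>]]
        contractive_comp[OF \<tau> isometric_homD(2)[OF \<pi>]]] by simp
    have RN: "contractive_block_representation p N blocks sz (\<lambda>a. act p N (\<sigma> (?y a)))"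
      using contractive_block_representation_of_hom[OF p blocks algebra_hom_comp[OF \<tau>(1) isometric_homD(1)[OF \<sigma>]]
        contractive_comp[OF \<tau> isometric_homD(2)[OF \<sigma>]]] by simp
    let ?D = "?C + real n * (real n * \<delta>)"
    have "matrix_bound p M n (\<lambda>i j. act p M (\<pi> (?y (a i j)))) (?D powr p)"
    proof (rule AM.matrix_bound_perturb[OF _ _ _ C _ bound])
      fix i j f assume ij: "i \<in> {1..n}" "j \<in> {1..n}" and f: "f \<in> Lp_functions p M"
      show "act p M (b i j) f \<in> Lp_functions p M" using bL[OF ij] f by (rule act_closed)
      show "act p M (\<pi> (?y (a i j))) f \<in> Lp_functions p M" using yL f by (rule act_closed)
      have "Lp_norm p M (\<lambda>t. act p M (\<pi> (?y (a i j))) f t - act p M (b i j) f t)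
          \<le> norm_of A (diff_of A (?y (a i j)) (x i j)) * Lp_norm p M f"
        unfolding b[OF ij] by (rule Lp_norm_act_diff_le[OF A \<pi> y x[OF ij] f])
      also have "norm_of A (diff_of A (?y (a i j)) (x i j)) = norm_of A (diff_of A (x i j) (?y (a i j)))"
        by (rule complex_normed_space.norm_diff_comm[OF A y x[OF ij]])
      also have "\<dots> * Lp_norm p M f \<le> \<delta> * Lp_norm p M f"
        using near ij by (intro mult_right_mono) (auto intro: less_imp_le)
      finally show "Lp_norm p M (\<lambda>t. act p M (\<pi> (?y (a i j))) f t - act p M (b i j) f t) \<le> \<delta> * Lp_norm p M f" .
    qed (use \<delta> in simp)
    then have bN: "matrix_bound p N n (\<lambda>i j. act p N (\<sigma> (?y (a i j)))) (?D powr p)"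
    proof (rule matrix_bound_transfer[OF RM RN, rotated -1])
      show "0 < sz k" if "k \<in> {1..blocks}" for k using sz that by blast
      show "\<forall>f\<in>Lp_functions p N. Lp_integral p N (act p N (\<sigma> (?y (matrix_unit k 1 1))) f) = 0"
        if "\<forall>f\<in>Lp_functions p M. Lp_integral p M (act p M (\<pi> (?y (matrix_unit k 1 1))) f) = 0" for k
        using that unfolding act_vanishes_iff[OF \<pi> y] act_vanishes_iff[OF \<sigma> y] .
    qed simp
    have D: "0 \<le> ?D" using C \<delta> by simp
    have "matrix_bound p N n (\<lambda>i j. act p N (c i j)) ((?D + real n * (real n * \<delta>)) powr p)"
    proof (rule AN.matrix_bound_perturb[OF _ _ _ D _ bN])
      fix i j f assume ij: "i \<in> {1..n}" "j \<in> {1..n}" and f: "f \<in> Lp_functions p N"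
      show "act p N (c i j) f \<in> Lp_functions p N" using cK[OF ij] f by (rule act_closed)
      show "act p N (\<sigma> (?y (a i j))) f \<in> Lp_functions p N" using yK f by (rule act_closed)
      have "Lp_norm p N (\<lambda>t. act p N (c i j) f t - act p N (\<sigma> (?y (a i j))) f t)
          \<le> norm_of A (diff_of A (x i j) (?y (a i j))) * Lp_norm p N f"
        unfolding c[OF ij] by (rule Lp_norm_act_diff_le[OF A \<sigma> x[OF ij] y f])
      also have "\<dots> \<le> \<delta> * Lp_norm p N f"
        using near ij by (intro mult_right_mono) (auto intro: less_imp_le)
      finally show "Lp_norm p N (\<lambda>t. act p N (c i j) f t - act p N (\<sigma> (?y (a i j))) f t) \<le> \<delta> * Lp_norm p N f" .
    qed (use \<delta> in simp)
    moreover have "0 \<le> ?D + real n * (real n * \<delta>)" 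
      using \<delta> by (intro add_nonneg_nonneg[OF D] mult_nonneg_nonneg) auto
    ultimately show ?thesis using AN.matrix_norm_le_iff[where b = c, OF cK] by blast
  qed
  show ?thesis
  proof (rule field_le_epsilon)
    fix \<epsilon> :: real assume \<epsilon>: "0 < \<epsilon>"
    define \<delta> where "\<delta> = \<epsilon> / (2 * (real n * real n + 1))"
    have den: "0 < 2 * (real n * real n + 1)" by (simp add: add_nonneg_pos)
    have \<delta>: "0 < \<delta>" unfolding \<delta>_def using \<epsilon> den by (rule divide_pos_pos)
    have "(2 * (real n * real n + 1)) * \<delta> = \<epsilon>" unfolding \<delta>_def using den by simp
    then have "real n * (real n * \<delta>) + real n * (real n * \<delta>) \<le> \<epsilon>"
      using \<delta> by (simp add: algebra_simps)
    then show "matrix_norm p N n c \<le> ?C + \<epsilon>" using step[OF \<delta>] by linarith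
  qed
qed

end

theorem corollary9p12:
  fixes p :: real and A :: "'a nalg"
  assumes "1 \<le> p" and "p \<noteq> 2"
    and "spatial_Lp_AF_algebra TYPE('b) p A"
  shows "unique_Lp_operator_matrix_norms TYPE('x) TYPE('y) p A"
  unfolding unique_Lp_operator_matrix_norms_def isometric_representation_def completely_isometric_on_def
proof (intro allI impI, elim conjE)
  fix M :: "'x measure" and N :: "'y measure" and \<pi> \<sigma> b and n :: nat
  assume M: "sigma_finite_measure M" and N: "sigma_finite_measure N"
    and \<pi>: "isometric_hom A (Lp_operators p M) \<pi>" and \<sigma>: "isometric_hom A (Lp_operators p N) \<sigma>"
    and b: "\<forall>i\<in>{1..n}. \<forall>j\<in>{1..n}. b i j \<in> \<pi> ` carrier_of A"
  interpret lp_exponent p using assms(1) by unfold_locales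
  note A = block_approximable_AF[OF assms(3)]
  define x where "x i j = inv_into (carrier_of A) \<pi> (b i j)" for i j
  have x: "x i j \<in> carrier_of A" "b i j = \<pi> (x i j)" if "i \<in> {1..n}" "j \<in> {1..n}" for i j
    using b that unfolding x_def by (auto simp: inv_into_into f_inv_into_f)
  have "matrix_norm p N n (\<lambda>i j. \<sigma> (x i j)) = matrix_norm p M n b"
    by (intro antisym matrix_norm_le[OF assms(2) A M N \<pi> \<sigma> x] matrix_norm_le[OF assms(2) A N M \<sigma> \<pi> x(1) _ x(2)] refl)
  then show "matrix_norm p N n (\<lambda>i j. (\<sigma> \<circ> inv_into (carrier_of A) \<pi>) (b i j)) = matrix_norm p M n b"
    by (simp add: x_def)
qed

end
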